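(* Let $1<p<\infty$ and let $M$ be a smooth Riemannian manifold which satisfies $\mathrm{CZ}(p)$ and admits a sequence of Hessian cut-off functions. Let $u\in C^2(M)$ be a solution of the Poisson equation $\Delta u=f$. If $u,\ |\mathrm{grad}(u)|,\ f\in \mathsf{L}^p(M)$, then $|\mathrm{Hess}(u)|\in \mathsf{L}^p(M)$.
   Context: Manifolds are smooth and without boundary. $\mathsf{L}^p$-norms $\|\cdot\|_p$ are with respect to the Riemannian volume measure, pointwise norms are induced by the metric, $\mathrm{Hess}(u)=\nabla\mathrm{d}u$ with $\nabla$ the Levi-Civita connection, $\Delta u=-\mathrm{tr}(\mathrm{Hess}(u))$. $M$ satisfies $\mathrm{CZ}(p)$ if there are $C_1\ge0$, $C_2>0$ with $\|\mathrm{Hess}(v)\|_p\le C_1\|v\|_p+C_2\|\Delta v\|_p$ for all $v\in C^\infty_{\mathrm{c}}(M)$. $M$ admits a sequence $(\chi_n)\subset C^\infty_{\mathrm{c}}(M)$ of Hessian cut-off functions if: $0\le\chi_n\le1$ for all $n$; for every compact $K\subset M$ there is $n_0(K)$ with $\chi_n|_K=1$ for all $n\ge n_0(K)$; $\sup_{x\in M}|\mathrm{d}\chi_n(x)|_x\to0$ as $n\to\infty$; and $\sup_{x\in M}|\mathrm{Hess}(\chi_n)(x)|_x\to0$ as $n\to\infty$. *)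

theory Defs
  imports "HOL-Analysis.Analysis"
begin

section \<open>Functions of class $C^k$ on open subsets of Euclidean space\<close>

definition partial :: "'n::finite \<Rightarrow> (real^'n \<Rightarrow> 'b::real_normed_vector) \<Rightarrow> real^'n \<Rightarrow> 'b"
  where "partial i F z = frechet_derivative F (at z) (axis i 1)"

text \<open>Only meant for open \<open>S\<close>.\<close>

primrec Ck_on :: "nat \<Rightarrow> (real^'n::finite \<Rightarrow> 'b::real_normed_vector) \<Rightarrow> (real^'n) set \<Rightarrow> bool"
  where
    "Ck_on 0 F S \<longleftrightarrow> continuous_on S F"
  | "Ck_on (Suc k) F S \<longleftrightarrow> F differentiable_on S \<and> (\<forall>i. Ck_on k (partial i F) S)"


section \<open>Smooth manifolds\<close>

text \<open>
  The manifold is the whole type \<open>'a\<close>, of dimension \<open>CARD('n)\<close>; Hausdorffness and second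
  countability are imposed through the type classes of \<open>'a\<close>. A smooth structure is given by any
  smooth atlas, which need not be maximal: none of the notions below changes when the atlas is
  enlarged to the maximal one.
\<close>

type_synonym ('a, 'n) chart = "'a set \<times> ('a \<Rightarrow> real^'n)"

abbreviation chart_dom :: "('a, 'n::finite) chart \<Rightarrow> 'a set"
  where "chart_dom \<equiv> fst"

abbreviation chart_map :: "('a, 'n::finite) chart \<Rightarrow> 'a \<Rightarrow> real^'n"
  where "chart_map \<equiv> snd"

definition is_chart :: "('a::topological_space, 'n::finite) chart \<Rightarrow> bool"
  where "is_chart c \<longleftrightarrow>
    open (chart_dom c) \<and> open (chart_map c ` chart_dom c) \<and>
    (\<exists>\<psi>. homeomorphism (chart_dom c) (chart_map c ` chart_dom c) (chart_map c) \<psi>)"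

definition in_coords :: "('a, 'n::finite) chart \<Rightarrow> ('a \<Rightarrow> 'b) \<Rightarrow> real^'n \<Rightarrow> 'b"
  where "in_coords c f z = f (inv_into (chart_dom c) (chart_map c) z)"

definition smooth_atlas :: "('a::{t2_space,second_countable_topology}, 'n::finite) chart set \<Rightarrow> bool"
  where "smooth_atlas A \<longleftrightarrow>
    (\<forall>c\<in>A. is_chart c) \<and> (\<Union>c\<in>A. chart_dom c) = UNIV \<and>
    (\<forall>c\<in>A. \<forall>d\<in>A. \<forall>k. Ck_on k (in_coords c (chart_map d))
                          (chart_map c ` (chart_dom c \<inter> chart_dom d)))"

definition Ck_fun :: "('a, 'n::finite) chart set \<Rightarrow> nat \<Rightarrow> ('a \<Rightarrow> real) \<Rightarrow> bool"
  where "Ck_fun A k u \<longleftrightarrow> (\<forall>c\<in>A. Ck_on k (in_coords c u) (chart_map c ` chart_dom c))"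

definition smooth_compact_support ::
    "('a::topological_space, 'n::finite) chart set \<Rightarrow> ('a \<Rightarrow> real) \<Rightarrow> bool"
  where "smooth_compact_support A v \<longleftrightarrow> (\<forall>k. Ck_fun A k v) \<and> compact (closure {x. v x \<noteq> 0})"

text \<open>The partial derivative $\partial f/\partial x^i$ at a point \<open>x\<close> of the domain of the chart
  \<open>c\<close>, with respect to the coordinates of \<open>c\<close>.\<close>

definition coord_deriv :: "('a, 'n::finite) chart \<Rightarrow> 'n \<Rightarrow> ('a \<Rightarrow> 'b::real_normed_vector) \<Rightarrow> 'a \<Rightarrow> 'b"
  where "coord_deriv c i f x = partial i (in_coords c f) (chart_map c x)"

text \<open>$J_{ia} = \partial x^i/\partial y^a$, for the coordinates $x$ of \<open>c\<close> and $y$ of \<open>d\<close>.\<close>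

definition jacobian :: "('a, 'n::finite) chart \<Rightarrow> ('a, 'n) chart \<Rightarrow> 'a \<Rightarrow> real^'n^'n"
  where "jacobian c d x = (\<chi> i a. coord_deriv d a (\<lambda>y. chart_map c y $ i) x)"


section \<open>Riemannian metrics\<close>

text \<open>
  Tensor fields are represented by their components in the charts of the atlas: \<open>T c x\<close> holds the
  components at \<open>x\<close> in the coordinates of \<open>c\<close>, and is only meaningful for \<open>x \<in> chart_dom c\<close>. The
  last condition of the next definition is the transformation law of a covariant 2-tensor.
\<close>

type_synonym ('a, 'n) tensor1 = "('a, 'n) chart \<Rightarrow> 'a \<Rightarrow> real^'n"
type_synonym ('a, 'n) tensor2 = "('a, 'n) chart \<Rightarrow> 'a \<Rightarrow> real^'n^'n"

definition riemannian_metric ::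
    "('a, 'n::finite) chart set \<Rightarrow> ('a, 'n) tensor2 \<Rightarrow> bool"
  where "riemannian_metric A g \<longleftrightarrow>
    (\<forall>c\<in>A. \<forall>i j k. Ck_on k (in_coords c (\<lambda>x. g c x $ i $ j)) (chart_map c ` chart_dom c)) \<and>
    (\<forall>c\<in>A. \<forall>x\<in>chart_dom c. transpose (g c x) = g c x \<and> (\<forall>v. v \<noteq> 0 \<longrightarrow> v \<bullet> (g c x *v v) > 0)) \<and>
    (\<forall>c\<in>A. \<forall>d\<in>A. \<forall>x\<in>chart_dom c \<inter> chart_dom d.
        g d x = transpose (jacobian c d x) ** g c x ** jacobian c d x)"

definition riemannian_manifold ::
    "('a::{t2_space,second_countable_topology}, 'n::finite) chart set \<Rightarrow> ('a, 'n) tensor2 \<Rightarrow> bool"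
  where "riemannian_manifold A g \<longleftrightarrow> smooth_atlas A \<and> riemannian_metric A g"

text \<open>The unique Borel measure that in every chart has density $\sqrt{\det(g_{ij})}$ with respect
  to Lebesgue measure.\<close>

definition riemannian_volume ::
    "('a::topological_space, 'n::finite) chart set \<Rightarrow> ('a, 'n) tensor2 \<Rightarrow> 'a measure"
  where "riemannian_volume A g = (THE \<mu>. sets \<mu> = sets borel \<and>
    (\<forall>c\<in>A. \<forall>B\<in>sets borel. B \<subseteq> chart_dom c \<longrightarrow>
        emeasure \<mu> B =
          (\<integral>\<^sup>+ z\<in>chart_map c ` B. ennreal (sqrt (det (in_coords c (g c) z))) \<partial>lborel)))"

text \<open>Some chart around \<open>x\<close>, in which pointwise norms and traces are evaluated; for tensors, the
  values obtained do not depend on the choice.\<close>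

definition chart_at :: "('a, 'n::finite) chart set \<Rightarrow> 'a \<Rightarrow> ('a, 'n) chart"
  where "chart_at A x = (SOME c. c \<in> A \<and> x \<in> chart_dom c)"

definition vector_norm ::
    "('a, 'n::finite) chart set \<Rightarrow> ('a, 'n) tensor2 \<Rightarrow> ('a, 'n) tensor1 \<Rightarrow> 'a \<Rightarrow> real"
  where "vector_norm A g X x =
    (let c = chart_at A x in sqrt (\<Sum>i\<in>UNIV. \<Sum>j\<in>UNIV. g c x $ i $ j * X c x $ i * X c x $ j))"

definition covector_norm ::
    "('a, 'n::finite) chart set \<Rightarrow> ('a, 'n) tensor2 \<Rightarrow> ('a, 'n) tensor1 \<Rightarrow> 'a \<Rightarrow> real"
  where "covector_norm A g \<omega> x =
    (let c = chart_at A x; h = matrix_inv (g c x)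
     in sqrt (\<Sum>i\<in>UNIV. \<Sum>j\<in>UNIV. h $ i $ j * \<omega> c x $ i * \<omega> c x $ j))"

definition cotensor2_norm ::
    "('a, 'n::finite) chart set \<Rightarrow> ('a, 'n) tensor2 \<Rightarrow> ('a, 'n) tensor2 \<Rightarrow> 'a \<Rightarrow> real"
  where "cotensor2_norm A g T x =
    (let c = chart_at A x; h = matrix_inv (g c x)
     in sqrt (\<Sum>i\<in>UNIV. \<Sum>j\<in>UNIV. \<Sum>k\<in>UNIV. \<Sum>l\<in>UNIV.
               h $ i $ k * h $ j $ l * T c x $ i $ j * T c x $ k $ l))"

definition cotensor2_trace ::
    "('a, 'n::finite) chart set \<Rightarrow> ('a, 'n) tensor2 \<Rightarrow> ('a, 'n) tensor2 \<Rightarrow> 'a \<Rightarrow> real"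
  where "cotensor2_trace A g T x =
    (let c = chart_at A x; h = matrix_inv (g c x) in \<Sum>i\<in>UNIV. \<Sum>j\<in>UNIV. h $ i $ j * T c x $ i $ j)"


section \<open>Gradient, Levi-Civita connection, Hessian and Laplacian\<close>

definition differential :: "('a \<Rightarrow> real) \<Rightarrow> ('a, 'n::finite) tensor1"
  where "differential u c x = (\<chi> i. coord_deriv c i u x)"

definition gradient :: "('a, 'n::finite) tensor2 \<Rightarrow> ('a \<Rightarrow> real) \<Rightarrow> ('a, 'n) tensor1"
  where "gradient g u c x = matrix_inv (g c x) *v differential u c x"

text \<open>The coefficients $\Gamma^k_{ij}$ of the Levi-Civita connection, that is, the components of
  $\nabla_{\partial_i}\partial_j$; see the lemmas on torsion, metric compatibility and uniqueness
  below.\<close>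

definition christoffel :: "('a, 'n::finite) tensor2 \<Rightarrow> ('a, 'n) chart \<Rightarrow> 'a \<Rightarrow> 'n \<Rightarrow> 'n \<Rightarrow> 'n \<Rightarrow> real"
  where "christoffel g c x k i j =
    1/2 * (\<Sum>l\<in>UNIV. matrix_inv (g c x) $ k $ l *
      (coord_deriv c i (\<lambda>y. g c y $ j $ l) x + coord_deriv c j (\<lambda>y. g c y $ i $ l) x
        - coord_deriv c l (\<lambda>y. g c y $ i $ j) x))"

text \<open>$(\nabla\omega)_{ij} = (\nabla_{\partial_i}\omega)(\partial_j)
  = \partial_i\omega_j - \Gamma^k_{ij}\omega_k$.\<close>

definition covariant_deriv :: "('a, 'n::finite) tensor2 \<Rightarrow> ('a, 'n) tensor1 \<Rightarrow> ('a, 'n) tensor2"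
  where "covariant_deriv g \<omega> c x =
    (\<chi> i j. coord_deriv c i (\<lambda>y. \<omega> c y $ j) x - (\<Sum>k\<in>UNIV. christoffel g c x k i j * \<omega> c x $ k))"

definition hessian :: "('a, 'n::finite) tensor2 \<Rightarrow> ('a \<Rightarrow> real) \<Rightarrow> ('a, 'n) tensor2"
  where "hessian g u = covariant_deriv g (differential u)"

definition laplacian ::
    "('a, 'n::finite) chart set \<Rightarrow> ('a, 'n) tensor2 \<Rightarrow> ('a \<Rightarrow> real) \<Rightarrow> 'a \<Rightarrow> real"
  where "laplacian A g u x = - cotensor2_trace A g (hessian g u) x"

abbreviation gradient_norm ::
    "('a, 'n::finite) chart set \<Rightarrow> ('a, 'n) tensor2 \<Rightarrow> ('a \<Rightarrow> real) \<Rightarrow> 'a \<Rightarrow> real"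
  where "gradient_norm A g u \<equiv> vector_norm A g (gradient g u)"

abbreviation differential_norm ::
    "('a, 'n::finite) chart set \<Rightarrow> ('a, 'n) tensor2 \<Rightarrow> ('a \<Rightarrow> real) \<Rightarrow> 'a \<Rightarrow> real"
  where "differential_norm A g u \<equiv> covector_norm A g (differential u)"

abbreviation hessian_norm ::
    "('a, 'n::finite) chart set \<Rightarrow> ('a, 'n) tensor2 \<Rightarrow> ('a \<Rightarrow> real) \<Rightarrow> 'a \<Rightarrow> real"
  where "hessian_norm A g u \<equiv> cotensor2_norm A g (hessian g u)"


section \<open>$L^p$ functions, Calderon--Zygmund inequality, Hessian cut-off functions\<close>

definition in_Lp :: "real \<Rightarrow> 'a measure \<Rightarrow> ('a \<Rightarrow> real) \<Rightarrow> bool"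
  where "in_Lp p \<mu> f \<longleftrightarrow> f \<in> borel_measurable \<mu> \<and> integrable \<mu> (\<lambda>x. \<bar>f x\<bar> powr p)"

text \<open>Meaningful for functions satisfying \<open>in_Lp p \<mu>\<close>; below it is applied to compactly supported
  continuous functions only.\<close>

definition Lp_norm :: "real \<Rightarrow> 'a measure \<Rightarrow> ('a \<Rightarrow> real) \<Rightarrow> real"
  where "Lp_norm p \<mu> f = (LINT x|\<mu>. \<bar>f x\<bar> powr p) powr (1 / p)"

definition CZ ::
    "('a::topological_space, 'n::finite) chart set \<Rightarrow> ('a, 'n) tensor2 \<Rightarrow> real \<Rightarrow> bool"
  where "CZ A g p \<longleftrightarrow> (\<exists>C1\<ge>0. \<exists>C2>0. \<forall>v. smooth_compact_support A v \<longrightarrow>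
    Lp_norm p (riemannian_volume A g) (hessian_norm A g v)
      \<le> C1 * Lp_norm p (riemannian_volume A g) v
        + C2 * Lp_norm p (riemannian_volume A g) (laplacian A g v))"

definition hessian_cutoffs ::
    "('a::topological_space, 'n::finite) chart set \<Rightarrow> ('a, 'n) tensor2 \<Rightarrow> (nat \<Rightarrow> 'a \<Rightarrow> real) \<Rightarrow> bool"
  where "hessian_cutoffs A g \<eta> \<longleftrightarrow>
    (\<forall>n. smooth_compact_support A (\<eta> n)) \<and>
    (\<forall>n x. 0 \<le> \<eta> n x \<and> \<eta> n x \<le> 1) \<and>
    (\<forall>K. compact K \<longrightarrow> (\<exists>n0. \<forall>n\<ge>n0. \<forall>x\<in>K. \<eta> n x = 1)) \<and>
    ((\<lambda>n. SUP x. ennreal (differential_norm A g (\<eta> n) x)) \<longlonglongrightarrow> 0) \<and>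
    ((\<lambda>n. SUP x. ennreal (hessian_norm A g (\<eta> n) x)) \<longlonglongrightarrow> 0)"


section \<open>The Christoffel symbols define the Levi-Civita connection\<close>

lemma riemannian_metric_invertible:
  assumes "riemannian_metric A g" "c \<in> A" "x \<in> chart_dom c"
  shows "invertible (g c x)"
proof -
  have "v = 0" if "g c x *v v = 0" for v
    using assms that unfolding riemannian_metric_def
    by (metis inner_zero_right less_irrefl)
  then show ?thesis
    by (simp add: invertible_left_inverse matrix_left_invertible_ker)
qed

lemma riemannian_metric_sym:
  assumes "riemannian_metric A g" "c \<in> A" "x \<in> chart_dom c"
  shows "g c x $ i $ j = g c x $ j $ i"
proof -
  have "transpose (g c x) = g c x"
    using assms unfolding riemannian_metric_def by blast
  then have "transpose (g c x) $ i $ j = g c x $ i $ j" by simp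
  then show ?thesis by (simp add: transpose_def)
qed

lemma coord_deriv_cong:
  assumes c: "is_chart c" and x: "x \<in> chart_dom c"
    and eq: "\<And>y. y \<in> chart_dom c \<Longrightarrow> f y = h y"
  shows "coord_deriv c i f x = coord_deriv c i h x"
proof -
  have op: "open (chart_map c ` chart_dom c)"
    using c by (simp add: is_chart_def)
  have eq': "in_coords c f z = in_coords c h z" if "z \<in> chart_map c ` chart_dom c" for z
    unfolding in_coords_def by (rule eq) (use that in \<open>simp add: inv_into_into\<close>)
  have "(in_coords c f has_derivative F) (at (chart_map c x)) \<longleftrightarrow>
        (in_coords c h has_derivative F) (at (chart_map c x))" for F
    using has_derivative_transform_within_open[OF _ op, of _ F "chart_map c x" UNIV] x eq'
    by (metis image_eqI)
  then show ?thesis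
    by (simp add: coord_deriv_def partial_def frechet_derivative_def)
qed

lemma coord_deriv_metric_sym:
  assumes "smooth_atlas A" "riemannian_metric A g" "c \<in> A" "x \<in> chart_dom c"
  shows "coord_deriv c k (\<lambda>y. g c y $ i $ j) x = coord_deriv c k (\<lambda>y. g c y $ j $ i) x"
  using assms
  by (intro coord_deriv_cong) (auto simp: smooth_atlas_def intro: riemannian_metric_sym)

lemma christoffel_torsion_free:
  assumes "smooth_atlas A" "riemannian_metric A g" "c \<in> A" "x \<in> chart_dom c"
  shows "christoffel g c x k i j = christoffel g c x k j i"
  unfolding christoffel_def by (simp add: coord_deriv_metric_sym[OF assms, of _ i j] add.commute)

lemma christoffel_lowered:
  assumes "smooth_atlas A" "riemannian_metric A g" "c \<in> A" "x \<in> chart_dom c"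
  shows "(\<Sum>m\<in>UNIV. christoffel g c x m i j * g c x $ m $ k) =
    1/2 * (coord_deriv c i (\<lambda>y. g c y $ j $ k) x + coord_deriv c j (\<lambda>y. g c y $ i $ k) x
        - coord_deriv c k (\<lambda>y. g c y $ i $ j) x)"
proof -
  define D where "D l = coord_deriv c i (\<lambda>y. g c y $ j $ l) x
    + coord_deriv c j (\<lambda>y. g c y $ i $ l) x - coord_deriv c l (\<lambda>y. g c y $ i $ j) x" for l
  have "g c x ** matrix_inv (g c x) = mat 1"
    using riemannian_metric_invertible[OF assms(2-4)]
    unfolding invertible_def matrix_inv_def by (rule someI2_ex) simp
  then have *: "(\<Sum>m\<in>UNIV. g c x $ k $ m * matrix_inv (g c x) $ m $ l) = (if k = l then 1 else 0)" for l
    by (simp add: matrix_matrix_mult_def mat_def vec_eq_iff)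
  have "(\<Sum>m\<in>UNIV. christoffel g c x m i j * g c x $ m $ k) =
      1/2 * (\<Sum>m\<in>UNIV. \<Sum>l\<in>UNIV. g c x $ k $ m * matrix_inv (g c x) $ m $ l * D l)"
    unfolding christoffel_def D_def[symmetric]
    by (simp add: sum_distrib_left sum_distrib_right sum_divide_distrib
        riemannian_metric_sym[OF assms(2-4), of _ k] mult_ac)
  also have "\<dots> = 1/2 * (\<Sum>l\<in>UNIV. (\<Sum>m\<in>UNIV. g c x $ k $ m * matrix_inv (g c x) $ m $ l) * D l)"
    by (subst sum.swap) (simp add: sum_distrib_right)
  also have "\<dots> = 1/2 * D k"
    unfolding * by (simp add: if_distrib[where f="\<lambda>u. u * D _"] cong: if_cong)
  finally show ?thesis unfolding D_def .
qed

lemma christoffel_metric_compatible: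
  assumes "smooth_atlas A" "riemannian_metric A g" "c \<in> A" "x \<in> chart_dom c"
  shows "coord_deriv c k (\<lambda>y. g c y $ i $ j) x =
    (\<Sum>m\<in>UNIV. christoffel g c x m k i * g c x $ m $ j) +
    (\<Sum>m\<in>UNIV. christoffel g c x m k j * g c x $ m $ i)"
  unfolding christoffel_lowered[OF assms]
  using coord_deriv_metric_sym[OF assms, of k i j] coord_deriv_metric_sym[OF assms, of i k j]
    coord_deriv_metric_sym[OF assms, of j k i]
  by (simp add: field_simps)

lemma christoffel_unique:
  assumes "smooth_atlas A" "riemannian_metric A g" "c \<in> A" "x \<in> chart_dom c"
    and tf: "\<And>k i j. G k i j = G k j i"
    and mc: "\<And>i j k. coord_deriv c k (\<lambda>y. g c y $ i $ j) x =
      (\<Sum>m\<in>UNIV. G m k i * g c x $ m $ j) + (\<Sum>m\<in>UNIV. G m k j * g c x $ m $ i)"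
  shows "G k i j = christoffel g c x k i j"
proof -
  note sg = riemannian_metric_sym[OF assms(2-4)]
  have tf': "(\<lambda>m. G m j i) = (\<lambda>m. G m i j)" for i j
    using tf by blast
  have low: "(\<Sum>m\<in>UNIV. G m i j * g c x $ m $ k) =
      (\<Sum>m\<in>UNIV. christoffel g c x m i j * g c x $ m $ k)" for i j k
    unfolding christoffel_lowered[OF assms(1-4)] mc
    using tf[of _ i j] tf[of _ i k] tf[of _ j k] by simp
  define v where "v = (\<chi> m. G m i j - christoffel g c x m i j)"
  have "g c x *v v = 0"
    using low[of i j]
    by (simp add: vec_eq_iff matrix_vector_mult_def v_def algebra_simps sum_subtractf sg[of _ _])
  then have "v = 0"
    using riemannian_metric_invertible[OF assms(2-4)]
    by (metis invertible_left_inverse matrix_left_invertible_ker)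
  then show ?thesis by (simp add: v_def vec_eq_iff)
qed

end

theory Submission
  imports Defs
begin

text \<open>
  The inequality CZ is first extended from smooth functions to the compactly supported
  $C^2$ functions $\eta_n u$, where $(\eta_n)$ are the Hessian cut-off functions: by means of
  bump functions $b$ and the splitting $w = bw + (1-b)w$ a compactly supported $C^2$ function is
  broken up into pieces supported in single charts, and each piece is mollified there, so that the
  Hessians converge uniformly on a compact set. The product rule bounds
  $\eta_n |\mathrm{Hess}(u)|$ by $|\mathrm{Hess}(\eta_n u)|$ and $|\Delta(\eta_n u)|$ by $|f|$, up to terms
  in $|\mathrm{grad}(u)|$ and $|u|$ whose coefficients tend to 0 uniformly. Hence the $L^p$ norms of
  $\eta_n |\mathrm{Hess}(u)|$ are bounded, and Fatou's lemma concludes. As only finiteness matters,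
  $(a+b)^p \le 2^p(a^p+b^p)$ replaces the Minkowski inequality.

  Pointwise norms are taken in an arbitrarily chosen chart at each point, so that even their
  measurability depends on the transformation law of the Hessian. The volume measure is a definite
  description, whose existence rests on the change of variables theorem.
\<close>

section \<open>Calculus of \<open>C\<^sup>k\<close> functions\<close>

text \<open>Multiplying by a cut-off function does not improve regularity: \<eta>_n u is only C^2,
  while \<open>CZ\<close> speaks about smooth functions. The gap is closed by an approximation at
  the fixed distance 1 instead of a limit: for each n one smooth v is taken such that the p-th power
  integrals of \<eta>_n u - v and of its Hessian are at most 1, and the resulting bound is
  independent of n. The Laplacian of the difference is controlled pointwise by its Hessian, through
  Cauchy-Schwarz for the trace. All pointwise estimates are made in a frame. The inverse metric is
  factored as B^T B by completing squares, and then |T| is the Euclidean norm of B T B^T. Triangle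
  inequality, norms of outer products and the trace estimate thus come from the Euclidean inner
  product on matrices, and independence of the chart becomes a cancellation of Jacobians. The
  transformation law of the Hessian itself rests on the symmetry of the second partial derivatives
  of the transition maps.\<close>

lemma has_derivative_imp_partial:
  fixes F :: "real^'n::finite \<Rightarrow> 'b::real_normed_vector"
  assumes "(F has_derivative F') (at z)"
  shows "partial i F z = F' (axis i 1)"
  using frechet_derivative_at[OF assms] by (simp add: partial_def)

lemma has_derivative_cong_open:
  assumes "open S" "z \<in> S" "\<And>y. y \<in> S \<Longrightarrow> F y = G y"
  shows "(F has_derivative D) (at z) \<longleftrightarrow> (G has_derivative D) (at z)"
  using has_derivative_transform_within_open[OF _ assms(1,2)] assms(3) by metis

lemma partial_cong_open:
  fixes F :: "real^'n::finite \<Rightarrow> 'b::real_normed_vector"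
  assumes "open S" "z \<in> S" "\<And>y. y \<in> S \<Longrightarrow> F y = G y"
  shows "partial i F z = partial i G z"
  using has_derivative_cong_open[OF assms, simplified]
  by (simp add: partial_def frechet_derivative_def)

lemma differentiable_on_open_iff:
  "open S \<Longrightarrow> F differentiable_on S \<longleftrightarrow> (\<forall>z\<in>S. F differentiable (at z))"
  by (simp add: differentiable_on_def at_within_open[of _ S])

lemma Ck_on_cong:
  fixes F :: "real^'n::finite \<Rightarrow> 'b::real_normed_vector"
  assumes "open S" "\<And>z. z \<in> S \<Longrightarrow> F z = G z"
  shows "Ck_on k F S \<longleftrightarrow> Ck_on k G S"
  using assms
proof (induction k arbitrary: F G)
  case 0
  then show ?case by (simp cong: continuous_on_cong)
next
  case (Suc k)
  have "F differentiable_on S \<longleftrightarrow> G differentiable_on S"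
    unfolding differentiable_on_open_iff[OF Suc.prems(1)] differentiable_def
    using has_derivative_cong_open[OF Suc.prems(1), of _ F G] Suc.prems(2) by blast
  moreover have "Ck_on k (partial i F) S \<longleftrightarrow> Ck_on k (partial i G) S" for i
    using partial_cong_open[OF Suc.prems(1) _ Suc.prems(2)] by (intro Suc.IH Suc.prems) auto
  ultimately show ?case by simp
qed

lemma Ck_on_subset: "Ck_on k F S \<Longrightarrow> T \<subseteq> S \<Longrightarrow> Ck_on k F T"
  by (induction k arbitrary: F) (auto intro: continuous_on_subset differentiable_on_subset)

lemma Ck_on_SucD: "Ck_on (Suc k) F S \<Longrightarrow> Ck_on k F S"
  by (induction k arbitrary: F) (auto intro: differentiable_imp_continuous_on)

lemma Ck_on_mono: "Ck_on k F S \<Longrightarrow> j \<le> k \<Longrightarrow> Ck_on j F S"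
  by (induction k) (auto simp del: Ck_on.simps simp: le_Suc_eq dest: Ck_on_SucD)

lemma Ck_on_continuous: "Ck_on k F S \<Longrightarrow> continuous_on S F"
  using Ck_on_mono[of k F S 0] by simp

lemma Ck_on_partial: "Ck_on (Suc k) F S \<Longrightarrow> Ck_on k (partial i F) S"
  by simp

lemma Ck_on_2D:
  assumes "Ck_on 2 F S"
  shows "Ck_on (Suc 0) F S" "Ck_on (Suc 0) (partial i F) S"
    "continuous_on S F" "continuous_on S (partial i F)" "continuous_on S (partial i (partial j F))"
  using assms Ck_on_mono[of 2 F S 1] Ck_on_continuous[OF assms] Ck_on_continuous[of "Suc 0" "partial i F" S]
  by (auto simp: numeral_2_eq_2)

lemma Ck_on_has_derivative:
  assumes "open S" "Ck_on (Suc k) F S" "z \<in> S"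
  shows "(F has_derivative frechet_derivative F (at z)) (at z)"
  using assms by (auto simp: differentiable_on_open_iff frechet_derivative_works)

lemma frechet_derivative_partial:
  fixes F :: "real^'n::finite \<Rightarrow> 'b::real_normed_vector"
  assumes "F differentiable (at z)"
  shows "frechet_derivative F (at z) v = (\<Sum>i\<in>UNIV. v $ i *\<^sub>R partial i F z)"
proof -
  interpret bounded_linear "frechet_derivative F (at z)"
    using assms frechet_derivative_works has_derivative_bounded_linear by blast
  have "v = (\<Sum>i\<in>UNIV. v $ i *\<^sub>R axis i 1)"
    by (simp add: basis_expansion flip: scalar_mult_eq_scaleR)
  then have "frechet_derivative F (at z) v = frechet_derivative F (at z) (\<Sum>i\<in>UNIV. v $ i *\<^sub>R axis i 1)"
    by simp
  also have "\<dots> = (\<Sum>i\<in>UNIV. v $ i *\<^sub>R partial i F z)"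
    by (simp add: sum scaleR partial_def)
  finally show ?thesis .
qed

text \<open>Serves the inductions on \<open>k\<close> below: once a derivative is known in closed
  form, only its values on the axis vectors have to be checked for regularity, and the induction
  hypothesis applies to these.\<close>

lemma Ck_on_SucI:
  fixes F :: "real^'n::finite \<Rightarrow> 'b::real_normed_vector"
  assumes S: "open S"
    and D: "\<And>z. z \<in> S \<Longrightarrow> (F has_derivative D z) (at z)"
    and C: "\<And>i. Ck_on k (\<lambda>z. D z (axis i 1)) S"
  shows "Ck_on (Suc k) F S"
proof -
  have "Ck_on k (partial i F) S" for i
    using C[of i] Ck_on_cong[OF S, of "partial i F"] has_derivative_imp_partial[OF D] by metis
  moreover have "F differentiable_on S"
    using D by (auto simp: differentiable_on_open_iff[OF S] differentiable_def)
  ultimately show ?thesis by simp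
qed

lemma Ck_on_const [simp]: "Ck_on k (\<lambda>_. c) S"
proof -
  \<comment> \<open>\<open>Ck_on_SucI\<close> asks for an open set, so the claim is proved on
    \<open>UNIV\<close> and then restricted to \<open>S\<close>.\<close>
  have "Ck_on k (\<lambda>_. c) UNIV"
  proof (induction k arbitrary: c)
    case (Suc k)
    show ?case by (rule Ck_on_SucI[where D="\<lambda>_ _. 0"]) (use Suc in auto)
  qed simp
  then show ?thesis by (rule Ck_on_subset) simp
qed

lemma Ck_on_bounded_linear:
  fixes F :: "real^'n::finite \<Rightarrow> 'b::real_normed_vector"
  assumes "bounded_linear L" "open S" "Ck_on k F S"
  shows "Ck_on k (\<lambda>z. L (F z)) S"
  using assms(3)
proof (induction k arbitrary: F)
  case 0
  then show ?case
    using assms(1) by (simp add: bounded_linear.continuous_on)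
next
  case (Suc k)
  show ?case
  proof (rule Ck_on_SucI[OF assms(2)])
    show "((\<lambda>z. L (F z)) has_derivative (\<lambda>v. L (frechet_derivative F (at z) v))) (at z)"
      if "z \<in> S" for z
      using bounded_linear.has_derivative[OF assms(1) Ck_on_has_derivative[OF assms(2) Suc.prems that]] .
    show "Ck_on k (\<lambda>z. L (frechet_derivative F (at z) (axis i 1))) S" for i
      using Suc.IH[OF Ck_on_partial[OF Suc.prems, of i]] by (simp add: partial_def)
  qed
qed

lemma Ck_on_nth:
  fixes F :: "real^'n::finite \<Rightarrow> real^'m"
  assumes "open S" "Ck_on k F S"
  shows "Ck_on k (\<lambda>z. F z $ i) S"
  by (rule Ck_on_bounded_linear[OF bounded_linear_vec_nth assms])

lemma Ck_on_add:
  fixes F G :: "real^'n::finite \<Rightarrow> 'b::real_normed_vector"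
  assumes "open S" "Ck_on k F S" "Ck_on k G S"
  shows "Ck_on k (\<lambda>z. F z + G z) S"
  using assms(2,3)
proof (induction k arbitrary: F G)
  case 0
  then show ?case by (simp add: continuous_on_add)
next
  case (Suc k)
  show ?case
  proof (rule Ck_on_SucI[OF assms(1)])
    show "((\<lambda>z. F z + G z) has_derivative
        (\<lambda>v. frechet_derivative F (at z) v + frechet_derivative G (at z) v)) (at z)"
      if "z \<in> S" for z
      by (intro has_derivative_add Ck_on_has_derivative[OF assms(1) Suc.prems(1) that]
          Ck_on_has_derivative[OF assms(1) Suc.prems(2) that])
    show "Ck_on k (\<lambda>z. frechet_derivative F (at z) (axis i 1) + frechet_derivative G (at z) (axis i 1)) S" for i
      using Suc.IH[OF Ck_on_partial[OF Suc.prems(1), of i] Ck_on_partial[OF Suc.prems(2), of i]]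
      by (simp add: partial_def)
  qed
qed

lemma Ck_on_sum:
  fixes F :: "'i \<Rightarrow> real^'n::finite \<Rightarrow> 'b::real_normed_vector"
  assumes "open S" "\<And>i. i \<in> I \<Longrightarrow> Ck_on k (F i) S"
  shows "Ck_on k (\<lambda>z. \<Sum>i\<in>I. F i z) S"
  using assms(2)
  by (induction I rule: infinite_finite_induct) (auto intro: Ck_on_add[OF assms(1)])

lemma Ck_on_minus:
  assumes "open S" "Ck_on k F S"
  shows "Ck_on k (\<lambda>z. - F z) S"
  by (rule Ck_on_bounded_linear[OF bounded_linear_minus[OF bounded_linear_ident] assms])

lemma Ck_on_diff:
  assumes "open S" "Ck_on k F S" "Ck_on k G S"
  shows "Ck_on k (\<lambda>z. F z - G z) S"
  using Ck_on_add[OF assms(1,2) Ck_on_minus[OF assms(1,3)]] by simp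

lemma Ck_on_mult:
  fixes F G :: "real^'n::finite \<Rightarrow> real"
  assumes "open S" "Ck_on k F S" "Ck_on k G S"
  shows "Ck_on k (\<lambda>z. F z * G z) S"
  using assms(2,3)
proof (induction k arbitrary: F G)
  case 0
  then show ?case by (simp add: continuous_on_mult)
next
  case (Suc k)
  show ?case
  proof (rule Ck_on_SucI[OF assms(1)])
    show "((\<lambda>z. F z * G z) has_derivative
        (\<lambda>v. F z * frechet_derivative G (at z) v + frechet_derivative F (at z) v * G z)) (at z)"
      if "z \<in> S" for z
      by (intro has_derivative_mult Ck_on_has_derivative[OF assms(1) Suc.prems(1) that]
          Ck_on_has_derivative[OF assms(1) Suc.prems(2) that])
    show "Ck_on k (\<lambda>z. F z * frechet_derivative G (at z) (axis i 1)
        + frechet_derivative F (at z) (axis i 1) * G z) S" for i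
      using Suc.IH[OF Ck_on_SucD[OF Suc.prems(1)] Ck_on_partial[OF Suc.prems(2), of i]]
        Suc.IH[OF Ck_on_partial[OF Suc.prems(1), of i] Ck_on_SucD[OF Suc.prems(2)]]
      by (auto simp: partial_def intro: Ck_on_add[OF assms(1)])
  qed
qed

lemma Ck_on_id [simp]: "Ck_on k (\<lambda>z. z) S"
proof (cases k)
  case (Suc k')
  have "Ck_on (Suc k') (\<lambda>z. z) UNIV"
    by (rule Ck_on_SucI[where D="\<lambda>_ v. v"]) auto
  then show ?thesis unfolding Suc by (rule Ck_on_subset) simp
qed (simp add: continuous_on_id)

lemma chain_rule_frechet:
  fixes F :: "real^'n::finite \<Rightarrow> 'b::real_normed_vector" and G :: "real^'m::finite \<Rightarrow> real^'n"
  assumes "G differentiable (at z)" "F differentiable (at (G z))"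
  shows "((\<lambda>z. F (G z)) has_derivative
      (\<lambda>v. \<Sum>j\<in>UNIV. (frechet_derivative G (at z) v) $ j *\<^sub>R partial j F (G z))) (at z)"
proof -
  have "((\<lambda>z. F (G z)) has_derivative
      (\<lambda>v. frechet_derivative F (at (G z)) (frechet_derivative G (at z) v))) (at z)"
    using diff_chain_at[of G _ z F] assms unfolding frechet_derivative_works o_def by blast
  then show ?thesis by (simp add: frechet_derivative_partial[OF assms(2)])
qed

lemma partial_nth:
  fixes G :: "real^'m::finite \<Rightarrow> real^'n"
  assumes "G differentiable (at z)"
  shows "partial i (\<lambda>z. G z $ j) z = partial i G z $ j"
  using bounded_linear.has_derivative[OF bounded_linear_vec_nth[of j]] assms
  unfolding frechet_derivative_works
  by (subst has_derivative_imp_partial) (auto simp: partial_def)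

lemma partial_compose:
  fixes F :: "real^'n::finite \<Rightarrow> real" and G :: "real^'m::finite \<Rightarrow> real^'n"
  assumes "G differentiable (at z)" "F differentiable (at (G z))"
  shows "partial i (\<lambda>z. F (G z)) z = (\<Sum>j\<in>UNIV. partial i (\<lambda>z. G z $ j) z * partial j F (G z))"
  unfolding has_derivative_imp_partial[OF chain_rule_frechet[OF assms]] partial_nth[OF assms(1)]
  by (simp add: partial_def[of i G])

lemma Ck_on_compose:
  fixes F :: "real^'n::finite \<Rightarrow> real" and G :: "real^'m::finite \<Rightarrow> real^'n"
  assumes "open S" "open T" "G ` S \<subseteq> T" "Ck_on k F T" "Ck_on k G S"
  shows "Ck_on k (\<lambda>z. F (G z)) S"
  using assms(4,5)
proof (induction k arbitrary: F)
  case 0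
  then show ?case
    using assms(3) by (auto intro: continuous_on_compose2)
next
  case (Suc k)
  have dG: "G differentiable (at z)" if "z \<in> S" for z
    using Suc.prems(2) that by (simp add: differentiable_on_open_iff assms(1))
  have dF: "F differentiable (at (G z))" if "z \<in> S" for z
    using Suc.prems(1) that assms(3) by (auto simp: differentiable_on_open_iff assms(2))
  show ?case
  proof (rule Ck_on_SucI[OF assms(1) chain_rule_frechet[OF dG dF]])
    fix i
    \<comment> \<open>By the chain rule the partials are sums of products of partials of
      \<open>G\<close> with functions \<open>partial j F\<close> composed with the same
      \<open>G\<close>; hence the induction varies \<open>F\<close> only.\<close>
    have "Ck_on k (\<lambda>z. \<Sum>j\<in>UNIV. partial i G z $ j *\<^sub>R partial j F (G z)) S"
      unfolding real_scaleR_def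
      by (intro Ck_on_sum Ck_on_mult Ck_on_nth assms(1) Suc.IH Ck_on_partial Suc.prems Ck_on_SucD[OF Suc.prems(2)])
    then show "Ck_on k (\<lambda>z. \<Sum>j\<in>UNIV. frechet_derivative G (at z) (axis i 1) $ j *\<^sub>R partial j F (G z)) S"
      by (simp add: partial_def[of i G])
  qed auto
qed

text \<open>Permits gluing: a function extended by zero is examined separately inside the chart and
  off its support.\<close>

lemma Ck_on_local:
  fixes F :: "real^'n::finite \<Rightarrow> 'b::real_normed_vector"
  assumes S: "open S" and loc: "\<And>z. z \<in> S \<Longrightarrow> \<exists>T. open T \<and> z \<in> T \<and> Ck_on k F T"
  shows "Ck_on k F S"
  using loc
proof (induction k arbitrary: F)
  case 0
  then show ?case
    using S by (metis Ck_on.simps(1) continuous_on_eq_continuous_at)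
next
  case (Suc k)
  have "F differentiable (at z)" if "z \<in> S" for z
    using Suc.prems[OF that] by (auto simp: differentiable_on_open_iff)
  moreover have "Ck_on k (partial i F) S" for i
    by (rule Suc.IH) (use Suc.prems in fastforce)
  ultimately show ?case
    by (simp add: differentiable_on_open_iff[OF S])
qed

lemma partial_add:
  assumes "F differentiable (at z)" "G differentiable (at z)"
  shows "partial i (\<lambda>z. F z + G z) z = partial i F z + partial i G z"
  using has_derivative_add assms unfolding frechet_derivative_works
  by (subst has_derivative_imp_partial) (auto simp: partial_def)

lemma partial_diff:
  assumes "F differentiable (at z)" "G differentiable (at z)"
  shows "partial i (\<lambda>z. F z - G z) z = partial i F z - partial i G z"
  using has_derivative_diff assms unfolding frechet_derivative_works
  by (subst has_derivative_imp_partial) (auto simp: partial_def)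

lemma partial_mult:
  fixes F G :: "real^'n::finite \<Rightarrow> real"
  assumes "F differentiable (at z)" "G differentiable (at z)"
  shows "partial i (\<lambda>z. F z * G z) z = F z * partial i G z + partial i F z * G z"
proof -
  have "((\<lambda>z. F z * G z) has_derivative
        (\<lambda>v. F z * frechet_derivative G (at z) v + frechet_derivative F (at z) v * G z)) (at z)"
    using assms unfolding frechet_derivative_works by (intro has_derivative_mult)
  then show ?thesis by (subst has_derivative_imp_partial) (auto simp: partial_def)
qed

section \<open>Symmetry of second partial derivatives\<close>

lemma has_real_derivative_line:
  fixes F :: "real^'n::finite \<Rightarrow> real"
  assumes "F differentiable (at (w + t *\<^sub>R axis j 1))"
  shows "((\<lambda>t. F (w + t *\<^sub>R axis j 1)) has_real_derivative partial j F (w + t *\<^sub>R axis j 1)) (at t)"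
proof -
  let ?D = "frechet_derivative F (at (w + t *\<^sub>R axis j 1))"
  have D: "(F has_derivative ?D) (at (w + t *\<^sub>R axis j 1))"
    using assms frechet_derivative_works by blast
  have "((\<lambda>t. w + t *\<^sub>R axis j 1) has_derivative (\<lambda>s. s *\<^sub>R axis j 1)) (at t)"
    by (auto intro!: derivative_eq_intros)
  from has_derivative_compose[OF this D]
  have "((\<lambda>t. F (w + t *\<^sub>R axis j 1)) has_derivative (\<lambda>s. ?D (s *\<^sub>R axis j 1))) (at t)" .
  moreover have "?D (s *\<^sub>R axis j 1) = partial j F (w + t *\<^sub>R axis j 1) * s" for s
    using linear_scale[OF has_derivative_linear[OF D]] by (simp add: partial_def)
  ultimately show ?thesis
    by (simp add: has_field_derivative_def)
qed

text \<open>The one-variable mean value theorem is applied twice: in direction \<open>j\<close> to a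
  difference of values of \<open>F\<close>, then in direction \<open>i\<close> to
  \<open>partial j F\<close>. The radius \<open>2 * h\<close> contains the whole parallelogram
  spanned by the two steps of length \<open>h\<close>.\<close>

lemma second_difference_mean_value:
  fixes F :: "real^'n::finite \<Rightarrow> real"
  assumes S: "open S" and F: "Ck_on 2 F S" and h: "h > 0" and sub: "cball z (2 * h) \<subseteq> S"
  obtains w where "w \<in> cball z (2 * h)"
    "F (z + h *\<^sub>R axis i 1 + h *\<^sub>R axis j 1) - F (z + h *\<^sub>R axis i 1) - F (z + h *\<^sub>R axis j 1) + F z
      = h * h * partial i (partial j F) w"
proof -
  let ?a = "axis i 1 :: real^'n" and ?b = "axis j 1 :: real^'n"
  have inS: "z + s *\<^sub>R ?a + t *\<^sub>R ?b \<in> cball z (2 * h)"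
    if "0 \<le> s" "s \<le> h" "0 \<le> t" "t \<le> h" for s t
  proof -
    have "norm (s *\<^sub>R ?a + t *\<^sub>R ?b) \<le> norm (s *\<^sub>R ?a) + norm (t *\<^sub>R ?b)"
      by (rule norm_triangle_ineq)
    also have "\<dots> \<le> 2 * h" using that by simp
    finally show ?thesis
      by (simp add: dist_norm norm_minus_commute ac_simps)
  qed
  have dF: "F differentiable (at w)" and dG: "partial j F differentiable (at w)" if "w \<in> cball z (2*h)" for w
    using F that sub by (auto simp: numeral_2_eq_2 differentiable_on_open_iff[OF S])
  let ?\<psi> = "\<lambda>t. F (z + h *\<^sub>R ?a + t *\<^sub>R ?b) - F (z + t *\<^sub>R ?b)"
  let ?\<psi>' = "\<lambda>t. partial j F (z + h *\<^sub>R ?a + t *\<^sub>R ?b) - partial j F (z + t *\<^sub>R ?b)"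
  have "(?\<psi> has_real_derivative ?\<psi>' t) (at t)" if "0 \<le> t" "t \<le> h" for t
    using inS[of h t] inS[of 0 t] that h
    by (intro DERIV_diff has_real_derivative_line dF) auto
  then obtain t where t: "0 < t" "t < h" "?\<psi> h - ?\<psi> 0 = (h - 0) * ?\<psi>' t"
    using MVT2[of 0 h ?\<psi> ?\<psi>'] h by blast
  let ?\<phi> = "\<lambda>s. partial j F (z + t *\<^sub>R ?b + s *\<^sub>R ?a)"
  let ?\<phi>' = "\<lambda>s. partial i (partial j F) (z + t *\<^sub>R ?b + s *\<^sub>R ?a)"
  have "(?\<phi> has_real_derivative ?\<phi>' s) (at s)" if "0 \<le> s" "s \<le> h" for s
    using inS[of s t] that t by (intro has_real_derivative_line dG) (simp add: ac_simps)
  then obtain s where s: "0 < s" "s < h" "?\<phi> h - ?\<phi> 0 = (h - 0) * ?\<phi>' s"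
    using MVT2[of 0 h ?\<phi> ?\<phi>'] h by blast
  show thesis
  proof
    show "z + s *\<^sub>R ?a + t *\<^sub>R ?b \<in> cball z (2 * h)"
      using s t by (intro inS) auto
    show "F (z + h *\<^sub>R ?a + h *\<^sub>R ?b) - F (z + h *\<^sub>R ?a) - F (z + h *\<^sub>R ?b) + F z
      = h * h * partial i (partial j F) (z + s *\<^sub>R ?a + t *\<^sub>R ?b)"
      using s(3) t(3) by (simp add: algebra_simps)
  qed
qed

text \<open>The second difference does not change when \<open>i\<close> and \<open>j\<close> are
  exchanged, so the two mixed derivatives agree at two points arbitrarily close to \<open>z\<close>;
  their continuity at \<open>z\<close> then excludes different values there.\<close>

lemma partial_commute:
  fixes F :: "real^'n::finite \<Rightarrow> real"
  assumes S: "open S" and F: "Ck_on 2 F S" and z: "z \<in> S"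
  shows "partial i (partial j F) z = partial j (partial i F) z"
proof (rule ccontr)
  let ?a = "partial i (partial j F)" and ?b = "partial j (partial i F)"
  assume "?a z \<noteq> ?b z"
  then have e: "\<bar>?a z - ?b z\<bar> / 2 > 0" by simp
  have c: "isCont ?a z" "isCont ?b z"
    using F S z by (auto simp: numeral_2_eq_2 continuous_on_eq_continuous_at)
  obtain d1 where d1: "d1 > 0" "\<And>w. dist w z < d1 \<Longrightarrow> \<bar>?a w - ?a z\<bar> < \<bar>?a z - ?b z\<bar> / 2"
    using c(1) e unfolding continuous_at_eps_delta dist_real_def by meson
  obtain d2 where d2: "d2 > 0" "\<And>w. dist w z < d2 \<Longrightarrow> \<bar>?b w - ?b z\<bar> < \<bar>?a z - ?b z\<bar> / 2"
    using c(2) e unfolding continuous_at_eps_delta dist_real_def by meson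
  obtain d3 where d3: "d3 > 0" "cball z d3 \<subseteq> S"
    using S z open_contains_cball by blast
  define h where "h = min (min d1 d2) d3 / 4"
  have h: "h > 0" "2 * h < d1" "2 * h < d2" "2 * h < d3"
    using d1 d2 d3 by (auto simp: h_def)
  have sub: "cball z (2*h) \<subseteq> S"
    using h d3 by (auto simp: subset_iff)
  obtain w where w: "w \<in> cball z (2 * h)"
    "F (z + h *\<^sub>R axis i 1 + h *\<^sub>R axis j 1) - F (z + h *\<^sub>R axis i 1) - F (z + h *\<^sub>R axis j 1) + F z = h * h * ?a w"
    using second_difference_mean_value[OF S F h(1) sub] by blast
  obtain w' where w': "w' \<in> cball z (2 * h)"
    "F (z + h *\<^sub>R axis j 1 + h *\<^sub>R axis i 1) - F (z + h *\<^sub>R axis j 1) - F (z + h *\<^sub>R axis i 1) + F z = h * h * ?b w'"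
    using second_difference_mean_value[OF S F h(1) sub] by blast
  have "h * h * ?a w = h * h * ?b w'"
    unfolding w(2)[symmetric] w'(2)[symmetric] by (simp add: algebra_simps)
  then have "?a w = ?b w'" using h by simp
  moreover have "\<bar>?a w - ?a z\<bar> < \<bar>?a z - ?b z\<bar> / 2" "\<bar>?b w' - ?b z\<bar> < \<bar>?a z - ?b z\<bar> / 2"
    using w w' h d1(2) d2(2) by (auto simp: dist_commute)
  moreover have "\<bar>?a z - ?b z\<bar> \<le> \<bar>?a w - ?a z\<bar> + \<bar>?a w - ?b z\<bar>"
    by linarith
  ultimately show False by simp
qed

section \<open>Smoothing by convolution\<close>

text \<open>The powers in the denominator make the family closed under differentiation up to linear
  combinations. Smoothness of exp(-1/t), extended by 0, then becomes an induction on the order of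
  differentiability for all \<open>m\<close> at once.\<close>

definition flat_exp :: "nat \<Rightarrow> real \<Rightarrow> real"
  where "flat_exp m t = (if t > 0 then exp (- 1 / t) / t ^ m else 0)"

text \<open>From the right, with s = 1/t, this is the convergence of s^m / exp(s) to 0 at
  infinity.\<close>

lemma flat_exp_tendsto_0: "(flat_exp m \<longlongrightarrow> 0) (at 0)"
proof (rule filterlim_split_at)
  show "(flat_exp m \<longlongrightarrow> 0) (at_left 0)"
    by (rule tendsto_eventually) (auto simp: flat_exp_def eventually_at_filter)
  have "((\<lambda>t. inverse t ^ m / exp (inverse t)) \<longlongrightarrow> (0::real)) (at_right 0)"
    by (rule filterlim_compose[OF tendsto_power_div_exp_0 filterlim_inverse_at_top_right])
  then show "(flat_exp m \<longlongrightarrow> 0) (at_right 0)"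
    by (rule Lim_transform_eventually)
      (auto simp: flat_exp_def eventually_at_filter exp_minus field_simps)
qed

lemma flat_exp_DERIV:
  "(flat_exp m has_real_derivative flat_exp (m + 2) t - m * flat_exp (m + 1) t) (at t)"
proof (cases "t = 0")
  case True
  \<comment> \<open>At 0 the difference quotient of \<open>flat_exp m\<close> is the function
    \<open>flat_exp (Suc m)\<close> itself, so the previous limit applies.\<close>
  have "((\<lambda>h. (flat_exp m (0 + h) - flat_exp m 0) / h) \<longlongrightarrow> 0) (at 0)"
    by (rule Lim_transform_eventually[OF flat_exp_tendsto_0[of "Suc m"]])
      (auto simp: flat_exp_def eventually_at_filter field_simps)
  then show ?thesis
    unfolding True has_field_derivative_iff by (simp add: flat_exp_def)
next
  case False
  show ?thesis
  proof (cases "t > 0")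
    case True
    let ?D = "exp (- 1 / t) * (1 / t\<^sup>2) * inverse (t ^ m)
      + exp (- 1 / t) * (- (inverse (t ^ m) * (m * t ^ (m - 1)) * inverse (t ^ m)))"
    have "((\<lambda>t. exp (- 1 / t) * inverse (t ^ m)) has_real_derivative ?D) (at t)"
      using True by (auto intro!: derivative_eq_intros simp: power2_eq_square field_simps)
    also have "?D = flat_exp (m + 2) t - m * flat_exp (m + 1) t"
      using True by (cases m) (auto simp: flat_exp_def field_simps power2_eq_square)
    finally show ?thesis
      by (rule has_field_derivative_transform_within_open[where S="{0<..}"])
        (use True in \<open>auto simp: flat_exp_def field_simps\<close>)
  next
    case neg: False
    have "((\<lambda>_. 0) has_real_derivative flat_exp (m + 2) t - m * flat_exp (m + 1) t) (at t)"
      using neg by (simp add: flat_exp_def)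
    then show ?thesis
      by (rule has_field_derivative_transform_within_open[where S="{..<0}"])
        (use neg False in \<open>auto simp: flat_exp_def\<close>)
  qed
qed

lemma Ck_on_flat_exp_comp:
  fixes q :: "real^'n::finite \<Rightarrow> real"
  assumes S: "open S" and q: "\<And>k. Ck_on k q S"
  shows "Ck_on k (\<lambda>z. flat_exp m (q z)) S"
proof (induction k arbitrary: m)
  case 0
  have "isCont (flat_exp m) t" for t
    using flat_exp_DERIV DERIV_isCont by blast
  then have "continuous_on UNIV (flat_exp m)"
    by (simp add: continuous_at_imp_continuous_on)
  then show ?case
    using q[of 0] by (auto intro: continuous_on_compose2)
next
  case (Suc k)
  show ?case
  proof (rule Ck_on_SucI[OF S])
    show "((\<lambda>z. flat_exp m (q z)) has_derivative
      (\<lambda>v. (flat_exp (m + 2) (q z) - m * flat_exp (m + 1) (q z)) * frechet_derivative q (at z) v)) (at z)"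
      if "z \<in> S" for z
      using has_derivative_compose[OF Ck_on_has_derivative[OF S q that]] flat_exp_DERIV[of m "q z"]
      unfolding has_field_derivative_def by blast
    show "Ck_on k (\<lambda>z. (flat_exp (m + 2) (q z) - m * flat_exp (m + 1) (q z)) * frechet_derivative q (at z) (axis i 1)) S" for i
      unfolding partial_def[symmetric]
      by (intro Ck_on_mult Ck_on_diff S Suc Ck_on_const Ck_on_partial q)
  qed
qed

section \<open>Convolution and its derivatives\<close>

definition conv :: "(real^'n::finite \<Rightarrow> real) \<Rightarrow> (real^'n \<Rightarrow> real) \<Rightarrow> real^'n \<Rightarrow> real"
  where "conv F G x = (LINT y|lborel. F y * G (x - y))"

text \<open>The two uses of a mollification want the derivative on different factors: smoothness
  puts it on the mollifier, closeness of the derivatives puts it on the given function.\<close>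

lemma conv_commute:
  fixes F G :: "real^'n::finite \<Rightarrow> real"
  assumes "continuous_on UNIV F" "continuous_on UNIV G"
  shows "conv F G = conv G F"
proof (rule ext)
  fix x :: "real^'n"
  note [measurable] = assms[THEN borel_measurable_continuous_onI]
  \<comment> \<open>Lebesgue measure is invariant under the reflection sending y to x - y.\<close>
  have eq: "lborel = distr lborel borel (\<lambda>y. x - y)"
    using lborel_affine[of "-1" x] by (simp add: density_1)
  have "conv F G x = (LINT y|distr lborel borel (\<lambda>y. x - y). F (x - y) * G y)"
    by (subst integral_distr) (auto simp: conv_def)
  also have "\<dots> = conv G F x"
    unfolding eq[symmetric] by (simp add: conv_def mult.commute)
  finally show "conv F G x = conv G F x" .
qed

text \<open>\<open>leibniz_rule\<close>, used next to differentiate under the integral sign, is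
  about gauge integrals over a box; the box is chosen to contain the support of \<open>F\<close>,
  uniformly in \<open>x\<close>.\<close>

lemma conv_eq_integral_cbox:
  fixes F G :: "real^'n::finite \<Rightarrow> real"
  assumes "continuous_on UNIV F" "{y. F y \<noteq> 0} \<subseteq> cbox a b" "continuous_on UNIV G"
  shows "conv F G x = integral (cbox a b) (\<lambda>y. F y * G (x - y))"
    and "integrable lborel (\<lambda>y. F y * G (x - y))"
proof -
  have c: "continuous_on (cbox a b) (\<lambda>y. F y * G (x - y))"
    by (intro continuous_intros continuous_on_subset[OF assms(1)] continuous_on_compose2[OF assms(3)]) auto
  have i: "integrable lborel (\<lambda>y. indicator (cbox a b) y *\<^sub>R (F y * G (x - y)))"
    by (rule borel_integrable_compact[OF compact_cbox c])
  have eq: "indicator (cbox a b) y *\<^sub>R (F y * G (x - y)) = F y * G (x - y)" for y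
    using assms(2) by (cases "y \<in> cbox a b") auto
  show "integrable lborel (\<lambda>y. F y * G (x - y))" using i unfolding eq .
  show "conv F G x = integral (cbox a b) (\<lambda>y. F y * G (x - y))"
    using set_borel_integral_eq_integral(2)[of "cbox a b" "\<lambda>y. F y * G (x - y)"] i
    by (simp add: conv_def set_integrable_def set_lebesgue_integral_def eq[unfolded real_scaleR_def])
qed

lemma conv_has_derivative:
  fixes F G :: "real^'n::finite \<Rightarrow> real"
  assumes F: "continuous_on UNIV F" "{y. F y \<noteq> 0} \<subseteq> cbox a b" and G: "Ck_on (Suc 0) G UNIV"
  obtains D where "(conv F G has_derivative D) (at x)" "\<And>i. D (axis i 1) = conv F (partial i G) x"
proof -
  \<comment> \<open>The derivative of the integrand in \<open>x\<close>, as a bounded linear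
    function. Written through the partials of \<open>G\<close>, its joint continuity in
    \<open>x\<close> and \<open>y\<close> is visible.\<close>
  define fx where "fx x y = (\<Sum>i\<in>UNIV. (F y * partial i G (x - y)) *\<^sub>R blinfun_inner_right (axis i (1::real)))"
    for x y :: "real^'n"
  have fx_apply: "blinfun_apply (fx x y) v = F y * frechet_derivative G (at (x - y)) v" for x y v
  proof -
    have "G differentiable (at (x - y))" using G by (simp add: differentiable_on_open_iff)
    from frechet_derivative_partial[OF this, of v] show ?thesis
      by (simp add: fx_def blinfun.sum_left blinfun.scaleR_left inner_axis' sum_distrib_left ac_simps)
  qed
  have cG: "continuous_on UNIV G" "continuous_on UNIV (partial i G)" for i
    using G Ck_on_continuous by (auto dest: differentiable_imp_continuous_on)
  have cfx: "continuous_on (UNIV \<times> cbox a b) (\<lambda>(x, y). fx x y)"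
    unfolding fx_def split_beta
    by (intro continuous_intros continuous_on_compose2[OF cG(2)] continuous_on_compose2[OF F(1)]) auto
  have "((\<lambda>x. integral (cbox a b) (\<lambda>y. F y * G (x - y))) has_derivative
      blinfun_apply (integral (cbox a b) (fx x))) (at x within UNIV)"
  proof (rule leibniz_rule[OF _ _ cfx])
    fix x y :: "real^'n"
    have "(G has_derivative frechet_derivative G (at (x - y))) (at (x - y))"
      using Ck_on_has_derivative[OF _ G] by auto
    moreover have "((\<lambda>x. x - y) has_derivative (\<lambda>v. v)) (at x)"
      by (auto intro!: derivative_eq_intros)
    ultimately have "((\<lambda>x. G (x - y)) has_derivative frechet_derivative G (at (x - y))) (at x)"
      using has_derivative_compose by blast
    then have "((\<lambda>x. F y * G (x - y)) has_derivative (\<lambda>v. F y * frechet_derivative G (at (x - y)) v)) (at x)"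
      by (rule has_derivative_mult_right)
    then show "((\<lambda>x. F y * G (x - y)) has_derivative blinfun_apply (fx x y)) (at x within UNIV)"
      using fx_apply by presburger
    show "(\<lambda>y. F y * G (x - y)) integrable_on cbox a b"
      by (intro integrable_continuous continuous_intros continuous_on_subset[OF F(1)] continuous_on_compose2[OF cG(1)]) auto
  qed auto
  moreover have "conv F G = (\<lambda>x. integral (cbox a b) (\<lambda>y. F y * G (x - y)))"
    using conv_eq_integral_cbox(1)[OF F cG(1)] by (intro ext) simp
  ultimately have "(conv F G has_derivative blinfun_apply (integral (cbox a b) (fx x))) (at x)"
    by simp
  moreover have "blinfun_apply (integral (cbox a b) (fx x)) (axis i 1) = conv F (partial i G) x" for i
  proof -
    have "fx x integrable_on cbox a b"
      using continuous_on_compose2[OF cfx, of "cbox a b" "Pair x"] continuous_on_Pair[of "cbox a b" "\<lambda>_. x" "\<lambda>y. y"]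
      by (intro integrable_continuous) auto
    from integral_linear[OF this, of "\<lambda>L. blinfun_apply L (axis i 1)"]
    have "blinfun_apply (integral (cbox a b) (fx x)) (axis i 1)
        = integral (cbox a b) (\<lambda>y. blinfun_apply (fx x y) (axis i 1))"
      by (simp add: o_def blinfun.bounded_linear_left)
    then show ?thesis
      unfolding fx_apply partial_def[symmetric] using conv_eq_integral_cbox(1)[OF F cG(2)] by simp
  qed
  ultimately show thesis by (rule that)
qed

lemma partial_conv:
  fixes F G :: "real^'n::finite \<Rightarrow> real"
  assumes F: "continuous_on UNIV F" "{y. F y \<noteq> 0} \<subseteq> cbox a b" and G: "Ck_on (Suc 0) G UNIV"
  shows "partial i (conv F G) = conv F (partial i G)"
proof (rule ext)
  fix x
  obtain D where "(conv F G has_derivative D) (at x)" "\<And>i. D (axis i 1) = conv F (partial i G) x"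
    using conv_has_derivative[OF F G] by blast
  then show "partial i (conv F G) x = conv F (partial i G) x"
    by (simp add: has_derivative_imp_partial)
qed

lemma Ck_on_conv:
  fixes F G :: "real^'n::finite \<Rightarrow> real"
  assumes F: "continuous_on UNIV F" "{y. F y \<noteq> 0} \<subseteq> cbox a b" and G: "Ck_on k G UNIV"
  shows "Ck_on k (conv F G) UNIV"
  using G
proof (induction k arbitrary: G)
  case 0
  then have cG: "continuous_on UNIV G" by simp
  have "continuous_on UNIV (\<lambda>x. integral (cbox a b) (\<lambda>y. F y * G (x - y)))"
    by (rule integral_continuous_on_param, unfold split_beta)
      (intro continuous_intros continuous_on_compose2[OF cG] continuous_on_compose2[OF F(1)]; auto)
  then show ?case
    using conv_eq_integral_cbox(1)[OF F cG] by (simp cong: continuous_on_cong)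
next
  case (Suc k)
  have G1: "Ck_on (Suc 0) G UNIV"
    by (rule Ck_on_mono[OF Suc.prems]) simp
  have "conv F G differentiable (at x)" for x
  proof -
    obtain D where "(conv F G has_derivative D) (at x)"
      using conv_has_derivative[OF F G1] by blast
    then show ?thesis by (auto simp: differentiable_def)
  qed
  moreover have "Ck_on k (partial i (conv F G)) UNIV" for i
    unfolding partial_conv[OF F G1] by (rule Suc.IH[OF Ck_on_partial[OF Suc.prems]])
  ultimately show ?case by (simp add: differentiable_on_open_iff)
qed

section \<open>Mollifiers and bump functions\<close>

lemma mollifier_exists:
  assumes e: "e > 0"
  obtains \<rho> :: "real^'n::finite \<Rightarrow> real"
  where "\<And>k. Ck_on k \<rho> UNIV" "\<And>z. \<rho> z \<ge> 0" "{z. \<rho> z \<noteq> 0} \<subseteq> ball 0 e"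
    "(LINT z|lborel. \<rho> z) = 1"
proof -
  \<comment> \<open>The squared norm is written as a polynomial in the coordinates so that the
    \<open>Ck_on\<close> rules apply; \<open>q\<close> is positive exactly on the open ball of
    radius \<open>e\<close>.\<close>
  define q where "q z = e\<^sup>2 - (\<Sum>i\<in>UNIV. z $ i * z $ i)" for z :: "real^'n"
  have q_norm: "q z = e\<^sup>2 - (norm z)\<^sup>2" for z
    by (simp add: q_def power2_norm_eq_inner inner_vec_def)
  have q: "Ck_on k q UNIV" for k
    unfolding q_def by (intro Ck_on_diff Ck_on_const Ck_on_sum Ck_on_mult Ck_on_nth) auto
  define r where "r z = flat_exp 0 (q z)" for z :: "real^'n"
  have r: "Ck_on k r UNIV" for k
    unfolding r_def by (rule Ck_on_flat_exp_comp) (auto simp: q)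
  have r0: "r z \<ge> 0" for z
    by (simp add: r_def flat_exp_def)
  have r_out: "r z = 0" if "norm z \<ge> e" for z
  proof -
    have "e\<^sup>2 \<le> (norm z)\<^sup>2" using that e by (intro power_mono) auto
    then have "q z \<le> 0" unfolding q_norm by linarith
    then show ?thesis by (simp add: r_def flat_exp_def)
  qed
  have r_in: "r z > 0" if "norm z < e" for z
    using that e by (simp add: r_def flat_exp_def q_norm power_strict_mono)
  obtain a b :: "real^'n" where ab: "cball 0 e \<subseteq> cbox a b"
    using bounded_subset_cbox_symmetric[OF bounded_cball] by metis
  have cr: "continuous_on UNIV r" using r[of 0] by simp
  have r_supp: "{z. r z \<noteq> 0} \<subseteq> ball 0 e"
    using r_out by (force simp: not_le[symmetric])
  then have "{z. r z \<noteq> 0} \<subseteq> cbox a b"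
    using ab ball_subset_cball by blast
  from conv_eq_integral_cbox(2)[OF cr this, of "\<lambda>_. 1" 0]
  have int: "integrable lborel r" by simp
  \<comment> \<open>A vanishing integral would make \<open>r\<close> zero almost everywhere, but
    \<open>r\<close> is positive on a ball. This allows the normalisation at the end.\<close>
  have "(LINT z|lborel. r z) \<noteq> 0"
  proof
    assume "(LINT z|lborel. r z) = 0"
    then have "AE z in lborel. r z = 0"
      using integral_nonneg_eq_0_iff_AE[OF int] r0 by auto
    then have "emeasure lborel {z. r z \<noteq> 0} = 0"
      using int by (subst (asm) AE_iff_measurable[OF _ refl]) auto
    moreover have "ball 0 e \<subseteq> {z. r z \<noteq> 0}"
      using r_in by force
    moreover have "{z. r z \<noteq> 0} \<in> sets lborel"
      using int by measurable
    ultimately have "emeasure lborel (ball (0::real^'n) e) = 0"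
      by (metis emeasure_mono le_zero_eq)
    then show False
      using open_not_negligible[of "ball (0::real^'n) e"] e
      by (auto simp: negligible_iff_null_sets null_sets_def)
  qed
  then have pos: "(LINT z|lborel. r z) > 0"
    using Bochner_Integration.integral_nonneg[of lborel r] r0 by (simp add: less_le)
  show thesis
  proof
    show "Ck_on k (\<lambda>z. r z * (1 / (LINT z|lborel. r z))) UNIV" for k
      by (intro Ck_on_mult r Ck_on_const) auto
  qed (use pos r0 r_supp in auto)
qed

lemma compact_support_uniformly_continuous:
  fixes F :: "'a::euclidean_space \<Rightarrow> real"
  assumes F: "continuous_on UNIV F" and K: "compact K" "{y. F y \<noteq> 0} \<subseteq> K" and e: "e > 0"
  obtains d where "d > 0" "\<And>x y. dist x y < d \<Longrightarrow> \<bar>F x - F y\<bar> < e"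
proof -
  obtain R where R: "K \<subseteq> cball 0 R"
    using compact_imp_bounded[OF K(1)] unfolding bounded_iff by (auto simp: subset_iff)
  \<comment> \<open>Two points at distance less than 1 either both lie in the ball of radius
    \<open>R + 1\<close>, or both have norm above \<open>R\<close>, where \<open>F\<close>
    vanishes.\<close>
  have "uniformly_continuous_on (cball 0 (R + 1)) F"
    by (intro compact_uniformly_continuous continuous_on_subset[OF F]) auto
  then obtain d where d: "d > 0"
    "\<And>x y. x \<in> cball 0 (R+1) \<Longrightarrow> y \<in> cball 0 (R+1) \<Longrightarrow> dist x y < d \<Longrightarrow> dist (F x) (F y) < e"
    unfolding uniformly_continuous_on_def using e by metis
  show thesis
  proof
    show "min d 1 > 0" using d by simp
    fix x y :: 'a assume xy: "dist x y < min d 1"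
    have n: "norm x \<le> norm y + 1" "norm y \<le> norm x + 1"
      using xy norm_triangle_ineq2[of x y] norm_triangle_ineq2[of y x]
      by (auto simp: dist_norm norm_minus_commute)
    have out: "F w = 0" if "norm w > R" for w
      using that R K(2) by (force simp: subset_iff)
    show "\<bar>F x - F y\<bar> < e"
    proof (cases "norm x \<le> R + 1 \<and> norm y \<le> R + 1")
      case True
      then show ?thesis using d(2)[of x y] xy by (simp add: dist_real_def)
    next
      case False
      then show ?thesis using out[of x] out[of y] n e by fastforce
    qed
  qed
qed

text \<open>\<open>conv \<rho> F x\<close> is a weighted average of the values of \<open>F\<close>
  at distance less than \<open>d\<close> from \<open>x\<close>. With \<open>e = 0\<close> this also
  yields exact values where \<open>F\<close> is locally constant.\<close>

lemma conv_mollifier_close: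
  fixes F \<rho> :: "real^'n::finite \<Rightarrow> real"
  assumes \<rho>: "continuous_on UNIV \<rho>" "\<And>z. \<rho> z \<ge> 0" "{z. \<rho> z \<noteq> 0} \<subseteq> ball 0 d" "(LINT z|lborel. \<rho> z) = 1"
    and F: "continuous_on UNIV F" and close: "\<And>y. norm y < d \<Longrightarrow> \<bar>F (x - y) - c\<bar> \<le> e"
  shows "\<bar>conv \<rho> F x - c\<bar> \<le> e"
proof -
  obtain a b :: "real^'n" where ab: "cball 0 d \<subseteq> cbox a b"
    using bounded_subset_cbox_symmetric[OF bounded_cball] by metis
  have out: "{y. \<rho> y \<noteq> 0} \<subseteq> cbox a b"
    using ab \<rho>(3) ball_subset_cball by blast
  have int: "integrable lborel (\<lambda>y. \<rho> y * F (x - y))" "integrable lborel \<rho>"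
    using conv_eq_integral_cbox(2)[OF \<rho>(1) out F, of x]
      conv_eq_integral_cbox(2)[OF \<rho>(1) out, of "\<lambda>_. 1" x] by auto
  have eq: "conv \<rho> F x - c = (LINT y|lborel. \<rho> y * (F (x - y) - c))"
    using int \<rho>(4) by (simp add: conv_def right_diff_distrib)
  have le: "\<bar>\<rho> y * (F (x - y) - c)\<bar> \<le> e * \<rho> y" for y
    using close[of y] \<rho>(2)[of y] \<rho>(3) mult_left_mono[of "\<bar>F (x - y) - c\<bar>" e "\<rho> y"]
    by (cases "\<rho> y = 0") (auto simp: abs_mult mult.commute)
  have "\<bar>LINT y|lborel. \<rho> y * (F (x - y) - c)\<bar> \<le> (LINT y|lborel. \<bar>\<rho> y * (F (x - y) - c)\<bar>)"
    by (rule integral_abs_bound)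
  also have "\<dots> \<le> (LINT y|lborel. e * \<rho> y)"
    using int le by (intro integral_mono) (auto simp: right_diff_distrib)
  also have "\<dots> = e" using \<rho>(4) by simp
  finally show ?thesis unfolding eq .
qed

lemma smooth_bump_exists:
  fixes z :: "real^'n::finite"
  assumes r: "r > 0"
  obtains b :: "real^'n \<Rightarrow> real"
  where "\<And>k. Ck_on k b UNIV" "ball z r \<subseteq> {y. b y = 1}" "{y. b y \<noteq> 0} \<subseteq> cball z (4 * r)"
proof -
  obtain \<rho> :: "real^'n \<Rightarrow> real" where \<rho>: "\<And>k. Ck_on k \<rho> UNIV" "\<And>z. \<rho> z \<ge> 0"
      "{z. \<rho> z \<noteq> 0} \<subseteq> ball 0 r" "(LINT z|lborel. \<rho> z) = 1"
    using mollifier_exists[OF r, where 'n='n] by blast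
  \<comment> \<open>\<open>F\<close> is 1 up to distance \<open>2 * r\<close> and 0 from distance
    \<open>3 * r\<close> on. Averaging over radius \<open>r\<close> leaves the value 1 on the ball
    of radius \<open>r\<close> and the value 0 beyond \<open>4 * r\<close>.\<close>
  define F where "F y = max 0 (min 1 (3 - dist y z / r))" for y
  have F: "continuous_on UNIV F"
    unfolding F_def using r by (intro continuous_intros) auto
  have F1: "F y = 1" if "dist y z \<le> 2 * r" for y
    using that r by (auto simp: F_def field_simps min_def max_def)
  have F0: "F y = 0" if "dist y z \<ge> 3 * r" for y
    using that r by (auto simp: F_def field_simps min_def max_def)
  obtain u v :: "real^'n" where uv: "cball z (3 * r) \<subseteq> cbox u v"
    using bounded_subset_cbox_symmetric[OF bounded_cball] by metis
  have out: "{y. F y \<noteq> 0} \<subseteq> cbox u v"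
    using F0 uv by (force simp: not_le[symmetric] dist_commute)
  have c\<rho>: "continuous_on UNIV \<rho>" using \<rho>(1)[of 0] by simp
  have close: "dist (x - y) z \<le> dist x z + norm y" "dist x z \<le> dist (x - y) z + norm y" for x y
    using dist_triangle[of "x - y" z x] dist_triangle[of x z "x - y"] by (auto simp: dist_norm)
  show thesis
  proof
    show "Ck_on k (conv \<rho> F) UNIV" for k
      unfolding conv_commute[OF c\<rho> F] by (rule Ck_on_conv[OF F out \<rho>(1)])
    have "conv \<rho> F y = 1" if "y \<in> ball z r" for y
    proof -
      have "\<bar>conv \<rho> F y - 1\<bar> \<le> 0"
      proof (rule conv_mollifier_close[OF c\<rho> \<rho>(2-4) F])
        fix w :: "real^'n" assume "norm w < r"
        then show "\<bar>F (y - w) - 1\<bar> \<le> 0"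
          using close(1)[of y w] that by (subst F1) (auto simp: dist_commute)
      qed
      then show ?thesis by simp
    qed
    then show "ball z r \<subseteq> {y. conv \<rho> F y = 1}" by blast
    have "conv \<rho> F y = 0" if "y \<notin> cball z (4 * r)" for y
    proof -
      have "\<bar>conv \<rho> F y - 0\<bar> \<le> 0"
      proof (rule conv_mollifier_close[OF c\<rho> \<rho>(2-4) F])
        fix w :: "real^'n" assume "norm w < r"
        then show "\<bar>F (y - w) - 0\<bar> \<le> 0"
          using close(2)[of y w] that by (subst F0) (auto simp: dist_commute)
      qed
      then show ?thesis by simp
    qed
    then show "{y. conv \<rho> F y \<noteq> 0} \<subseteq> cball z (4 * r)" by blast
  qed
qed

text \<open>Mollification commutes with partial derivatives, so a single radius works for
  \<open>F\<close> and its partials of order one and two as soon as it is adapted to the uniform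
  continuity of all of them.\<close>

lemma C2_smooth_approximation:
  fixes F :: "real^'n::finite \<Rightarrow> real"
  assumes F: "Ck_on 2 F UNIV" and K: "compact K" "{y. F y \<noteq> 0} \<subseteq> K" and e: "e > 0" and \<delta>: "\<delta> > 0"
  obtains H where "\<And>k. Ck_on k H UNIV" "\<And>y. (\<And>x. x \<in> K \<Longrightarrow> \<delta> < dist x y) \<Longrightarrow> H y = 0"
    "\<And>y. \<bar>F y - H y\<bar> \<le> e" "\<And>i y. \<bar>partial i F y - partial i H y\<bar> \<le> e"
    "\<And>i j y. \<bar>partial i (partial j F) y - partial i (partial j H) y\<bar> \<le> e"
proof -
  have supp: "{y. partial i G y \<noteq> 0} \<subseteq> K" if G: "{y. G y \<noteq> 0} \<subseteq> K" for i and G :: "real^'n \<Rightarrow> real"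
  proof -
    have "partial i G y = 0" if "y \<notin> K" for y
    proof -
      have "partial i G y = partial i (\<lambda>_. 0) y"
        using K(1) that G by (intro partial_cong_open[of "- K"]) (auto simp: compact_imp_closed open_Compl)
      also have "\<dots> = 0" by (subst has_derivative_imp_partial) auto
      finally show ?thesis .
    qed
    then show ?thesis by blast
  qed
  note F' = Ck_on_2D[OF F]
  define \<F> where "\<F> = {F} \<union> range (\<lambda>i. partial i F) \<union> range (\<lambda>(i, j). partial i (partial j F))"
  have "\<exists>d>0. \<forall>x y. dist x y < d \<longrightarrow> \<bar>G x - G y\<bar> < e" if "G \<in> \<F>" for G
  proof -
    have "G = F \<or> (\<exists>i. G = partial i F) \<or> (\<exists>i j. G = partial i (partial j F))"
      using that by (auto simp: \<F>_def)
    then have "continuous_on UNIV G" "{y. G y \<noteq> 0} \<subseteq> K"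
      using K(2) F' supp[OF K(2)] supp[OF supp[OF K(2)]] by (elim disjE exE; simp)+
    from compact_support_uniformly_continuous[OF this(1) K(1) this(2) e] show ?thesis by metis
  qed
  then obtain d where d: "\<And>G. G \<in> \<F> \<Longrightarrow> d G > 0"
      "\<And>G x y. G \<in> \<F> \<Longrightarrow> dist x y < d G \<Longrightarrow> \<bar>G x - G y\<bar> < e"
    by metis
  have fin: "finite \<F>" by (simp add: \<F>_def)
  \<comment> \<open>\<open>\<F>\<close> is finite, so the minimum is positive; including
    \<open>\<delta>\<close> confines the support of the mollification to distance
    \<open>\<delta>\<close> from \<open>K\<close>.\<close>
  define r where "r = Min (insert \<delta> (d ` \<F>))"
  have r: "r > 0" "r \<le> \<delta>" "\<And>G. G \<in> \<F> \<Longrightarrow> r \<le> d G"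
    using d(1) \<delta> fin by (auto simp: r_def)
  obtain \<rho> :: "real^'n \<Rightarrow> real" where \<rho>: "\<And>k. Ck_on k \<rho> UNIV" "\<And>z. \<rho> z \<ge> 0"
      "{z. \<rho> z \<noteq> 0} \<subseteq> ball 0 r" "(LINT z|lborel. \<rho> z) = 1"
    using mollifier_exists[OF r(1), where 'n='n] by blast
  obtain u v :: "real^'n" where uv: "K \<union> cball 0 r \<subseteq> cbox u v"
    using bounded_subset_cbox_symmetric[of "K \<union> cball 0 r"] K(1) by (metis bounded_Un bounded_cball compact_imp_bounded)
  have Fout: "{y. F y \<noteq> 0} \<subseteq> cbox u v"
    using uv K(2) by blast
  have \<rho>out: "{y. \<rho> y \<noteq> 0} \<subseteq> cbox u v"
    using uv \<rho>(3) ball_subset_cball by blast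
  have c\<rho>: "continuous_on UNIV \<rho>" using \<rho>(1)[of 0] by simp
  have near: "\<bar>conv \<rho> G x - G x\<bar> \<le> e" if "G \<in> \<F>" for G x
  proof (rule conv_mollifier_close[OF c\<rho> \<rho>(2-4)])
    show "continuous_on UNIV G" using that F' by (auto simp: \<F>_def)
    show "\<bar>G (x - y) - G x\<bar> \<le> e" if "norm y < r" for y
      using d(2)[OF \<open>G \<in> \<F>\<close>, of "x - y" x] r(3)[OF \<open>G \<in> \<F>\<close>] that by (simp add: dist_norm)
  qed
  have p1: "partial i (conv \<rho> F) = conv \<rho> (partial i F)" for i
    by (rule partial_conv[OF c\<rho> \<rho>out F'(1)])
  have p2: "partial i (conv \<rho> (partial j F)) = conv \<rho> (partial i (partial j F))" for i j
    by (rule partial_conv[OF c\<rho> \<rho>out F'(2)])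
  show thesis
  proof
    show "Ck_on k (conv \<rho> F) UNIV" for k
      unfolding conv_commute[OF c\<rho> F'(3)] by (rule Ck_on_conv[OF F'(3) Fout \<rho>(1)])
    show "conv \<rho> F y = 0" if far: "\<And>x. x \<in> K \<Longrightarrow> \<delta> < dist x y" for y
    proof -
      have "\<bar>conv \<rho> F y - 0\<bar> \<le> 0"
      proof (rule conv_mollifier_close[OF c\<rho> \<rho>(2-4) F'(3)])
        fix w :: "real^'n" assume "norm w < r"
        then have "y - w \<notin> K"
          using far[of "y - w"] r(2) by (auto simp: dist_norm)
        then have "F (y - w) = 0" using K(2) by blast
        then show "\<bar>F (y - w) - 0\<bar> \<le> 0" by simp
      qed
      then show ?thesis by simp
    qed
    show "\<bar>F y - conv \<rho> F y\<bar> \<le> e" for y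
      using near[of F y] by (simp add: \<F>_def abs_minus_commute)
    show "\<bar>partial i F y - partial i (conv \<rho> F) y\<bar> \<le> e" for i y
      using near[of "partial i F" y] by (simp add: \<F>_def abs_minus_commute p1)
    show "\<bar>partial i (partial j F) y - partial i (partial j (conv \<rho> F)) y\<bar> \<le> e" for i j y
    proof -
      have "partial i (partial j F) \<in> \<F>"
        unfolding \<F>_def by (rule UnI2) (rule range_eqI[where x="(i, j)"], simp)
      from near[OF this, of y] show ?thesis by (simp add: abs_minus_commute p1 p2)
    qed
  qed
qed

section \<open>Norms induced by a positive definite matrix\<close>

lemma matrix_inv_mult:
  fixes M :: "real^'n^'n"
  assumes "invertible M"
  shows "M ** matrix_inv M = mat 1" "matrix_inv M ** M = mat 1"
  using assms unfolding invertible_def matrix_inv_def by (metis (mono_tags, lifting) someI_ex)+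

lemma matrix_inv_eqI:
  fixes M N :: "real^'n^'n"
  assumes "M ** N = mat 1"
  shows "matrix_inv M = N"
proof -
  have "invertible M"
    using assms matrix_left_right_inverse unfolding invertible_def by blast
  then have "matrix_inv M ** (M ** N) = N"
    by (simp add: matrix_mul_assoc matrix_inv_mult)
  then show ?thesis by (simp add: assms)
qed

lemma matrix_inv_transpose:
  fixes M :: "real^'n^'n"
  assumes "invertible M"
  shows "matrix_inv (transpose M) = transpose (matrix_inv M)"
  by (rule matrix_inv_eqI) (simp add: matrix_inv_mult[OF assms] flip: matrix_transpose_mul)

text \<open>The inner product of the type of matrices is tr(X^T Y), for which the adjoint of a
  multiplication is multiplication by the transpose.\<close>

lemma matrix_inner_mult_left:
  fixes X :: "real^'m^'k" and Y :: "real^'n^'m" and Z :: "real^'n^'k"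
  shows "(X ** Y) \<bullet> Z = Y \<bullet> (transpose X ** Z)"
proof -
  have "(X ** Y) \<bullet> Z = (\<Sum>i\<in>UNIV. \<Sum>j\<in>UNIV. \<Sum>k\<in>UNIV. X $ i $ k * Y $ k $ j * Z $ i $ j)"
    by (simp add: inner_vec_def matrix_matrix_mult_def sum_distrib_right)
  also have "\<dots> = (\<Sum>i\<in>UNIV. \<Sum>k\<in>UNIV. \<Sum>j\<in>UNIV. X $ i $ k * Y $ k $ j * Z $ i $ j)"
    by (rule sum.cong[OF refl], rule sum.swap)
  also have "\<dots> = (\<Sum>k\<in>UNIV. \<Sum>i\<in>UNIV. \<Sum>j\<in>UNIV. X $ i $ k * Y $ k $ j * Z $ i $ j)"
    by (rule sum.swap)
  also have "\<dots> = (\<Sum>k\<in>UNIV. \<Sum>j\<in>UNIV. \<Sum>i\<in>UNIV. X $ i $ k * Y $ k $ j * Z $ i $ j)"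
    by (rule sum.cong[OF refl], rule sum.swap)
  also have "\<dots> = Y \<bullet> (transpose X ** Z)"
    by (simp add: inner_vec_def matrix_matrix_mult_def transpose_def sum_distrib_left mult_ac)
  finally show ?thesis .
qed

lemma matrix_inner_transpose:
  fixes X Y :: "real^'m^'k"
  shows "transpose X \<bullet> transpose Y = X \<bullet> Y"
  unfolding inner_vec_def transpose_def by (simp, rule sum.swap)

lemma matrix_inner_mult_right:
  fixes X :: "real^'m^'k" and Y :: "real^'n^'m" and Z :: "real^'n^'k"
  shows "(X ** Y) \<bullet> Z = X \<bullet> (Z ** transpose Y)"
proof -
  have "(X ** Y) \<bullet> Z = (transpose Y ** transpose X) \<bullet> transpose Z"
    by (metis matrix_inner_transpose matrix_transpose_mul)
  also have "\<dots> = transpose X \<bullet> transpose (Z ** transpose Y)"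
    by (simp add: matrix_inner_mult_left matrix_transpose_mul)
  finally show ?thesis by (simp add: matrix_inner_transpose)
qed

text \<open>The formula of \<open>cotensor2_norm\<close> detached from the chart selected by
  \<open>chart_at\<close>, so that it can be evaluated in any chart.\<close>

definition tensor2_norm :: "real^'n^'n \<Rightarrow> real^'n^'n \<Rightarrow> real"
  where "tensor2_norm h T = sqrt (\<Sum>i\<in>UNIV. \<Sum>j\<in>UNIV. \<Sum>k\<in>UNIV. \<Sum>l\<in>UNIV.
               h $ i $ k * h $ j $ l * T $ i $ j * T $ k $ l)"

text \<open>Moving both factors \<open>B\<close> across the inner product turns the square of the
  right-hand side into the inner product of \<open>T\<close> with h T h, for h = B^T B.\<close>

lemma tensor2_norm_factor:
  fixes B T :: "real^'n^'n"
  shows "tensor2_norm (transpose B ** B) T = norm (B ** T ** transpose B)"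
proof -
  define h where "h = transpose B ** B"
  have sym: "h $ i $ j = h $ j $ i" for i j
    by (simp add: h_def matrix_matrix_mult_def transpose_def mult.commute)
  have "(B ** T ** transpose B) \<bullet> (B ** T ** transpose B)
      = T \<bullet> (transpose B ** (B ** T ** transpose B ** transpose (transpose B)))"
    by (simp only: matrix_inner_mult_right[of "B ** T"] matrix_inner_mult_left[of B T])
  also have "\<dots> = T \<bullet> (h ** T ** h)"
    by (simp add: matrix_mul_assoc h_def)
  also have "\<dots> = (\<Sum>i\<in>UNIV. \<Sum>j\<in>UNIV. \<Sum>l\<in>UNIV. \<Sum>k\<in>UNIV. h $ i $ k * h $ l $ j * T $ i $ j * T $ k $ l)"
    by (simp add: inner_vec_def matrix_matrix_mult_def
        sum_distrib_left sum_distrib_right mult_ac)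
  also have "\<dots> = (\<Sum>i\<in>UNIV. \<Sum>j\<in>UNIV. \<Sum>k\<in>UNIV. \<Sum>l\<in>UNIV. h $ i $ k * h $ j $ l * T $ i $ j * T $ k $ l)"
    by (rule sum.cong[OF refl], rule sum.cong[OF refl], subst sum.swap) (simp only: sym)
  finally show ?thesis
    by (simp add: tensor2_norm_def h_def norm_eq_sqrt_inner)
qed

lemma covector_norm_factor:
  fixes B :: "real^'n^'n"
  shows "(\<Sum>i\<in>UNIV. \<Sum>j\<in>UNIV. (transpose B ** B) $ i $ j * v $ i * w $ j) = (B *v v) \<bullet> (B *v w)"
proof -
  have "(B *v v) \<bullet> (B *v w) = v \<bullet> ((transpose B ** B) *v w)"
    by (metis dot_lmul_matrix inner_commute matrix_vector_mul_assoc transpose_matrix_vector)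
  also have "\<dots> = (\<Sum>i\<in>UNIV. \<Sum>j\<in>UNIV. (transpose B ** B) $ i $ j * v $ i * w $ j)"
    unfolding inner_vec_def matrix_vector_mult_def by (simp add: sum_distrib_left mult_ac)
  finally show ?thesis by simp
qed

definition outer :: "real^'n \<Rightarrow> real^'n \<Rightarrow> real^'n^'n"
  where "outer v w = (\<chi> i j. v $ i * w $ j)"

lemma matrix_mult_outer:
  fixes B :: "real^'n^'n"
  shows "B ** outer v w ** transpose B = outer (B *v v) (B *v w)"
  by (simp add: vec_eq_iff outer_def matrix_matrix_mult_def matrix_vector_mult_def transpose_def
      sum_distrib_left sum_distrib_right mult_ac)

lemma norm_outer: "norm (outer v w) = norm v * norm w"
proof -
  have "outer v w \<bullet> outer v w = (v \<bullet> v) * (w \<bullet> w)"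
    unfolding outer_def inner_vec_def by (simp add: sum_product mult_ac)
  then show ?thesis by (simp add: norm_eq_sqrt_inner real_sqrt_mult)
qed

text \<open>The trace is the inner product of the identity with B T B^T, and Cauchy-Schwarz applies;
  the constant is the square root of the dimension.\<close>

lemma trace_factor_le:
  fixes B T :: "real^'n^'n"
  shows "\<bar>\<Sum>i\<in>UNIV. \<Sum>j\<in>UNIV. (transpose B ** B) $ i $ j * T $ i $ j\<bar>
    \<le> norm (mat 1 :: real^'n^'n) * norm (B ** T ** transpose B)"
proof -
  have "(\<Sum>i\<in>UNIV. \<Sum>j\<in>UNIV. (transpose B ** B) $ i $ j * T $ i $ j) = (transpose B ** (mat 1 ** B)) \<bullet> T"
    by (simp add: inner_vec_def)
  also have "\<dots> = mat 1 \<bullet> (B ** T ** transpose B)"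
    by (simp only: matrix_inner_mult_left[of "transpose B"] matrix_inner_mult_right[of "mat 1" B] transpose_transpose)
  finally show ?thesis
    by (simp add: Cauchy_Schwarz_ineq2)
qed

text \<open>Lagrange reduction: subtracting a square removes one coordinate direction and leaves a
  semidefinite form. \<open>S\<close> holds the directions not yet removed, and all others lie in
  the kernel of \<open>b\<close>.\<close>

lemma psd_bilinear_sum_of_squares:
  fixes b :: "real^'n \<Rightarrow> real^'n \<Rightarrow> real"
  assumes "finite S"
    and "bilinear b" "\<And>v w. b v w = b w v" "\<And>v. b v v \<ge> 0"
    and "\<And>a v. a \<notin> S \<Longrightarrow> b (axis a 1) v = 0"
  shows "\<exists>L::'n \<Rightarrow> real^'n \<Rightarrow> real. \<forall>v w. b v w = (\<Sum>k\<in>S. L k v * L k w)"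
  using assms
proof (induction S arbitrary: b rule: finite_induct)
  case empty
  have "b v w = 0" for v w
  proof -
    have "v = (\<Sum>i\<in>UNIV. v $ i *\<^sub>R axis i 1)"
      by (simp add: basis_expansion flip: scalar_mult_eq_scaleR)
    then have "b v w = b (\<Sum>i\<in>UNIV. v $ i *\<^sub>R axis i 1) w" by simp
    also have "\<dots> = (\<Sum>i\<in>UNIV. v $ i *\<^sub>R b (axis i 1) w)"
      using empty.prems(1) by (simp add: bilinear_def linear_sum[of "\<lambda>x. b x w"] linear_scale[of "\<lambda>x. b x w"])
    also have "\<dots> = 0" using empty.prems(4) by simp
    finally show ?thesis .
  qed
  then show ?case by simp
next
  case (insert a S)
  note bil = insert.prems(1) and sym = insert.prems(2) and pos = insert.prems(3)
  note lin = bilinear_ladd[OF bil] bilinear_radd[OF bil] bilinear_lmul[OF bil] bilinear_rmul[OF bil]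
  define e where "e = (axis a 1 :: real^'n)"
  show ?case
  proof (cases "b e e = 0")
    case True
    have "b e v = 0" for v
    proof (rule ccontr)
      assume ne: "b e v \<noteq> 0"
      \<comment> \<open>If e is isotropic, b(v + t e, v + t e) is affine in t; this t gives it the
        value -1.\<close>
      define t where "t = - (b v v + 1) / (2 * b e v)"
      have t: "t * (2 * b e v) = - (b v v + 1)"
        using nonzero_eq_divide_eq[of "2 * b e v" t "- (b v v + 1)"] ne by (simp add: t_def)
      have "0 \<le> b (t *\<^sub>R e + v) (t *\<^sub>R e + v)" by (rule pos)
      also have "\<dots> = t * t * b e e + t * (2 * b e v) + b v v"
        by (simp only: lin sym[of v e] real_scaleR_def) (simp add: algebra_simps)
      also have "\<dots> = -1" unfolding t True by simp
      finally show False by simp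
    qed
    then have "\<exists>L::'n \<Rightarrow> real^'n \<Rightarrow> real. \<forall>v w. b v w = (\<Sum>k\<in>S. L k v * L k w)"
      using insert.prems(4) by (intro insert.IH bil sym pos) (metis e_def insertE)
    then obtain L :: "'n \<Rightarrow> real^'n \<Rightarrow> real" where L: "\<And>v w. b v w = (\<Sum>k\<in>S. L k v * L k w)" by blast
    have "b v w = (\<Sum>k\<in>insert a S. (L(a := \<lambda>_. 0)) k v * (L(a := \<lambda>_. 0)) k w)" for v w
      using insert.hyps by (subst sum.insert) (auto simp: L intro!: sum.cong)
    then show ?thesis by blast
  next
    case False
    then have p: "b e e > 0" using pos[of e] by simp
    define b' where "b' v w = b v w - b e v * b e w / b e e" for v w
    have "\<exists>L::'n \<Rightarrow> real^'n \<Rightarrow> real. \<forall>v w. b' v w = (\<Sum>k\<in>S. L k v * L k w)"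
    proof (rule insert.IH)
      show "bilinear b'"
        unfolding bilinear_def b'_def
        by (intro conjI allI linearI) (simp_all add: lin algebra_simps add_divide_distrib)
      show "b' v w = b' w v" for v w by (simp add: b'_def sym[of v w])
      show "0 \<le> b' v v" for v
      proof -
        \<comment> \<open>The minimiser of b(v + t e, v + t e) over t; the minimum is the reduced
          form at \<open>v\<close>, whence its positivity.\<close>
        let ?t = "- (b e v / b e e)"
        have "0 \<le> b (v + ?t *\<^sub>R e) (v + ?t *\<^sub>R e)" by (rule pos)
        also have "\<dots> = b v v + 2 * ?t * b e v + ?t * ?t * b e e"
          by (simp only: lin sym[of v e] real_scaleR_def) (simp add: algebra_simps)
        also have "\<dots> = b' v v" using p by (simp add: b'_def field_simps)
        finally show ?thesis .
      qed
      show "b' (axis c 1) v = 0" if "c \<notin> S" for c v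
      proof (cases "c = a")
        case True
        then show ?thesis using p by (simp add: b'_def e_def)
      next
        case False
        then show ?thesis
          using insert.prems(4)[of c] that sym by (simp add: b'_def)
      qed
    qed
    then obtain L :: "'n \<Rightarrow> real^'n \<Rightarrow> real" where L: "\<And>v w. b' v w = (\<Sum>k\<in>S. L k v * L k w)" by blast
    define L' where "L' = L(a := \<lambda>v. b e v / sqrt (b e e))"
    have "b v w = (\<Sum>k\<in>insert a S. L' k v * L' k w)" for v w
    proof -
      have "(\<Sum>k\<in>S. L' k v * L' k w) = b' v w"
        unfolding L using insert.hyps by (intro sum.cong) (auto simp: L'_def)
      then show ?thesis
        using insert.hyps p by (subst sum.insert) (auto simp: L'_def b'_def)
    qed
    then show ?thesis by blast
  qed
qed

lemma psd_matrix_factor: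
  fixes h :: "real^'n^'n"
  assumes sym: "transpose h = h" and pos: "\<And>v. v \<bullet> (h *v v) \<ge> 0"
  obtains B :: "real^'n^'n" where "h = transpose B ** B"
proof -
  have "\<exists>L::'n \<Rightarrow> real^'n \<Rightarrow> real. \<forall>v w. v \<bullet> (h *v w) = (\<Sum>k\<in>UNIV. L k v * L k w)"
  proof (rule psd_bilinear_sum_of_squares)
    show "bilinear (\<lambda>v w. v \<bullet> (h *v w))"
      unfolding bilinear_def
      by (intro conjI allI linearI) (simp_all add: inner_left_distrib inner_right_distrib matrix_vector_right_distrib matrix_vector_mult_scaleR)
    show "v \<bullet> (h *v w) = w \<bullet> (h *v v)" for v w
      by (metis dot_lmul_matrix inner_commute sym transpose_matrix_vector)
  qed (use pos in auto)
  then obtain L :: "'n \<Rightarrow> real^'n \<Rightarrow> real" where L: "\<And>v w. v \<bullet> (h *v w) = (\<Sum>k\<in>UNIV. L k v * L k w)" by blast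
  have "h $ i $ j = (\<Sum>k\<in>UNIV. L k (axis i 1) * L k (axis j 1))" for i j
    unfolding L[symmetric] by (simp add: inner_axis' matrix_vector_mul_component inner_axis)
  then have "h = transpose (\<chi> k i. L k (axis i 1)) ** (\<chi> k i. L k (axis i 1))"
    by (simp add: vec_eq_iff matrix_matrix_mult_def transpose_def)
  then show thesis by (rule that)
qed

text \<open>The rows of \<open>B\<close> are a basis orthonormal for \<open>g\<close>, since B g B^T
  = 1. Multiplication by \<open>B\<close> therefore computes components in an orthonormal
  frame.\<close>

lemma spd_inverse_factor:
  fixes g :: "real^'n^'n"
  assumes sym: "transpose g = g" and pos: "\<And>v. v \<noteq> 0 \<Longrightarrow> v \<bullet> (g *v v) > 0"
  obtains B :: "real^'n^'n" where "matrix_inv g = transpose B ** B"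
proof -
  have inv: "invertible g"
    unfolding invertible_left_inverse matrix_left_invertible_ker using pos by fastforce
  have "v \<bullet> (matrix_inv g *v v) \<ge> 0" for v
  proof -
    let ?w = "matrix_inv g *v v"
    have "g *v ?w = v" by (simp add: matrix_vector_mul_assoc matrix_inv_mult[OF inv])
    then have "v \<bullet> ?w = ?w \<bullet> (g *v ?w)" by (simp add: inner_commute)
    then show ?thesis using pos[of ?w] by (cases "?w = 0") auto
  qed
  moreover have "transpose (matrix_inv g) = matrix_inv g"
    using matrix_inv_transpose[OF inv] sym by simp
  ultimately show thesis using psd_matrix_factor that by metis
qed

section \<open>Continuity of the inverse matrix\<close>

lemma continuous_on_det:
  fixes M :: "'a::topological_space \<Rightarrow> real^'n^'n"
  assumes "\<And>i j. continuous_on S (\<lambda>x. M x $ i $ j)"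
  shows "continuous_on S (\<lambda>x. det (M x))"
  unfolding det_def by (intro continuous_intros assms)

text \<open>Cramer's rule makes every entry of the inverse a quotient of polynomials in the entries
  of \<open>M\<close>, which is how continuity is obtained next.\<close>

lemma matrix_inv_component:
  fixes M :: "real^'n^'n"
  assumes "invertible M"
  shows "matrix_inv M $ k $ j = det (\<chi> i l. if l = k then axis j 1 $ i else M $ i $ l) / det M"
proof -
  have d: "det M \<noteq> 0" using assms by (simp add: invertible_det_nz)
  have "M *v (matrix_inv M *v axis j 1) = axis j 1"
    by (simp add: matrix_vector_mul_assoc matrix_inv_mult[OF assms])
  then have "matrix_inv M *v axis j 1 = (\<chi> k. det (\<chi> i l. if l = k then axis j 1 $ i else M $ i $ l) / det M)"
    using cramer[OF d] by blast
  then have "(matrix_inv M *v axis j 1) $ k = det (\<chi> i l. if l = k then axis j 1 $ i else M $ i $ l) / det M"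
    by simp
  then show ?thesis by (simp add: matrix_vector_mul_component inner_axis)
qed

lemma continuous_on_matrix_inv:
  fixes M :: "'a::topological_space \<Rightarrow> real^'n^'n"
  assumes "\<And>i j. continuous_on S (\<lambda>x. M x $ i $ j)" "\<And>x. x \<in> S \<Longrightarrow> invertible (M x)"
  shows "continuous_on S (\<lambda>x. matrix_inv (M x) $ k $ j)"
proof -
  have "continuous_on S (\<lambda>x. det (\<chi> i l. if l = k then axis j 1 $ i else M x $ i $ l) / det (M x))"
  proof (intro continuous_on_divide continuous_on_det)
    show "continuous_on S (\<lambda>x. (\<chi> i l. if l = k then axis j 1 $ i else M x $ i $ l) $ a $ b)" for a b
      by (cases "b = k") (auto intro: assms)
  qed (use assms in \<open>auto simp: invertible_det_nz\<close>)
  then show ?thesis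
    using matrix_inv_component[OF assms(2)] by (simp cong: continuous_on_cong)
qed

section \<open>Charts and the transformation law of the Hessian\<close>

lemma has_derivative_vecI:
  fixes f :: "'a::real_normed_vector \<Rightarrow> 'b::euclidean_space^'n"
  assumes "\<And>i. ((\<lambda>x. f x $ i) has_derivative (\<lambda>h. f' h $ i)) (at a within S)"
  shows "(f has_derivative f') (at a within S)"
proof (rule has_derivative_componentwise_within[THEN iffD2], rule ballI)
  fix b :: "'b^'n" assume "b \<in> Basis"
  then obtain i u where b: "b = axis i u" "u \<in> Basis"
    unfolding Basis_vec_def by auto
  have "((\<lambda>x. f x $ i \<bullet> u) has_derivative (\<lambda>h. f' h $ i \<bullet> u)) (at a within S)"
    by (intro derivative_intros assms)
  then show "((\<lambda>x. f x \<bullet> b) has_derivative (\<lambda>h. f' h \<bullet> b)) (at a within S)"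
    by (simp add: b inner_axis)
qed

lemma bounded_bilinear_matrix_vector_mult: "bounded_bilinear ((*v) :: real^'n^'m \<Rightarrow> real^'n \<Rightarrow> real^'m)"
  unfolding bilinear_conv_bounded_bilinear[symmetric] bilinear_def
  by (intro conjI allI linearI)
    (simp_all add: matrix_vector_mult_add_rdistrib matrix_vector_right_distrib
      scaleR_matrix_vector_assoc matrix_vector_mult_scaleR)

text \<open>The transformation law of a covariant 2-tensor, read as the pull-back of a bilinear form
  along \<open>J\<close>.\<close>

lemma inner_transpose_sandwich:
  fixes J H :: "real^'n^'n"
  shows "v \<bullet> ((transpose J ** H ** J) *v w) = (J *v v) \<bullet> (H *v (J *v w))"
proof -
  have "v \<bullet> (transpose J *v y) = (J *v v) \<bullet> y" for y
    unfolding transpose_matrix_vector by (metis dot_lmul_matrix inner_commute)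
  then show ?thesis
    by (simp add: matrix_vector_mul_assoc[symmetric] del: transpose_matrix_vector)
qed

lemmas has_derivative_matrix_vector_mult =
  bounded_bilinear.FDERIV[OF bounded_bilinear_matrix_vector_mult]

lemma matrix_has_derivative_entries:
  fixes M :: "real^'n::finite \<Rightarrow> real^'k::finite^'m::finite"
  assumes "\<And>i j. (\<lambda>z. M z $ i $ j) differentiable (at z)"
  shows "(M has_derivative (\<lambda>v. \<chi> i j. \<Sum>k\<in>UNIV. v $ k * partial k (\<lambda>z. M z $ i $ j) z)) (at z)"
proof (intro has_derivative_vecI)
  fix i j
  have "((\<lambda>z. M z $ i $ j) has_derivative frechet_derivative (\<lambda>z. M z $ i $ j) (at z)) (at z)"
    using assms frechet_derivative_works by blast
  then show "((\<lambda>x. M x $ i $ j) has_derivative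
      (\<lambda>h. (\<chi> i j. \<Sum>k\<in>UNIV. h $ k * partial k (\<lambda>z. M z $ i $ j) z) $ i $ j)) (at z)"
    by (simp flip: frechet_derivative_partial[OF assms, unfolded real_scaleR_def])
qed

lemma vec_has_derivative_entries:
  fixes M :: "real^'n::finite \<Rightarrow> real^'m::finite"
  assumes "\<And>i. (\<lambda>z. M z $ i) differentiable (at z)"
  shows "(M has_derivative (\<lambda>v. \<chi> i. \<Sum>k\<in>UNIV. v $ k * partial k (\<lambda>z. M z $ i) z)) (at z)"
proof (intro has_derivative_vecI)
  fix i
  have "((\<lambda>z. M z $ i) has_derivative frechet_derivative (\<lambda>z. M z $ i) (at z)) (at z)"
    using assms frechet_derivative_works by blast
  then show "((\<lambda>x. M x $ i) has_derivative
      (\<lambda>h. (\<chi> i. \<Sum>k\<in>UNIV. h $ k * partial k (\<lambda>z. M z $ i) z) $ i)) (at z)"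
    by (simp flip: frechet_derivative_partial[OF assms, unfolded real_scaleR_def])
qed

text \<open>Both sides are trilinear in \<open>v\<close>, \<open>w\<close>, \<open>z\<close>, so this is the index formula for the
  Christoffel symbols of the first kind, freed from coordinates. In this form the change of charts
  only involves derivatives of products.\<close>

lemma christoffel_vector_form:
  fixes G :: "real^'n^'n"
  assumes low: "\<And>i j k. (\<Sum>m\<in>UNIV. \<Gamma> m i j * G $ m $ k) = 1/2 * (D i j k + D j i k - D k i j)"
    and DG: "\<And>v. DG v = (\<chi> i j. \<Sum>k\<in>UNIV. v $ k * D k i j)"
    and Gam: "\<And>v w. Gam v w = (\<chi> k. \<Sum>i\<in>UNIV. \<Sum>j\<in>UNIV. \<Gamma> k i j * v $ i * w $ j)"
  shows "Gam v w \<bullet> (G *v z) = 1/2 * (w \<bullet> (DG v *v z) + v \<bullet> (DG w *v z) - v \<bullet> (DG z *v w))"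
proof -
  define T where "T F = (\<Sum>i\<in>UNIV. \<Sum>j\<in>UNIV. \<Sum>k\<in>UNIV. F i j k * (v $ i * w $ j * z $ k))" for F
  have "w \<bullet> (DG v *v z) = (\<Sum>j\<in>UNIV. \<Sum>k\<in>UNIV. \<Sum>i\<in>UNIV. D i j k * (v $ i * w $ j * z $ k))"
    by (simp add: DG inner_vec_def matrix_vector_mult_def sum_distrib_left sum_distrib_right mult_ac)
  also have "\<dots> = (\<Sum>j\<in>UNIV. \<Sum>i\<in>UNIV. \<Sum>k\<in>UNIV. D i j k * (v $ i * w $ j * z $ k))"
    by (rule sum.cong[OF refl], rule sum.swap)
  also have "\<dots> = T D" unfolding T_def by (rule sum.swap)
  finally have 1: "w \<bullet> (DG v *v z) = T D" .
  have "v \<bullet> (DG w *v z) = (\<Sum>i\<in>UNIV. \<Sum>k\<in>UNIV. \<Sum>j\<in>UNIV. D j i k * (v $ i * w $ j * z $ k))"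
    by (simp add: DG inner_vec_def matrix_vector_mult_def sum_distrib_left sum_distrib_right mult_ac)
  also have "\<dots> = T (\<lambda>i j k. D j i k)"
    unfolding T_def by (rule sum.cong[OF refl], rule sum.swap)
  finally have 2: "v \<bullet> (DG w *v z) = T (\<lambda>i j k. D j i k)" .
  have 3: "v \<bullet> (DG z *v w) = T (\<lambda>i j k. D k i j)"
    by (simp add: T_def DG inner_vec_def matrix_vector_mult_def sum_distrib_left sum_distrib_right mult_ac)
  let ?t = "\<lambda>i j k m. \<Gamma> m i j * G $ m $ k * (v $ i * w $ j * z $ k)"
  have "Gam v w \<bullet> (G *v z) = (\<Sum>m\<in>UNIV. \<Sum>i\<in>UNIV. \<Sum>j\<in>UNIV. \<Sum>k\<in>UNIV. ?t i j k m)"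
    by (simp add: Gam inner_vec_def matrix_vector_mult_def sum_distrib_left sum_distrib_right mult_ac)
  also have "\<dots> = (\<Sum>i\<in>UNIV. \<Sum>m\<in>UNIV. \<Sum>j\<in>UNIV. \<Sum>k\<in>UNIV. ?t i j k m)"
    by (rule sum.swap)
  also have "\<dots> = (\<Sum>i\<in>UNIV. \<Sum>j\<in>UNIV. \<Sum>m\<in>UNIV. \<Sum>k\<in>UNIV. ?t i j k m)"
    by (rule sum.cong[OF refl], rule sum.swap)
  also have "\<dots> = (\<Sum>i\<in>UNIV. \<Sum>j\<in>UNIV. \<Sum>k\<in>UNIV. \<Sum>m\<in>UNIV. ?t i j k m)"
    by (rule sum.cong[OF refl], rule sum.cong[OF refl], rule sum.swap)
  also have "\<dots> = (\<Sum>i\<in>UNIV. \<Sum>j\<in>UNIV. \<Sum>k\<in>UNIV. (\<Sum>m\<in>UNIV. \<Gamma> m i j * G $ m $ k) * (v $ i * w $ j * z $ k))"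
    by (simp only: sum_distrib_right)
  also have "\<dots> = 1/2 * (T D + T (\<lambda>i j k. D j i k) - T (\<lambda>i j k. D k i j))"
    unfolding low T_def by (simp add: sum_distrib_left sum.distrib sum_subtractf algebra_simps add_divide_distrib diff_divide_distrib)
  finally show ?thesis unfolding 1 2 3 .
qed

section \<open>Charts, metric and Jacobians in a Riemannian manifold\<close>

abbreviation chart_image :: "('a, 'n::finite) chart \<Rightarrow> (real^'n) set"
  where "chart_image c \<equiv> chart_map c ` chart_dom c"

abbreviation chart_inv :: "('a, 'n::finite) chart \<Rightarrow> real^'n \<Rightarrow> 'a"
  where "chart_inv c \<equiv> inv_into (chart_dom c) (chart_map c)"

locale riemannian =
  fixes A :: "('a::{t2_space,second_countable_topology}, 'n::finite) chart set"
    and g :: "('a, 'n) tensor2"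
  assumes manifold: "riemannian_manifold A g"
begin

lemma atlas: "smooth_atlas A" and metric: "riemannian_metric A g"
  using manifold by (auto simp: riemannian_manifold_def)

lemma is_chart: "c \<in> A \<Longrightarrow> is_chart c"
  using atlas by (simp add: smooth_atlas_def)

lemma open_dom: "c \<in> A \<Longrightarrow> open (chart_dom c)"
  and open_image: "c \<in> A \<Longrightarrow> open (chart_image c)"
  using is_chart[of c] by (auto simp: is_chart_def)

lemma inj_chart: "c \<in> A \<Longrightarrow> inj_on (chart_map c) (chart_dom c)"
  using is_chart[of c] unfolding is_chart_def homeomorphism_def by (metis inj_on_inverseI)

lemma continuous_chart: "c \<in> A \<Longrightarrow> continuous_on (chart_dom c) (chart_map c)"
  using is_chart[of c] unfolding is_chart_def homeomorphism_def by blast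

lemma inv_chart [simp]:
  "c \<in> A \<Longrightarrow> x \<in> chart_dom c \<Longrightarrow> chart_inv c (chart_map c x) = x"
  by (rule inv_into_f_f[OF inj_chart])

lemma continuous_inv_chart:
  assumes "c \<in> A"
  shows "continuous_on (chart_image c) (chart_inv c)"
proof -
  obtain \<psi> where "homeomorphism (chart_dom c) (chart_image c) (chart_map c) \<psi>"
    using is_chart[OF assms] unfolding is_chart_def by blast
  then have "continuous_on (chart_image c) \<psi>" "\<And>x. x \<in> chart_dom c \<Longrightarrow> \<psi> (chart_map c x) = x"
    by (auto simp: homeomorphism_def)
  then show ?thesis
    by (elim continuous_on_eq) (auto simp: assms)
qed

lemma in_coords_chart [simp]: "c \<in> A \<Longrightarrow> x \<in> chart_dom c \<Longrightarrow> in_coords c f (chart_map c x) = f x"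
  by (simp add: in_coords_def)

lemma open_chart_image:
  assumes "c \<in> A" "open U"
  shows "open (chart_map c ` (chart_dom c \<inter> U))"
proof -
  have "chart_map c ` (chart_dom c \<inter> U)
      = chart_image c \<inter> chart_inv c -` U"
    using assms by auto
  then show ?thesis
    using continuous_on_open_vimage[OF open_image[OF assms(1)], of "chart_inv c"]
      continuous_inv_chart[OF assms(1)] assms(2) by (metis Int_commute)
qed

lemma metric_invertible: "c \<in> A \<Longrightarrow> x \<in> chart_dom c \<Longrightarrow> invertible (g c x)"
  using riemannian_metric_invertible[OF metric] .

lemma metric_symmetric: "c \<in> A \<Longrightarrow> x \<in> chart_dom c \<Longrightarrow> transpose (g c x) = g c x"
  and metric_positive: "c \<in> A \<Longrightarrow> x \<in> chart_dom c \<Longrightarrow> v \<noteq> 0 \<Longrightarrow> v \<bullet> (g c x *v v) > 0"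
  using metric[unfolded riemannian_metric_def, THEN conjunct2, THEN conjunct1, THEN bspec, THEN bspec] by auto

lemma metric_factor:
  assumes "c \<in> A" "x \<in> chart_dom c"
  obtains B :: "real^'n^'n" where "matrix_inv (g c x) = transpose B ** B"
  by (rule spd_inverse_factor[OF metric_symmetric[OF assms] metric_positive[OF assms]])

lemma metric_transform:
  "c \<in> A \<Longrightarrow> d \<in> A \<Longrightarrow> x \<in> chart_dom c \<Longrightarrow> x \<in> chart_dom d \<Longrightarrow>
    g d x = transpose (jacobian c d x) ** g c x ** jacobian c d x"
  using metric unfolding riemannian_metric_def by blast

lemma metric_Ck: "c \<in> A \<Longrightarrow> Ck_on k (\<lambda>z. in_coords c (g c) z $ i $ j) (chart_image c)"
  using metric unfolding riemannian_metric_def in_coords_def by blast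

lemma transition_Ck:
  "c \<in> A \<Longrightarrow> d \<in> A \<Longrightarrow> Ck_on k (in_coords d (chart_map c)) (chart_map d ` (chart_dom d \<inter> chart_dom c))"
  using atlas by (simp add: smooth_atlas_def)

text \<open>Read off from the metric: the determinants of \<open>g\<close> in the two charts differ
  by the square of the Jacobian determinant, and both are nonzero.\<close>

lemma jacobian_invertible:
  assumes "c \<in> A" "d \<in> A" "x \<in> chart_dom c" "x \<in> chart_dom d"
  shows "invertible (jacobian c d x)"
proof -
  have "det (g d x) = det (jacobian c d x) * det (g c x) * det (jacobian c d x)"
    by (simp add: metric_transform[OF assms] det_mul)
  moreover have "det (g d x) \<noteq> 0"
    using metric_invertible[of d x] assms by (simp add: invertible_det_nz)
  ultimately show ?thesis by (auto simp: invertible_det_nz)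
qed

lemma jacobian_chart:
  "jacobian c d x = (\<chi> i a. partial a (\<lambda>z. in_coords d (chart_map c) z $ i) (chart_map d x))"
  by (simp add: jacobian_def coord_deriv_def in_coords_def[abs_def])

lemma hessian_component:
  assumes c: "c \<in> A" and x: "x \<in> chart_dom c"
  shows "hessian g u c x $ i $ j = partial i (partial j (in_coords c u)) (chart_map c x)
    - (\<Sum>k\<in>UNIV. christoffel g c x k i j * partial k (in_coords c u) (chart_map c x))"
proof -
  have "coord_deriv c i (\<lambda>y. differential u c y $ j) x
      = partial i (\<lambda>z. partial j (in_coords c u) z) (chart_map c x)"
    unfolding coord_deriv_def
  proof (rule partial_cong_open[OF open_image[OF c]])
    show "in_coords c (\<lambda>y. differential u c y $ j) z = partial j (in_coords c u) z"
      if "z \<in> chart_image c" for z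
      using that c by (auto simp: differential_def coord_deriv_def)
  qed (use x in auto)
  then show ?thesis
    by (simp add: hessian_def covariant_deriv_def differential_def coord_deriv_def)
qed

section \<open>Transformation of the Christoffel symbols and of the Hessian\<close>

definition christoffel_vec :: "('a, 'n) chart \<Rightarrow> 'a \<Rightarrow> real^'n \<Rightarrow> real^'n \<Rightarrow> real^'n"
  where "christoffel_vec c x v w = (\<chi> k. \<Sum>i\<in>UNIV. \<Sum>j\<in>UNIV. christoffel g c x k i j * v $ i * w $ j)"

definition metric_deriv :: "('a, 'n) chart \<Rightarrow> 'a \<Rightarrow> real^'n \<Rightarrow> real^'n^'n"
  where "metric_deriv c x v = (\<chi> i j. \<Sum>k\<in>UNIV. v $ k * coord_deriv c k (\<lambda>y. g c y $ i $ j) x)"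

lemma christoffel_vec_metric:
  assumes "c \<in> A" "x \<in> chart_dom c"
  shows "christoffel_vec c x v w \<bullet> (g c x *v z) = 1/2 * (w \<bullet> (metric_deriv c x v *v z)
    + v \<bullet> (metric_deriv c x w *v z) - v \<bullet> (metric_deriv c x z *v w))"
  by (rule christoffel_vector_form[OF christoffel_lowered[OF atlas metric assms]])
    (simp_all add: metric_deriv_def christoffel_vec_def)

text \<open>The Jacobian as a function of the coordinates of \<open>d\<close>, so that it can be
  differentiated once more; \<open>jacobian\<close> takes a point of the manifold.\<close>

definition coord_jacobian :: "('a, 'n) chart \<Rightarrow> ('a, 'n) chart \<Rightarrow> real^'n \<Rightarrow> real^'n^'n"
  where "coord_jacobian c d z = (\<chi> i a. partial a (\<lambda>z. in_coords d (chart_map c) z $ i) z)"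

lemma metric_has_derivative:
  assumes "c \<in> A" "x \<in> chart_dom c"
  shows "(in_coords c (g c) has_derivative metric_deriv c x) (at (chart_map c x))"
proof -
  have "(\<lambda>z. in_coords c (g c) z $ i $ j) differentiable (at (chart_map c x))" for i j
    using metric_Ck[OF assms(1), of "Suc 0" i j] assms by (simp add: differentiable_on_open_iff open_image)
  from matrix_has_derivative_entries[OF this] show ?thesis
    by (simp add: metric_deriv_def[abs_def] coord_deriv_def in_coords_def[abs_def])
qed

text \<open>The second partials in the new chart contain a term du(D^2 \<tau>), for the transition
  map \<tau>. The Christoffel symbols change by the same D^2 \<tau>, and the two contributions
  cancel.\<close>

lemma hessian_transform:
  assumes c: "c \<in> A" and d: "d \<in> A" and x: "x \<in> chart_dom c" "x \<in> chart_dom d" and u: "Ck_fun A 2 u"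
  shows "hessian g u d x = transpose (jacobian c d x) ** hessian g u c x ** jacobian c d x"
proof -
  define \<tau> where "\<tau> = in_coords d (chart_map c)"
  define W where "W = chart_map d ` (chart_dom d \<inter> chart_dom c)"
  define J where "J = coord_jacobian c d"
  define z0 where "z0 = chart_map d x"
  define P where "P = (\<lambda>z. \<chi> i. partial i (in_coords c u) z)"
  have W: "open W" unfolding W_def by (rule open_chart_image[OF d open_dom[OF c]])
  have z0: "z0 \<in> W" using x by (auto simp: W_def z0_def)
  have \<tau>z0: "\<tau> z0 = chart_map c x" using x by (simp add: \<tau>_def z0_def d)
  have \<tau>_in: "\<tau> z \<in> chart_image c" if "z \<in> W" for z
    using that by (auto simp: W_def \<tau>_def d)
  have \<tau>: "Ck_on k \<tau> W" for k unfolding \<tau>_def W_def by (rule transition_Ck[OF c d])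
  have \<tau>i: "Ck_on k (\<lambda>z. \<tau> z $ i) W" for k i by (rule Ck_on_nth[OF W \<tau>])
  have d\<tau>: "\<tau> differentiable (at z)" "(\<lambda>z. \<tau> z $ i) differentiable (at z)" if "z \<in> W" for z i
    using \<tau>[of "Suc 0"] \<tau>i[of "Suc 0" i] that by (auto simp: differentiable_on_open_iff W)
  have J_nth: "J z $ i $ a = partial a (\<lambda>z. \<tau> z $ i) z" for z i a
    by (simp add: J_def coord_jacobian_def \<tau>_def)
  have J_x: "jacobian c d x = J z0"
    by (simp add: jacobian_chart J_def coord_jacobian_def z0_def)
  have J_chart: "jacobian c d y = J (chart_map d y)" for y
    by (simp add: jacobian_chart J_def coord_jacobian_def)
  have dJ: "(\<lambda>z. J z $ i $ a) differentiable (at z0)" for i a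
    using \<tau>i[of "Suc (Suc 0)" i] z0 unfolding J_nth[abs_def] by (auto simp: differentiable_on_open_iff W)
  define DJ where "DJ = (\<lambda>v. \<chi> i a. \<Sum>k\<in>UNIV. v $ k * partial k (\<lambda>z. J z $ i $ a) z0)"
  have DJ: "(J has_derivative DJ) (at z0)"
    unfolding DJ_def by (rule matrix_has_derivative_entries[OF dJ])
  have D\<tau>: "(\<tau> has_derivative (\<lambda>v. J z0 *v v)) (at z0)"
  proof -
    have "(\<tau> has_derivative (\<lambda>v. \<chi> i. \<Sum>k\<in>UNIV. v $ k * partial k (\<lambda>z. \<tau> z $ i) z0)) (at z0)"
      by (rule vec_has_derivative_entries[OF d\<tau>(2)[OF z0]])
    then show ?thesis
      by (simp add: matrix_vector_mult_def J_nth mult.commute)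
  qed
  \<comment> \<open>\<open>DJ\<close> is the second derivative of the transition map, so this is
    Schwarz's theorem for its components.\<close>
  have S_sym: "DJ v *v w = DJ w *v v" for v w
  proof (rule vec_eq_iff[THEN iffD2, rule_format])
    fix i
    have comm: "partial k (\<lambda>z. J z $ i $ a) z0 = partial a (\<lambda>z. J z $ i $ k) z0" for a k
      unfolding J_nth[abs_def] by (rule partial_commute[OF W \<tau>i z0])
    have "(DJ v *v w) $ i = (\<Sum>a\<in>UNIV. \<Sum>k\<in>UNIV. v $ k * w $ a * partial k (\<lambda>z. J z $ i $ a) z0)"
      by (simp add: DJ_def matrix_vector_mult_def sum_distrib_left sum_distrib_right mult_ac)
    also have "\<dots> = (\<Sum>k\<in>UNIV. \<Sum>a\<in>UNIV. v $ k * w $ a * partial k (\<lambda>z. J z $ i $ a) z0)"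
      by (rule sum.swap)
    also have "\<dots> = (DJ w *v v) $ i"
      by (simp add: DJ_def matrix_vector_mult_def sum_distrib_left sum_distrib_right mult_ac comm[of _ "_::'n"])
    finally show "(DJ v *v w) $ i = (DJ w *v v) $ i" .
  qed
  define G where "G = in_coords c (g c)"
  have DG: "(G has_derivative metric_deriv c x) (at (\<tau> z0))"
    unfolding G_def \<tau>z0 by (rule metric_has_derivative[OF c x(1)])
  have G_x: "G (\<tau> z0) = g c x" using x by (simp add: G_def \<tau>z0 c)
  have Gd: "in_coords d (g d) z = transpose (J z) ** G (\<tau> z) ** J z" if z: "z \<in> W" for z
  proof -
    obtain y where y: "y \<in> chart_dom d" "y \<in> chart_dom c" "z = chart_map d y"
      using z by (auto simp: W_def)
    then show ?thesis
      by (simp add: c d G_def \<tau>_def J_chart[symmetric] metric_transform[OF c d])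
  qed
  \<comment> \<open>Differentiates the transformation law of the metric by the product rule and
    compares with \<open>metric_deriv d x\<close> by uniqueness of derivatives.\<close>
  have metric_deriv_d: "w \<bullet> (metric_deriv d x v *v q) =
      (J z0 *v w) \<bullet> (metric_deriv c x (J z0 *v v) *v (J z0 *v q))
      + (DJ v *v w) \<bullet> (g c x *v (J z0 *v q)) + (J z0 *v w) \<bullet> (g c x *v (DJ v *v q))" for v w q
  proof -
    have JW: "((\<lambda>z. J z *v w) has_derivative (\<lambda>v. DJ v *v w)) (at z0)" for w
      using has_derivative_matrix_vector_mult[OF DJ has_derivative_const[of w]] by simp
    have GT: "((\<lambda>z. G (\<tau> z)) has_derivative (\<lambda>v. metric_deriv c x (J z0 *v v))) (at z0)"
      by (rule has_derivative_compose[OF D\<tau> DG])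
    have "((\<lambda>z. (J z *v w) \<bullet> (G (\<tau> z) *v (J z *v q))) has_derivative
      (\<lambda>v. (J z0 *v w) \<bullet> (G (\<tau> z0) *v (DJ v *v q) + metric_deriv c x (J z0 *v v) *v (J z0 *v q))
        + (DJ v *v w) \<bullet> (G (\<tau> z0) *v (J z0 *v q)))) (at z0)"
      by (rule has_derivative_inner[OF JW has_derivative_matrix_vector_mult[OF GT JW]])
    moreover have "w \<bullet> (in_coords d (g d) z *v q) = (J z *v w) \<bullet> (G (\<tau> z) *v (J z *v q))" if "z \<in> W" for z
      unfolding Gd[OF that] by (rule inner_transpose_sandwich)
    ultimately have 1: "((\<lambda>z. w \<bullet> (in_coords d (g d) z *v q)) has_derivative
      (\<lambda>v. (J z0 *v w) \<bullet> (G (\<tau> z0) *v (DJ v *v q) + metric_deriv c x (J z0 *v v) *v (J z0 *v q))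
        + (DJ v *v w) \<bullet> (G (\<tau> z0) *v (J z0 *v q)))) (at z0)"
      using has_derivative_cong_open[OF W z0] by (metis (no_types, lifting))
    have "((\<lambda>z. w \<bullet> (in_coords d (g d) z *v q)) has_derivative (\<lambda>v. w \<bullet> (metric_deriv d x v *v q))) (at z0)"
      using has_derivative_inner_right[OF has_derivative_matrix_vector_mult[OF
            metric_has_derivative[OF d x(2)] has_derivative_const[of q]], of w] by (simp add: z0_def)
    from has_derivative_unique[OF this 1] show ?thesis
      by (simp add: fun_eq_iff G_x inner_right_distrib)
  qed
  have Gamma: "J z0 *v christoffel_vec d x v w = christoffel_vec c x (J z0 *v v) (J z0 *v w) + DJ v *v w" for v w
  proof -
    let ?L = "J z0 *v christoffel_vec d x v w"
    let ?R = "christoffel_vec c x (J z0 *v v) (J z0 *v w) + DJ v *v w"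
    have gsym: "a \<bullet> (g c x *v b) = b \<bullet> (g c x *v a)" for a b
      using metric_symmetric[OF c x(1)] by (metis dot_lmul_matrix inner_commute transpose_matrix_vector)
    have "?L \<bullet> (g c x *v (J z0 *v q)) = ?R \<bullet> (g c x *v (J z0 *v q))" for q
    proof -
      have "?L \<bullet> (g c x *v (J z0 *v q)) = christoffel_vec d x v w \<bullet> (g d x *v q)"
        unfolding metric_transform[OF c d x] J_x by (rule inner_transpose_sandwich[symmetric])
      \<comment> \<open>Of the six terms with \<open>DJ\<close>, four cancel by the symmetry of
        \<open>DJ\<close> and of the metric; the other two combine to the single term
        \<open>DJ v *v w\<close>.\<close>
      also have "\<dots> = ?R \<bullet> (g c x *v (J z0 *v q))"
        unfolding christoffel_vec_metric[OF d x(2)] metric_deriv_d inner_left_distrib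
          christoffel_vec_metric[OF c x(1)]
        using S_sym[of w v] S_sym[of q v] S_sym[of q w]
          gsym[of "J z0 *v w" "DJ v *v q"] gsym[of "J z0 *v v" "DJ w *v q"]
        by (simp add: field_simps)
      finally show ?thesis .
    qed
    then have eq: "(?L - ?R) \<bullet> (g c x *v (J z0 *v q)) = 0" for q
      by (simp add: inner_diff_left)
    \<comment> \<open>The choice of \<open>q\<close> for which the second argument in
      \<open>eq\<close> becomes \<open>?L - ?R\<close> itself; it exists as Jacobian and metric are
      invertible.\<close>
    have "J z0 *v (matrix_inv (J z0) *v (matrix_inv (g c x) *v (?L - ?R))) = matrix_inv (g c x) *v (?L - ?R)"
      using jacobian_invertible[OF c d x] by (simp add: matrix_vector_mul_assoc J_x matrix_mul_assoc matrix_inv_mult)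
    moreover have "g c x *v (matrix_inv (g c x) *v (?L - ?R)) = ?L - ?R"
      using metric_invertible[OF c x(1)] by (simp only: matrix_vector_mul_assoc matrix_inv_mult matrix_vector_mul_lid)
    ultimately have "(?L - ?R) \<bullet> (?L - ?R) = 0"
      using eq by metis
    then show ?thesis by simp
  qed
  have uc: "Ck_on 2 (in_coords c u) (chart_image c)"
    using u c by (simp add: Ck_fun_def)
  note uc' = Ck_on_2D[OF uc]
  have dP: "(\<lambda>z. P z $ i) differentiable (at (\<tau> z0))" for i
    using uc'(2)[of i] x unfolding \<tau>z0 by (simp add: P_def differentiable_on_open_iff open_image c)
  define DP where "DP = (\<lambda>v. \<chi> j. \<Sum>k\<in>UNIV. v $ k * partial k (\<lambda>z. P z $ j) (\<tau> z0))"
  have DP: "(P has_derivative DP) (at (\<tau> z0))"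
    unfolding DP_def by (rule vec_has_derivative_entries[OF dP])
  have first: "partial b (in_coords d u) z = P (\<tau> z) \<bullet> (J z *v axis b 1)" if "z \<in> W" for b z
  proof -
    have "partial b (in_coords d u) z = partial b (\<lambda>z. in_coords c u (\<tau> z)) z"
      by (rule partial_cong_open[OF W that]) (auto simp: W_def \<tau>_def c d)
    also have "\<dots> = (\<Sum>j\<in>UNIV. partial b (\<lambda>z. \<tau> z $ j) z * partial j (in_coords c u) (\<tau> z))"
      using uc'(1) \<tau>_in[OF that]
      by (intro partial_compose d\<tau>(1)[OF that]) (auto simp: differentiable_on_open_iff open_image c)
    also have "\<dots> = P (\<tau> z) \<bullet> (J z *v axis b 1)"
    proof -
      have "(J z *v axis b 1) $ j = partial b (\<lambda>z. \<tau> z $ j) z" for j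
        by (simp add: matrix_vector_mul_component inner_axis J_nth)
      then show ?thesis by (simp add: inner_vec_def P_def mult.commute)
    qed
    finally show ?thesis .
  qed
  have second: "partial a (partial b (in_coords d u)) z0
      = P (\<tau> z0) \<bullet> (DJ (axis a 1) *v axis b 1) + DP (J z0 *v axis a 1) \<bullet> (J z0 *v axis b 1)" for a b
  proof -
    have JW: "((\<lambda>z. J z *v axis b 1) has_derivative (\<lambda>v. DJ v *v axis b 1)) (at z0)"
      using has_derivative_matrix_vector_mult[OF DJ has_derivative_const[of "axis b 1"]] by simp
    have "((\<lambda>z. P (\<tau> z) \<bullet> (J z *v axis b 1)) has_derivative
        (\<lambda>v. P (\<tau> z0) \<bullet> (DJ v *v axis b 1) + DP (J z0 *v v) \<bullet> (J z0 *v axis b 1))) (at z0)"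
      by (rule has_derivative_inner[OF has_derivative_compose[OF D\<tau> DP] JW])
    from has_derivative_imp_partial[OF this, of a] show ?thesis
      using partial_cong_open[OF W z0 first[of _ b]] by simp
  qed
  show ?thesis
  proof (intro vec_eq_iff[THEN iffD2, rule_format])
    fix a b
    let ?v = "J z0 *v axis a 1" and ?w = "J z0 *v axis b 1"
    have "(\<Sum>k\<in>UNIV. christoffel g d x k a b * partial k (in_coords d u) z0)
        = (\<Sum>k\<in>UNIV. christoffel g d x k a b * (P (\<tau> z0) \<bullet> (J z0 *v axis k 1)))"
      by (simp add: first[OF z0])
    also have "\<dots> = P (\<tau> z0) \<bullet> (\<Sum>k\<in>UNIV. christoffel g d x k a b *\<^sub>R (J z0 *v axis k 1))"
      by (simp add: inner_sum_right)
    also have "(\<Sum>k\<in>UNIV. christoffel g d x k a b *\<^sub>R (J z0 *v axis k 1))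
        = J z0 *v (\<Sum>k\<in>UNIV. christoffel g d x k a b *\<^sub>R axis k 1)"
      by (simp add: matrix_vector_mult_scaleR linear_sum[OF matrix_vector_mul_linear])
    also have "(\<Sum>k\<in>UNIV. christoffel g d x k a b *\<^sub>R axis k 1) = christoffel_vec d x (axis a 1) (axis b 1)"
    proof -
      have "christoffel_vec d x (axis a 1) (axis b 1) $ k = christoffel g d x k a b" for k
        by (simp add: christoffel_vec_def axis_def if_distrib[of "\<lambda>u. _ * u"] cong: if_cong)
      then show ?thesis
        by (metis (no_types, lifting) basis_expansion scalar_mult_eq_scaleR sum.cong)
    qed
    \<comment> \<open>Here the term with \<open>DJ\<close> from \<open>second\<close> cancels
      against the one from \<open>Gamma\<close>.\<close>
    finally have "hessian g u d x $ a $ b = DP ?v \<bullet> ?w - P (\<tau> z0) \<bullet> christoffel_vec c x ?v ?w"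
      using hessian_component[OF d x(2), of u a b]
      by (simp add: z0_def[symmetric] second Gamma inner_right_distrib)
    also have "\<dots> = ?v \<bullet> (hessian g u c x *v ?w)"
    proof -
      let ?H = "\<lambda>i j. partial i (partial j (in_coords c u)) (\<tau> z0)"
      have "DP ?v \<bullet> ?w = (\<Sum>j\<in>UNIV. \<Sum>i\<in>UNIV. ?v $ i * ?w $ j * ?H i j)"
        by (simp add: inner_vec_def DP_def P_def sum_distrib_left sum_distrib_right mult_ac)
      also have "\<dots> = (\<Sum>i\<in>UNIV. \<Sum>j\<in>UNIV. ?v $ i * ?w $ j * ?H i j)" by (rule sum.swap)
      finally have 1: "DP ?v \<bullet> ?w = (\<Sum>i\<in>UNIV. \<Sum>j\<in>UNIV. ?v $ i * ?w $ j * ?H i j)" .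
      have "P (\<tau> z0) \<bullet> christoffel_vec c x ?v ?w
          = (\<Sum>k\<in>UNIV. \<Sum>i\<in>UNIV. \<Sum>j\<in>UNIV. ?v $ i * ?w $ j * (christoffel g c x k i j * P (\<tau> z0) $ k))"
        by (simp add: inner_vec_def christoffel_vec_def sum_distrib_left mult_ac)
      also have "\<dots> = (\<Sum>i\<in>UNIV. \<Sum>k\<in>UNIV. \<Sum>j\<in>UNIV. ?v $ i * ?w $ j * (christoffel g c x k i j * P (\<tau> z0) $ k))"
        by (rule sum.swap)
      also have "\<dots> = (\<Sum>i\<in>UNIV. \<Sum>j\<in>UNIV. \<Sum>k\<in>UNIV. ?v $ i * ?w $ j * (christoffel g c x k i j * P (\<tau> z0) $ k))"
        by (rule sum.cong[OF refl], rule sum.swap)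
      finally have 2: "P (\<tau> z0) \<bullet> christoffel_vec c x ?v ?w
          = (\<Sum>i\<in>UNIV. \<Sum>j\<in>UNIV. ?v $ i * ?w $ j * (\<Sum>k\<in>UNIV. christoffel g c x k i j * P (\<tau> z0) $ k))"
        by (simp only: sum_distrib_left)
      have H: "hessian g u c x $ i $ j = ?H i j - (\<Sum>k\<in>UNIV. christoffel g c x k i j * P (\<tau> z0) $ k)" for i j
        unfolding hessian_component[OF c x(1)] \<tau>z0 P_def by simp
      have "?v \<bullet> (hessian g u c x *v ?w) = (\<Sum>i\<in>UNIV. \<Sum>j\<in>UNIV. ?v $ i * (hessian g u c x $ i $ j * ?w $ j))"
        by (simp add: inner_vec_def matrix_vector_mult_def[of "hessian g u c x"] sum_distrib_left)
      then show ?thesis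
        unfolding 1 2 H by (simp add: sum_subtractf[symmetric] algebra_simps)
    qed
    also have "\<dots> = (transpose (J z0) ** hessian g u c x ** J z0) $ a $ b"
    proof -
      have "(transpose (J z0) ** hessian g u c x ** J z0) $ a $ b
          = axis a 1 \<bullet> ((transpose (J z0) ** hessian g u c x ** J z0) *v axis b 1)"
        by (simp add: inner_axis' matrix_vector_mul_component inner_axis)
      also have "\<dots> = ?v \<bullet> (hessian g u c x *v ?w)"
        by (rule inner_transpose_sandwich)
      finally show ?thesis by simp
    qed
    finally show "hessian g u d x $ a $ b = (transpose (jacobian c d x) ** hessian g u c x ** jacobian c d x) $ a $ b"
      unfolding J_x .
  qed
qed

end

section \<open>Pointwise norms of Hessians\<close>

text \<open>A crude constant, but continuous in \<open>h\<close>, hence bounded when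
  \<open>h\<close> is the inverse metric on a compact part of a chart.\<close>

lemma tensor2_norm_le:
  fixes h T :: "real^'n^'n"
  assumes "\<And>i j. \<bar>T $ i $ j\<bar> \<le> e"
  shows "tensor2_norm h T \<le> sqrt (\<Sum>i\<in>UNIV. \<Sum>j\<in>UNIV. \<Sum>k\<in>UNIV. \<Sum>l\<in>UNIV. \<bar>h $ i $ k\<bar> * \<bar>h $ j $ l\<bar>) * e"
proof -
  let ?h = "\<lambda>i j k l. \<bar>h $ i $ k\<bar> * \<bar>h $ j $ l\<bar>" and ?S = "\<Sum>i\<in>UNIV. \<Sum>j\<in>UNIV. \<Sum>k\<in>UNIV. \<Sum>l\<in>UNIV. \<bar>h $ i $ k\<bar> * \<bar>h $ j $ l\<bar>"
  have e: "e \<ge> 0" using assms[of undefined undefined] by linarith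
  have "h $ i $ k * h $ j $ l * T $ i $ j * T $ k $ l \<le> ?h i j k l * (e * e)" for i j k l
  proof -
    have "h $ i $ k * h $ j $ l * T $ i $ j * T $ k $ l \<le> \<bar>h $ i $ k * h $ j $ l * T $ i $ j * T $ k $ l\<bar>"
      by (rule abs_ge_self)
    also have "\<dots> = ?h i j k l * (\<bar>T $ i $ j\<bar> * \<bar>T $ k $ l\<bar>)"
      by (simp add: abs_mult mult_ac)
    also have "\<dots> \<le> ?h i j k l * (e * e)"
      using assms e by (intro mult_left_mono mult_mono) auto
    finally show ?thesis .
  qed
  then have "tensor2_norm h T
      \<le> sqrt (\<Sum>i\<in>UNIV. \<Sum>j\<in>UNIV. \<Sum>k\<in>UNIV. \<Sum>l\<in>UNIV. ?h i j k l * (e * e))"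
    unfolding tensor2_norm_def by (intro real_sqrt_le_mono sum_mono)
  also have "\<dots> = sqrt (?S * (e * e))"
    by (simp only: sum_distrib_right)
  also have "\<dots> = sqrt ?S * e"
    using e by (simp add: real_sqrt_mult)
  finally show ?thesis .
qed

lemma sandwich_linear:
  fixes B C S T :: "real^'n^'n"
  shows "B ** (S + T) ** C = B ** S ** C + B ** T ** C"
    and "B ** (S - T) ** C = B ** S ** C - B ** T ** C"
    and "B ** (a *\<^sub>R S) ** C = a *\<^sub>R (B ** S ** C)"
  by (simp_all add: vec_eq_iff matrix_matrix_mult_def sum_distrib_left sum_distrib_right
      algebra_simps sum.distrib sum_subtractf)

context riemannian
begin

lemma chart_at_in: "chart_at A x \<in> A" and in_chart_at: "x \<in> chart_dom (chart_at A x)"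
proof -
  have "\<exists>c. c \<in> A \<and> x \<in> chart_dom c"
    using atlas unfolding smooth_atlas_def by blast
  then have "chart_at A x \<in> A \<and> x \<in> chart_dom (chart_at A x)"
    unfolding chart_at_def by (rule someI_ex)
  then show "chart_at A x \<in> A" "x \<in> chart_dom (chart_at A x)" by auto
qed

lemma cotensor2_norm_eq:
  "cotensor2_norm A g T x = tensor2_norm (matrix_inv (g (chart_at A x) x)) (T (chart_at A x) x)"
  by (simp add: cotensor2_norm_def tensor2_norm_def Let_def)

text \<open>\<open>chart_at\<close> may jump from point to point; this formula in one fixed chart is
  what gives continuity of the norm. An orthonormal frame for \<open>c\<close> is rewritten for
  \<open>d\<close>, and the Jacobians cancel against those of
  \<open>hessian_transform\<close>.\<close>

lemma hessian_norm_chart: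
  assumes c: "c \<in> A" "x \<in> chart_dom c" and u: "Ck_fun A 2 u"
  shows "hessian_norm A g u x = tensor2_norm (matrix_inv (g c x)) (hessian g u c x)"
proof -
  define d where "d = chart_at A x"
  have d: "d \<in> A" "x \<in> chart_dom d" by (simp_all add: d_def chart_at_in in_chart_at)
  define J where "J = jacobian c d x"
  define Ji where "Ji = matrix_inv J"
  have J: "J ** Ji = mat 1" "Ji ** J = mat 1"
    unfolding Ji_def J_def using jacobian_invertible[OF c(1) d(1) c(2) d(2)] by (simp_all add: matrix_inv_mult)
  have Jt: "transpose J ** transpose Ji = mat 1" "transpose Ji ** transpose J = mat 1"
    unfolding matrix_transpose_mul[symmetric] J by simp_all
  obtain B :: "real^'n^'n" where B: "matrix_inv (g c x) = transpose B ** B"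
    using metric_factor[OF c] by blast
  \<comment> \<open>The rows of \<open>B\<close> are vectors in the coordinates of \<open>c\<close>;
    \<open>B'\<close> contains the same vectors in the coordinates of \<open>d\<close>.\<close>
  define B' where "B' = B ** transpose Ji"
  have gB: "g c x ** (transpose B ** B) = mat 1"
    unfolding B[symmetric] by (rule matrix_inv_mult(1)[OF metric_invertible[OF c]])
  have "matrix_inv (g d x) = transpose B' ** B'"
  proof (rule matrix_inv_eqI)
    have "g d x ** (transpose B' ** B')
        = transpose J ** (g c x ** ((J ** Ji) ** (transpose B ** B))) ** transpose Ji"
      unfolding metric_transform[OF c(1) d(1) c(2) d(2)] B'_def J_def[symmetric]
      by (simp add: matrix_transpose_mul matrix_mul_assoc)
    also have "\<dots> = mat 1" by (simp add: J gB Jt)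
    finally show "g d x ** (transpose B' ** B') = mat 1" .
  qed
  then have "hessian_norm A g u x = norm (B' ** hessian g u d x ** transpose B')"
    unfolding cotensor2_norm_eq d_def[symmetric] by (simp only: tensor2_norm_factor)
  also have "B' ** hessian g u d x ** transpose B'
      = B ** (transpose Ji ** transpose J) ** hessian g u c x ** (J ** Ji) ** transpose B"
    unfolding hessian_transform[OF c(1) d(1) c(2) d(2) u] B'_def J_def[symmetric]
    by (simp add: matrix_transpose_mul matrix_mul_assoc)
  also have "norm \<dots> = tensor2_norm (matrix_inv (g c x)) (hessian g u c x)"
    unfolding B tensor2_norm_factor by (simp add: J Jt)
  finally show ?thesis .
qed

section \<open>Continuity and local bounds for Hessians\<close>

lemma continuous_on_metric_inv:
  assumes "c \<in> A"
  shows "continuous_on (chart_dom c) (\<lambda>x. matrix_inv (g c x) $ i $ j)"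
proof (rule continuous_on_matrix_inv)
  fix i j
  have "continuous_on (chart_dom c) (\<lambda>x. in_coords c (g c) (chart_map c x) $ i $ j)"
    by (rule continuous_on_compose2[OF Ck_on_continuous[OF metric_Ck[OF assms]] continuous_chart[OF assms]]) auto
  then show "continuous_on (chart_dom c) (\<lambda>x. g c x $ i $ j)"
    by (simp add: assms cong: continuous_on_cong)
qed (rule metric_invertible[OF assms])

lemma continuous_on_coord_deriv:
  assumes "c \<in> A" "Ck_on (Suc 0) (in_coords c f) (chart_image c)"
  shows "continuous_on (chart_dom c) (coord_deriv c i f)"
  unfolding coord_deriv_def[abs_def]
  using continuous_on_compose2[OF _ continuous_chart[OF assms(1)], of "chart_image c" "partial i (in_coords c f)"]
    assms(2) by auto

lemma continuous_on_christoffel: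
  assumes "c \<in> A"
  shows "continuous_on (chart_dom c) (\<lambda>x. christoffel g c x k i j)"
proof -
  have "Ck_on (Suc 0) (in_coords c (\<lambda>y. g c y $ i $ j)) (chart_image c)" for i j
    using metric_Ck[OF assms] by (simp add: in_coords_def[abs_def])
  from continuous_on_coord_deriv[OF assms this] show ?thesis
    unfolding christoffel_def
    by (intro continuous_intros continuous_on_metric_inv[OF assms]) auto
qed

lemma continuous_on_hessian:
  assumes c: "c \<in> A" and u: "Ck_fun A 2 u"
  shows "continuous_on (chart_dom c) (\<lambda>x. hessian g u c x $ i $ j)"
proof -
  have uc: "Ck_on 2 (in_coords c u) (chart_image c)"
    using u c by (simp add: Ck_fun_def)
  have "continuous_on (chart_dom c) (\<lambda>x. partial i (partial j (in_coords c u)) (chart_map c x)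
    - (\<Sum>k\<in>UNIV. christoffel g c x k i j * partial k (in_coords c u) (chart_map c x)))"
    by (intro continuous_intros continuous_on_christoffel[OF c]
        continuous_on_compose2[OF Ck_on_2D(4)[OF uc] continuous_chart[OF c]]
        continuous_on_compose2[OF Ck_on_2D(5)[OF uc] continuous_chart[OF c]]) auto
  then show ?thesis
    by (simp add: hessian_component[OF c] cong: continuous_on_cong)
qed

lemma continuous_on_charts:
  assumes "\<And>c. c \<in> A \<Longrightarrow> continuous_on (chart_dom c) f"
  shows "continuous_on UNIV f"
proof -
  have "isCont f x" for x
    using assms[OF chart_at_in[of x]] open_dom[OF chart_at_in[of x]] in_chart_at[of x]
    by (simp add: continuous_on_eq_continuous_at)
  then show ?thesis by (simp add: continuous_at_imp_continuous_on)
qed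

lemma continuous_on_fun:
  assumes "Ck_fun A k u"
  shows "continuous_on UNIV u"
proof (rule continuous_on_charts)
  fix c assume c: "c \<in> A"
  have "continuous_on (chart_dom c) (\<lambda>x. in_coords c u (chart_map c x))"
    by (rule continuous_on_compose2[OF _ continuous_chart[OF c]])
      (use assms c in \<open>auto simp: Ck_fun_def intro: Ck_on_continuous\<close>)
  then show "continuous_on (chart_dom c) u"
    by (simp add: c cong: continuous_on_cong)
qed

lemma continuous_on_hessian_norm:
  assumes u: "Ck_fun A 2 u"
  shows "continuous_on UNIV (hessian_norm A g u)"
proof (rule continuous_on_charts)
  fix c assume c: "c \<in> A"
  have "continuous_on (chart_dom c) (\<lambda>x. tensor2_norm (matrix_inv (g c x)) (hessian g u c x))"
    unfolding tensor2_norm_def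
    by (intro continuous_intros continuous_on_metric_inv[OF c] continuous_on_hessian[OF c u])
  then show "continuous_on (chart_dom c) (hessian_norm A g u)"
    using hessian_norm_chart[OF c _ u] by (simp cong: continuous_on_cong)
qed

text \<open>Converts closeness of coordinate derivatives up to order two into closeness of Hessians.
  \<open>C\<close> depends on the metric over \<open>K\<close> only, so it can be fixed before the
  approximation is chosen.\<close>

lemma hessian_norm_bound_on_compact:
  assumes c: "c \<in> A" and K: "compact K" "K \<subseteq> chart_dom c"
  obtains C where "C > 0"
    "\<And>w x e. \<lbrakk>Ck_fun A 2 w; x \<in> K; \<And>i. \<bar>partial i (in_coords c w) (chart_map c x)\<bar> \<le> e;
      \<And>i j. \<bar>partial i (partial j (in_coords c w)) (chart_map c x)\<bar> \<le> e\<rbrakk>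
      \<Longrightarrow> hessian_norm A g w x \<le> C * e"
proof -
  let ?\<gamma> = "\<lambda>x i j k. \<bar>christoffel g c x k i j\<bar>"
  \<comment> \<open>The 1 accounts for the second partials, the sum for the Christoffel terms;
    summing over all indices gives one continuous bound for all components.\<close>
  define \<Gamma> where "\<Gamma> x = 1 + (\<Sum>i\<in>UNIV. \<Sum>j\<in>UNIV. \<Sum>k\<in>UNIV. ?\<gamma> x i j k)" for x
  define h where "h x = matrix_inv (g c x)" for x
  define \<Phi> where "\<Phi> x = sqrt (\<Sum>i\<in>UNIV. \<Sum>j\<in>UNIV. \<Sum>k\<in>UNIV. \<Sum>l\<in>UNIV. \<bar>h x $ i $ k\<bar> * \<bar>h x $ j $ l\<bar>)" for x
  have "continuous_on K (\<lambda>x. \<Phi> x * \<Gamma> x)"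
    unfolding \<Phi>_def \<Gamma>_def h_def
    by (intro continuous_intros continuous_on_subset[OF continuous_on_metric_inv[OF c] K(2)]
        continuous_on_subset[OF continuous_on_christoffel[OF c] K(2)])
  then have "bounded ((\<lambda>x. \<Phi> x * \<Gamma> x) ` K)"
    using K(1) compact_continuous_image compact_imp_bounded by blast
  then obtain C where C: "C > 0" "\<And>x. x \<in> K \<Longrightarrow> \<bar>\<Phi> x * \<Gamma> x\<bar> \<le> C"
    unfolding bounded_pos by auto
  show thesis
  proof
    fix w x e
    assume w: "Ck_fun A 2 w" and x: "x \<in> K"
      and e1: "\<And>i. \<bar>partial i (in_coords c w) (chart_map c x)\<bar> \<le> e"
      and e2: "\<And>i j. \<bar>partial i (partial j (in_coords c w)) (chart_map c x)\<bar> \<le> e"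
    have xc: "x \<in> chart_dom c" using x K by blast
    have e: "e \<ge> 0" using e1[of undefined] by linarith
    have "\<bar>hessian g w c x $ i $ j\<bar> \<le> \<Gamma> x * e" for i j
    proof -
      have "\<bar>hessian g w c x $ i $ j\<bar> \<le> \<bar>partial i (partial j (in_coords c w)) (chart_map c x)\<bar>
          + (\<Sum>k\<in>UNIV. \<bar>christoffel g c x k i j * partial k (in_coords c w) (chart_map c x)\<bar>)"
        unfolding hessian_component[OF c xc]
        by (rule order_trans[OF abs_triangle_ineq4 add_left_mono[OF sum_abs]])
      also have "\<dots> \<le> e + (\<Sum>k\<in>UNIV. ?\<gamma> x i j k * e)"
        unfolding abs_mult by (intro add_mono e2 sum_mono mult_left_mono e1) auto
      also have "\<dots> = (1 + (\<Sum>k\<in>UNIV. ?\<gamma> x i j k)) * e"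
        by (simp add: sum_distrib_right distrib_right)
      also have "\<dots> \<le> \<Gamma> x * e"
      proof (intro mult_right_mono e)
        have "(\<Sum>k\<in>UNIV. ?\<gamma> x i j k) \<le> (\<Sum>j\<in>UNIV. \<Sum>k\<in>UNIV. ?\<gamma> x i j k)"
          by (rule member_le_sum[where f="\<lambda>j. \<Sum>k\<in>UNIV. ?\<gamma> x i j k"]) (auto intro: sum_nonneg)
        also have "\<dots> \<le> (\<Sum>i\<in>UNIV. \<Sum>j\<in>UNIV. \<Sum>k\<in>UNIV. ?\<gamma> x i j k)"
          by (rule member_le_sum[where f="\<lambda>i. \<Sum>j\<in>UNIV. \<Sum>k\<in>UNIV. ?\<gamma> x i j k"]) (auto intro: sum_nonneg)
        finally show "1 + (\<Sum>k\<in>UNIV. ?\<gamma> x i j k) \<le> \<Gamma> x" by (simp add: \<Gamma>_def)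
      qed
      finally show ?thesis .
    qed
    then have "hessian_norm A g w x \<le> \<Phi> x * (\<Gamma> x * e)"
      unfolding hessian_norm_chart[OF c xc w] \<Phi>_def h_def by (rule tensor2_norm_le)
    also have "\<dots> \<le> C * e"
      using C(2)[OF x] e mult_right_mono[of "\<Phi> x * \<Gamma> x" C e] by (simp add: mult.assoc)
    finally show "hessian_norm A g w x \<le> C * e" .
  qed (rule C(1))
qed

section \<open>Sum and product rules on the manifold\<close>

lemma Ck_fun_add: "Ck_fun A k u \<Longrightarrow> Ck_fun A k v \<Longrightarrow> Ck_fun A k (\<lambda>x. u x + v x)"
  unfolding Ck_fun_def in_coords_def using open_image by (auto intro: Ck_on_add)

lemma Ck_fun_diff: "Ck_fun A k u \<Longrightarrow> Ck_fun A k v \<Longrightarrow> Ck_fun A k (\<lambda>x. u x - v x)"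
  unfolding Ck_fun_def in_coords_def using open_image by (auto intro: Ck_on_diff)

lemma Ck_fun_mult: "Ck_fun A k u \<Longrightarrow> Ck_fun A k v \<Longrightarrow> Ck_fun A k (\<lambda>x. u x * v x)"
  unfolding Ck_fun_def in_coords_def using open_image by (auto intro: Ck_on_mult)

lemma Ck_fun_const: "Ck_fun A k (\<lambda>x. a)"
  unfolding Ck_fun_def in_coords_def by auto

lemma coords_differentiable:
  assumes "c \<in> A" "x \<in> chart_dom c" "Ck_fun A 2 u"
  shows "in_coords c u differentiable (at (chart_map c x))"
    and "partial i (in_coords c u) differentiable (at (chart_map c x))"
  using Ck_on_2D(1,2)[of "in_coords c u" "chart_image c"] assms
  by (auto simp: Ck_fun_def differentiable_on_open_iff open_image)

lemma hessian_add:
  assumes c: "c \<in> A" "x \<in> chart_dom c" and u: "Ck_fun A 2 u" and v: "Ck_fun A 2 v"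
  shows "hessian g (\<lambda>x. u x + v x) c x = hessian g u c x + hessian g v c x"
proof (intro vec_eq_iff[THEN iffD2, rule_format])
  fix i j
  have eq: "in_coords c (\<lambda>x. u x + v x) = (\<lambda>z. in_coords c u z + in_coords c v z)"
    by (simp add: in_coords_def[abs_def])
  have p1: "partial k (in_coords c (\<lambda>x. u x + v x)) (chart_map c y)
      = partial k (in_coords c u) (chart_map c y) + partial k (in_coords c v) (chart_map c y)"
    if "y \<in> chart_dom c" for y k
    unfolding eq using coords_differentiable(1)[OF c(1) that] u v by (intro partial_add) auto
  have "partial i (partial j (in_coords c (\<lambda>x. u x + v x))) (chart_map c x)
      = partial i (\<lambda>z. partial j (in_coords c u) z + partial j (in_coords c v) z) (chart_map c x)"
    by (rule partial_cong_open[OF open_image[OF c(1)]]) (use c p1 in auto)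
  also have "\<dots> = partial i (partial j (in_coords c u)) (chart_map c x)
      + partial i (partial j (in_coords c v)) (chart_map c x)"
    using coords_differentiable(2)[OF c] u v by (intro partial_add) auto
  finally show "hessian g (\<lambda>x. u x + v x) c x $ i $ j = (hessian g u c x + hessian g v c x) $ i $ j"
    using p1[OF c(2)] by (simp add: hessian_component[OF c] algebra_simps sum.distrib)
qed

text \<open>The Christoffel terms contain first derivatives only and obey the Leibniz rule; the two
  outer products come from the mixed terms in the second partials.\<close>

lemma hessian_mult:
  assumes c: "c \<in> A" "x \<in> chart_dom c" and u: "Ck_fun A 2 u" and v: "Ck_fun A 2 v"
  shows "hessian g (\<lambda>x. u x * v x) c x = u x *\<^sub>R hessian g v c x + v x *\<^sub>R hessian g u c x
    + (outer (differential u c x) (differential v c x) + outer (differential v c x) (differential u c x))"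
proof (intro vec_eq_iff[THEN iffD2, rule_format])
  fix i j
  let ?u = "in_coords c u" and ?v = "in_coords c v" and ?z = "chart_map c x"
  have eq: "in_coords c (\<lambda>x. u x * v x) = (\<lambda>z. ?u z * ?v z)"
    by (simp add: in_coords_def[abs_def])
  have p1: "partial k (in_coords c (\<lambda>x. u x * v x)) (chart_map c y)
      = u y * partial k ?v (chart_map c y) + partial k ?u (chart_map c y) * v y"
    if "y \<in> chart_dom c" for y k
    unfolding eq using coords_differentiable(1)[OF c(1) that] u v
    by (subst partial_mult) (auto simp: that c(1))
  have "partial i (partial j (in_coords c (\<lambda>x. u x * v x))) ?z
      = partial i (\<lambda>z. ?u z * partial j ?v z + partial j ?u z * ?v z) ?z"
    by (rule partial_cong_open[OF open_image[OF c(1)]]) (use c p1 in auto)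
  also have "\<dots> = partial i (\<lambda>z. ?u z * partial j ?v z) ?z + partial i (\<lambda>z. partial j ?u z * ?v z) ?z"
    using coords_differentiable[OF c] u v by (intro partial_add) (auto intro: differentiable_mult)
  also have "\<dots> = (?u ?z * partial i (partial j ?v) ?z + partial i ?u ?z * partial j ?v ?z)
      + (partial j ?u ?z * partial i ?v ?z + partial i (partial j ?u) ?z * ?v ?z)"
    using coords_differentiable[OF c] u v by (simp add: partial_mult)
  finally have p2: "partial i (partial j (in_coords c (\<lambda>x. u x * v x))) ?z =
      (u x * partial i (partial j ?v) ?z + partial i ?u ?z * partial j ?v ?z)
      + (partial j ?u ?z * partial i ?v ?z + partial i (partial j ?u) ?z * v x)"
    by (simp add: c)
  show "hessian g (\<lambda>x. u x * v x) c x $ i $ j = (u x *\<^sub>R hessian g v c x + v x *\<^sub>R hessian g u c x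
    + (outer (differential u c x) (differential v c x) + outer (differential v c x) (differential u c x))) $ i $ j"
    unfolding vector_add_component vector_scaleR_component hessian_component[OF c] p2 p1[OF c(2)]
    by (simp add: outer_def differential_def coord_deriv_def algebra_simps sum.distrib sum_distrib_left)
qed

section \<open>Norm estimates in an orthonormal frame\<close>

text \<open>\<open>chart_factor x\<close> turns the chosen chart at \<open>x\<close> into an orthonormal frame.\<close>

definition chart_factor :: "'a \<Rightarrow> real^'n^'n"
  where "chart_factor x = (SOME B. matrix_inv (g (chart_at A x) x) = transpose B ** B)"

lemma chart_factor:
  "matrix_inv (g (chart_at A x) x) = transpose (chart_factor x) ** chart_factor x"
proof -
  obtain B :: "real^'n^'n" where "matrix_inv (g (chart_at A x) x) = transpose B ** B"
    using metric_factor[OF chart_at_in in_chart_at] by blast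
  then show ?thesis unfolding chart_factor_def by (rule someI)
qed

lemma cotensor2_norm_frame: "cotensor2_norm A g T x
    = norm (chart_factor x ** T (chart_at A x) x ** transpose (chart_factor x))"
  unfolding cotensor2_norm_eq chart_factor tensor2_norm_factor ..

lemma covector_norm_frame: "covector_norm A g \<omega> x = norm (chart_factor x *v \<omega> (chart_at A x) x)"
  by (simp add: covector_norm_def Let_def chart_factor covector_norm_factor norm_eq_sqrt_inner)

text \<open>Raising the index is an isometry: with \<omega> = du, both squares are the pairing of
  \<omega> with g^{-1} \<omega>. The integrability hypothesis concerns the gradient, the product
  rule the differential.\<close>

lemma gradient_norm_eq: "gradient_norm A g u x = differential_norm A g u x"
proof -
  let ?c = "chart_at A x"
  let ?g = "g ?c x" and ?\<omega> = "differential u ?c x"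
  have "(\<Sum>i\<in>UNIV. \<Sum>j\<in>UNIV. ?g $ i $ j * gradient g u ?c x $ i * gradient g u ?c x $ j)
      = gradient g u ?c x \<bullet> (?g *v gradient g u ?c x)"
    unfolding inner_vec_def matrix_vector_mult_def by (simp add: sum_distrib_left mult_ac)
  also have "\<dots> = (matrix_inv ?g *v ?\<omega>) \<bullet> ?\<omega>"
    using metric_invertible[OF chart_at_in in_chart_at]
    by (simp add: gradient_def matrix_vector_mul_assoc matrix_inv_mult)
  also have "\<dots> = ?\<omega> \<bullet> ((transpose (chart_factor x) ** chart_factor x) *v ?\<omega>)"
    unfolding chart_factor by (rule inner_commute)
  also have "\<dots> = (chart_factor x *v ?\<omega>) \<bullet> (chart_factor x *v ?\<omega>)"
    using inner_transpose_sandwich[of ?\<omega> "chart_factor x" "mat 1" ?\<omega>] by simp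
  finally show ?thesis
    by (simp add: vector_norm_def Let_def covector_norm_frame norm_eq_sqrt_inner)
qed

lemma laplacian_le:
  "\<bar>laplacian A g u x\<bar> \<le> norm (mat 1 :: real^'n^'n) * hessian_norm A g u x"
  using trace_factor_le[of "chart_factor x" "hessian g u (chart_at A x) x"]
  by (simp add: laplacian_def cotensor2_trace_def Let_def cotensor2_norm_frame chart_factor)

lemma hessian_norm_nonneg: "hessian_norm A g u x \<ge> 0"
  by (simp add: cotensor2_norm_frame)

lemma hessian_norm_add_le:
  assumes "Ck_fun A 2 u" "Ck_fun A 2 v"
  shows "hessian_norm A g (\<lambda>x. u x + v x) x \<le> hessian_norm A g u x + hessian_norm A g v x"
  using norm_triangle_ineq[of "chart_factor x ** hessian g u (chart_at A x) x ** transpose (chart_factor x)"]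
  by (simp add: cotensor2_norm_frame hessian_add[OF chart_at_in in_chart_at assms] sandwich_linear)

lemma laplacian_add:
  assumes "Ck_fun A 2 u" "Ck_fun A 2 v"
  shows "laplacian A g (\<lambda>x. u x + v x) x = laplacian A g u x + laplacian A g v x"
  by (simp add: laplacian_def cotensor2_trace_def Let_def hessian_add[OF chart_at_in in_chart_at assms]
      algebra_simps sum.distrib)

lemma norm_outer_frame:
  "norm (chart_factor x ** (outer (differential u (chart_at A x) x) (differential v (chart_at A x) x)) ** transpose (chart_factor x))
    = differential_norm A g u x * differential_norm A g v x"
  by (simp add: matrix_mult_outer norm_outer covector_norm_frame)

text \<open>The product rule solved for the term u Hess(v), followed by the triangle inequality in
  the frame. In the application \<open>u\<close> is a cut-off function and \<open>v\<close> the
  solution.\<close>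

lemma hessian_norm_mult_ge:
  assumes u: "Ck_fun A 2 u" and v: "Ck_fun A 2 v"
  shows "\<bar>u x\<bar> * hessian_norm A g v x \<le> hessian_norm A g (\<lambda>x. u x * v x) x
    + 2 * differential_norm A g u x * differential_norm A g v x + \<bar>v x\<bar> * hessian_norm A g u x"
proof -
  let ?B = "chart_factor x" and ?c = "chart_at A x"
  let ?F = "\<lambda>T. ?B ** T ** transpose ?B"
  let ?O = "outer (differential u ?c x) (differential v ?c x)"
  let ?O' = "outer (differential v ?c x) (differential u ?c x)"
  have "u x *\<^sub>R hessian g v ?c x = hessian g (\<lambda>x. u x * v x) ?c x - (?O + ?O') - v x *\<^sub>R hessian g u ?c x"
    by (simp add: hessian_mult[OF chart_at_in in_chart_at u v])
  then have "u x *\<^sub>R ?F (hessian g v ?c x) = ?F (hessian g (\<lambda>x. u x * v x) ?c x - (?O + ?O') - v x *\<^sub>R hessian g u ?c x)"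
    by (simp only: sandwich_linear(3)[symmetric])
  also have "\<dots> = ?F (hessian g (\<lambda>x. u x * v x) ?c x) - (?F ?O + ?F ?O') - v x *\<^sub>R ?F (hessian g u ?c x)"
    by (simp only: sandwich_linear)
  finally have "\<bar>u x\<bar> * norm (?F (hessian g v ?c x)) = norm (?F (hessian g (\<lambda>x. u x * v x) ?c x) - (?F ?O + ?F ?O') - v x *\<^sub>R ?F (hessian g u ?c x))"
    by (metis norm_scaleR)
  also have "\<dots> \<le> norm (?F (hessian g (\<lambda>x. u x * v x) ?c x)) + (norm (?F ?O) + norm (?F ?O')) + norm (v x *\<^sub>R ?F (hessian g u ?c x))"
    by (meson add_mono norm_triangle_ineq norm_triangle_ineq4 order_refl order_trans)
  finally show ?thesis
    by (simp add: cotensor2_norm_frame norm_outer_frame mult_ac)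
qed

text \<open>The term with the Laplacian of \<open>v\<close> is kept, since in the application it is
  the given right-hand side; the other three traces are estimated by Cauchy-Schwarz.\<close>

lemma laplacian_mult_le:
  assumes u: "Ck_fun A 2 u" and v: "Ck_fun A 2 v"
  shows "\<bar>laplacian A g (\<lambda>x. u x * v x) x\<bar> \<le> \<bar>u x\<bar> * \<bar>laplacian A g v x\<bar> + norm (mat 1 :: real^'n^'n) *
    (2 * differential_norm A g u x * differential_norm A g v x + \<bar>v x\<bar> * hessian_norm A g u x)"
proof -
  let ?B = "chart_factor x" and ?c = "chart_at A x" and ?N = "norm (mat 1 :: real^'n^'n)"
  define tr where "tr T = (\<Sum>i\<in>UNIV. \<Sum>j\<in>UNIV. (transpose ?B ** ?B) $ i $ j * T $ i $ j)" for T :: "real^'n^'n"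
  let ?O = "outer (differential u ?c x) (differential v ?c x)"
  let ?O' = "outer (differential v ?c x) (differential u ?c x)"
  have lap: "laplacian A g w x = - tr (hessian g w ?c x)" for w
    by (simp add: laplacian_def cotensor2_trace_def Let_def chart_factor tr_def)
  have tr_le: "\<bar>tr T\<bar> \<le> ?N * norm (?B ** T ** transpose ?B)" for T
    unfolding tr_def by (rule trace_factor_le)
  have lin: "tr (S + T) = tr S + tr T" "tr (a *\<^sub>R T) = a * tr T" for S T a
    by (simp_all add: tr_def algebra_simps sum.distrib sum_distrib_left)
  have "laplacian A g (\<lambda>x. u x * v x) x = u x * laplacian A g v x + (v x * laplacian A g u x - tr ?O - tr ?O')"
    unfolding lap hessian_mult[OF chart_at_in in_chart_at u v] lin by simp
  then have "\<bar>laplacian A g (\<lambda>x. u x * v x) x\<bar> \<le> \<bar>u x * laplacian A g v x\<bar> + (\<bar>v x * laplacian A g u x\<bar> + \<bar>tr ?O\<bar> + \<bar>tr ?O'\<bar>)"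
    by linarith
  also have "\<dots> \<le> \<bar>u x\<bar> * \<bar>laplacian A g v x\<bar> + (\<bar>v x\<bar> * (?N * hessian_norm A g u x)
      + ?N * (differential_norm A g u x * differential_norm A g v x)
      + ?N * (differential_norm A g v x * differential_norm A g u x))"
    using tr_le[of ?O] tr_le[of ?O'] laplacian_le[of u x]
    unfolding norm_outer_frame abs_mult by (intro add_mono mult_left_mono) auto
  finally show ?thesis by (simp add: algebra_simps)
qed

end

section \<open>Change of variables for arbitrary finite index types\<close>

text \<open>The change of variables theorem of the library needs a well-ordered index type. Every finite
  index type is transported to a well-ordered copy.\<close>

typedef 'n ordered_copy = "UNIV :: 'n set" ..

instance ordered_copy :: (finite) finite
proof
  have "(UNIV :: 'a ordered_copy set) = range Abs_ordered_copy"
    by (metis Rep_ordered_copy_inverse UNIV_eq_I rangeI)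
  then show "finite (UNIV :: 'a ordered_copy set)"
    by (metis finite finite_imageI)
qed

definition finite_rank :: "'n::finite \<Rightarrow> nat"
  where "finite_rank = (SOME f. inj f)"

lemma inj_finite_rank: "inj finite_rank"
proof -
  have "\<exists>f :: 'a \<Rightarrow> nat. inj f"
    using finite_imp_inj_to_nat_seg[of "UNIV :: 'a set"] by auto
  then show ?thesis unfolding finite_rank_def by (rule someI_ex)
qed

instantiation ordered_copy :: (finite) wellorder
begin

definition "x \<le> y \<longleftrightarrow> finite_rank (Rep_ordered_copy x) \<le> finite_rank (Rep_ordered_copy y)"
definition "x < y \<longleftrightarrow> finite_rank (Rep_ordered_copy x) < finite_rank (Rep_ordered_copy y)"

instance
proof
  fix P :: "'a ordered_copy \<Rightarrow> bool" and a :: "'a ordered_copy"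
  assume step: "\<And>x. (\<And>y. y < x \<Longrightarrow> P y) \<Longrightarrow> P x"
  show "P a"
    by (induction a rule: measure_induct_rule[where f="\<lambda>x. finite_rank (Rep_ordered_copy x)"])
      (auto intro: step simp: less_ordered_copy_def)
qed (auto simp: less_eq_ordered_copy_def less_ordered_copy_def Rep_ordered_copy_inject
      dest: injD[OF inj_finite_rank])

end

lemma bij_Rep_ordered_copy: "bij Rep_ordered_copy"
  by (rule bij_betw_byWitness[where f'=Abs_ordered_copy])
    (auto simp: Rep_ordered_copy_inverse Abs_ordered_copy_inverse)

lemma bij_Abs_ordered_copy: "bij Abs_ordered_copy"
  by (rule bij_betw_byWitness[where f'=Rep_ordered_copy])
    (auto simp: Rep_ordered_copy_inverse Abs_ordered_copy_inverse)

section \<open>Reindexing of Lebesgue measure and of determinants\<close>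

lemma prod_Basis_vec: "(\<Prod>b\<in>(Basis :: (real^'n) set). v \<bullet> b) = (\<Prod>i\<in>UNIV. v $ i)"
proof -
  have B: "(Basis :: (real^'n) set) = range (\<lambda>i. axis i 1)"
    by (auto simp: Basis_vec_def)
  have "inj (\<lambda>i. axis i (1::real) :: real^'n)"
    by (auto simp: inj_def axis_eq_axis)
  then show ?thesis
    unfolding B by (simp add: prod.reindex inner_axis)
qed

text \<open>Lebesgue measure is determined by its values on boxes, and reindexing takes boxes to
  boxes with the same side lengths.\<close>

lemma lborel_distr_reindex:
  fixes \<pi> :: "'m::finite \<Rightarrow> 'n::finite"
  assumes "bij \<pi>"
  shows "distr lborel borel (\<lambda>v :: real^'n. \<chi> i. v $ \<pi> i) = (lborel :: (real^'m) measure)"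
proof (rule lborel_eqI[symmetric])
  define r where "r = (\<lambda>v :: real^'n. \<chi> i. v $ \<pi> i)"
  define s where "s = (\<lambda>v :: real^'m. \<chi> k. v $ inv \<pi> k)"
  have r[measurable]: "r \<in> borel_measurable borel"
    unfolding r_def by (intro borel_measurable_continuous_onI continuous_intros)
  fix l u :: "real^'m" assume lu: "\<And>b. b \<in> Basis \<Longrightarrow> l \<bullet> b \<le> u \<bullet> b"
  have lu': "l $ i \<le> u $ i" for i
    using lu[of "axis i 1"] by (auto simp: inner_axis)
  have "r -` box l u = box (s l) (s u)"
    using assms by (auto simp: r_def s_def mem_box_cart bij_is_inj bij_is_surj surj_f_inv_f)
      (metis assms bij_inv_eq_iff)+
  then have "emeasure (distr lborel borel r) (box l u) = emeasure lborel (box (s l) (s u))"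
    by (subst emeasure_distr) auto
  also have "\<dots> = (\<Prod>b\<in>Basis. (s u - s l) \<bullet> b)"
  proof (rule emeasure_lborel_box)
    fix b :: "real^'n" assume "b \<in> Basis"
    then show "s l \<bullet> b \<le> s u \<bullet> b"
      by (auto simp: Basis_vec_def inner_axis s_def lu')
  qed
  also have "(\<Prod>b\<in>Basis. (s u - s l) \<bullet> b) = (\<Prod>k\<in>UNIV. (u - l) $ inv \<pi> k)"
    unfolding prod_Basis_vec by (simp add: s_def)
  also have "\<dots> = (\<Prod>i\<in>UNIV. (u - l) $ i)"
    by (rule prod.reindex_bij_betw[OF bij_imp_bij_inv[OF assms]])
  also have "\<dots> = (\<Prod>b\<in>Basis. (u - l) \<bullet> b)"
    by (rule prod_Basis_vec[symmetric])
  finally show "emeasure (distr lborel borel (\<lambda>v :: real^'n. \<chi> i. v $ \<pi> i)) (box l u) = (\<Prod>b\<in>Basis. (u - l) \<bullet> b)"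
    unfolding r_def .
qed simp

text \<open>Conjugation with \<pi> is a bijection between the permutations of the two index types
  which preserves signs.\<close>

lemma det_reindex:
  fixes M :: "real^'n^'n" and \<pi> :: "'m::finite \<Rightarrow> 'n::finite"
  assumes "bij \<pi>"
  shows "det (\<chi> i j. M $ \<pi> i $ \<pi> j) = det M"
proof -
  have inv: "inv \<pi> (\<pi> x) = x" "\<pi> (inv \<pi> y) = y" for x y
    using assms by (simp_all add: bij_is_inj bij_is_surj surj_f_inv_f)
  have "(\<Sum>p | p permutes (UNIV :: 'm set). of_int (sign p) * (\<Prod>i\<in>UNIV. M $ \<pi> i $ \<pi> (p i)))
      = (\<Sum>q | q permutes (UNIV :: 'n set). of_int (sign q) * (\<Prod>k\<in>UNIV. M $ k $ q k))"
  proof (rule sum.reindex_bij_witness[where i="\<lambda>q. inv \<pi> \<circ> q \<circ> \<pi>" and j="\<lambda>p. \<pi> \<circ> p \<circ> inv \<pi>"])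
    fix p :: "'m \<Rightarrow> 'm" assume "p \<in> {p. p permutes UNIV}"
    then have p: "p permutes UNIV" by simp
    let ?q = "\<pi> \<circ> p \<circ> inv \<pi>"
    have bp: "bij p" using p by (simp add: permutes_bij)
    show "inv \<pi> \<circ> ?q \<circ> \<pi> = p"
      by (simp add: fun_eq_iff inv)
    have "bij ?q"
      by (intro bij_comp assms bp bij_imp_bij_inv)
    then show "?q \<in> {p. p permutes UNIV}"
      by (auto intro: bij_imp_permutes)
    \<comment> \<open>This locale about conjugated permutations supplies the equality of
      signs.\<close>
    interpret permutes_bij_finite p UNIV UNIV \<pi> "inv \<pi>" "\<lambda>x. if x \<in> UNIV then \<pi> (p (inv \<pi> x)) else x"
      by unfold_locales (auto simp: p assms inv)
    have sg: "sign ?q = sign p"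
      using sign_p' by (simp add: o_def)
    have "(\<Prod>k\<in>UNIV. M $ k $ ?q k) = (\<Prod>i\<in>UNIV. M $ \<pi> i $ ?q (\<pi> i))"
      by (rule prod.reindex_bij_betw[OF assms, symmetric])
    then show "of_int (sign ?q) * (\<Prod>k\<in>UNIV. M $ k $ ?q k)
        = of_int (sign p) * (\<Prod>i\<in>UNIV. M $ \<pi> i $ \<pi> (p i))"
      by (simp add: sg inv)
  next
    fix q :: "'n \<Rightarrow> 'n" assume "q \<in> {q. q permutes UNIV}"
    then have "bij q" by (simp add: permutes_bij)
    then have "bij (inv \<pi> \<circ> q \<circ> \<pi>)"
      by (intro bij_comp assms bij_imp_bij_inv)
    then show "inv \<pi> \<circ> q \<circ> \<pi> \<in> {p. p permutes UNIV}"
      by (auto intro: bij_imp_permutes)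
    show "\<pi> \<circ> (inv \<pi> \<circ> q \<circ> \<pi>) \<circ> inv \<pi> = q"
      by (simp add: fun_eq_iff inv)
  qed
  then show ?thesis by (simp add: det_def)
qed

section \<open>Change of variables for nonnegative integrals\<close>

lemma nn_integral_eq_iff_has_integral:
  fixes F :: "'b::euclidean_space \<Rightarrow> real"
  assumes "F \<in> borel_measurable borel" "\<And>x. F x \<ge> 0" "r \<ge> 0"
  shows "(\<integral>\<^sup>+x. ennreal (F x) \<partial>lborel) = ennreal r \<longleftrightarrow> (F has_integral r) UNIV"
  using assms by (subst has_integral_iff_nn_integral_lebesgue)
    (auto simp: nn_integral_completion measurable_completion)

text \<open>The theorem for absolutely integrable functions is an equivalence for each prescribed
  value of the integral. Used for all finite values at once, it also settles infinite
  integrals.\<close>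

lemma nn_change_of_variables_wellorder:
  fixes \<tau> :: "real^'m::{finite,wellorder} \<Rightarrow> real^'m::{finite,wellorder}" and \<phi> :: "real^'m::{finite,wellorder} \<Rightarrow> real"
  assumes S: "S \<in> sets borel" and inj: "inj_on \<tau> S"
    and der: "\<And>z. z \<in> S \<Longrightarrow> (\<tau> has_derivative (\<lambda>v. J z *v v)) (at z)"
    and pos: "\<And>z. z \<in> S \<Longrightarrow> \<phi> (\<tau> z) \<ge> 0"
    and m1: "(\<lambda>y. indicator (\<tau> ` S) y * \<phi> y) \<in> borel_measurable borel"
    and m2: "(\<lambda>z. indicator S z * (\<bar>det (J z)\<bar> * \<phi> (\<tau> z))) \<in> borel_measurable borel"
  shows "(\<integral>\<^sup>+y. ennreal (indicator (\<tau> ` S) y * \<phi> y) \<partial>lborel)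
       = (\<integral>\<^sup>+z. ennreal (indicator S z * (\<bar>det (J z)\<bar> * \<phi> (\<tau> z))) \<partial>lborel)"
proof -
  let ?\<psi> = "\<lambda>z. \<bar>det (J z)\<bar> * \<phi> (\<tau> z)"
  let ?I = "\<integral>\<^sup>+y. ennreal (indicator (\<tau> ` S) y * \<phi> y) \<partial>lborel"
  let ?J = "\<integral>\<^sup>+z. ennreal (indicator S z * ?\<psi> z) \<partial>lborel"
  have ind: "((\<lambda>z. indicator T z * f z) has_integral r) UNIV \<longleftrightarrow> (f has_integral r) T"
    for T :: "(real^'m::{finite,wellorder}) set" and f :: "_ \<Rightarrow> real" and r
  proof -
    have "(\<lambda>z. indicator T z * f z) = (\<lambda>z. if z \<in> T then f z else 0)"
      by (auto simp: indicator_def)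
    then show ?thesis by (simp only: has_integral_restrict_UNIV)
  qed
  have abs_int: "f absolutely_integrable_on T \<and> integral T f = r \<longleftrightarrow> (f has_integral r) T"
    if "\<And>z. z \<in> T \<Longrightarrow> f z \<ge> 0" for T :: "(real^'m::{finite,wellorder}) set" and f :: "_ \<Rightarrow> real" and r
    using absolutely_integrable_on_iff_nonneg[of T f] that by (auto simp: has_integral_iff)
  have cov: "(?\<psi> has_integral r) S \<longleftrightarrow> (\<phi> has_integral r) (\<tau> ` S)" for r
  proof -
    \<comment> \<open>The theorem applied here is for vector-valued functions, so the real integrand
      is embedded in \<open>real^1\<close> by \<open>vec\<close>.\<close>
    have "(\<lambda>z. \<bar>det (matrix (\<lambda>v. J z *v v))\<bar> *\<^sub>R vec (\<phi> (\<tau> z)) :: real^1) absolutely_integrable_on S \<and>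
        integral S (\<lambda>z. \<bar>det (matrix (\<lambda>v. J z *v v))\<bar> *\<^sub>R vec (\<phi> (\<tau> z))) = (vec r :: real^1)
      \<longleftrightarrow> (\<lambda>y. vec (\<phi> y) :: real^1) absolutely_integrable_on (\<tau> ` S) \<and> integral (\<tau> ` S) (\<lambda>y. vec (\<phi> y)) = (vec r :: real^1)"
      by (rule has_absolute_integral_change_of_variables[OF _ has_derivative_at_withinI[OF der] inj])
        (use S in auto)
    then have "?\<psi> absolutely_integrable_on S \<and> integral S ?\<psi> = r
      \<longleftrightarrow> \<phi> absolutely_integrable_on (\<tau> ` S) \<and> integral (\<tau> ` S) \<phi> = r"
      by (simp add: absolutely_integrable_on_1_iff integral_on_1_eq)
    moreover have "?\<psi> absolutely_integrable_on S \<and> integral S ?\<psi> = r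
      \<longleftrightarrow> (?\<psi> has_integral r) S"
      using pos by (intro abs_int) simp
    moreover have "\<phi> absolutely_integrable_on (\<tau> ` S) \<and> integral (\<tau> ` S) \<phi> = r \<longleftrightarrow> (\<phi> has_integral r) (\<tau> ` S)"
      using pos by (intro abs_int) auto
    ultimately show ?thesis by argo
  qed
  have eq: "?I = ennreal r \<longleftrightarrow> ?J = ennreal r" if "r \<ge> 0" for r
  proof -
    have "indicator (\<tau> ` S) y * \<phi> y \<ge> 0" for y
      using pos by (auto simp: indicator_def)
    from nn_integral_eq_iff_has_integral[OF m1 this that]
    have "?I = ennreal r \<longleftrightarrow> (\<phi> has_integral r) (\<tau> ` S)" by (simp only: ind)
    moreover have "?J = ennreal r \<longleftrightarrow> (?\<psi> has_integral r) S"
    proof -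
      have "indicator S z * ?\<psi> z \<ge> 0" for z
        using pos by (auto simp: indicator_def)
      from nn_integral_eq_iff_has_integral[OF m2 this that] show ?thesis by (simp only: ind)
    qed
    ultimately show ?thesis using cov by simp
  qed
  show "?I = ?J"
  proof (cases ?I)
    case (real r)
    then show ?thesis using eq[of r] by simp
  next
    \<comment> \<open>By \<open>eq\<close>, a finite value of \<open>?J\<close> would also be the
      value of \<open>?I\<close>.\<close>
    case top
    then show ?thesis using eq by (cases ?J) auto
  qed
qed

text \<open>Conjugates \<tau> with the measure-preserving reindexings \<open>R\<close> and
  \<open>Q\<close>. Rows and columns of the Jacobian matrix are relabelled alike, which preserves
  its determinant.\<close>

lemma nn_change_of_variables:
  fixes \<tau> :: "real^'n::finite \<Rightarrow> real^'n" and \<phi> :: "real^'n \<Rightarrow> real"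
  assumes S: "S \<in> sets borel" and inj: "inj_on \<tau> S"
    and der: "\<And>z. z \<in> S \<Longrightarrow> (\<tau> has_derivative (\<lambda>v. J z *v v)) (at z)"
    and pos: "\<And>z. z \<in> S \<Longrightarrow> \<phi> (\<tau> z) \<ge> 0"
    and m1: "(\<lambda>y. indicator (\<tau> ` S) y * \<phi> y) \<in> borel_measurable borel"
    and m2: "(\<lambda>z. indicator S z * (\<bar>det (J z)\<bar> * \<phi> (\<tau> z))) \<in> borel_measurable borel"
  shows "(\<integral>\<^sup>+y. ennreal (indicator (\<tau> ` S) y * \<phi> y) \<partial>lborel)
       = (\<integral>\<^sup>+z. ennreal (indicator S z * (\<bar>det (J z)\<bar> * \<phi> (\<tau> z))) \<partial>lborel)"
proof -
  define R where "R = (\<lambda>v :: real^'n. \<chi> i :: 'n ordered_copy. v $ Rep_ordered_copy i)"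
  define Q where "Q = (\<lambda>w :: real^('n ordered_copy). \<chi> k :: 'n. w $ Abs_ordered_copy k)"
  have RQ [simp]: "R (Q w) = w" "Q (R v) = v" for v w
    by (simp_all add: R_def Q_def Rep_ordered_copy_inverse Abs_ordered_copy_inverse)
  have Qm [measurable]: "Q \<in> borel_measurable borel"
    unfolding Q_def by (intro borel_measurable_continuous_onI continuous_intros)
  have lb: "distr lborel borel Q = lborel"
    unfolding Q_def by (rule lborel_distr_reindex[OF bij_Abs_ordered_copy])
  have int: "(\<integral>\<^sup>+v. F v \<partial>lborel) = (\<integral>\<^sup>+w. F (Q w) \<partial>lborel)" if "F \<in> borel_measurable borel" for F
    using that by (subst lb[symmetric], subst nn_integral_distr) auto
  have linR: "bounded_linear R" and linQ: "bounded_linear Q"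
    unfolding R_def Q_def linear_conv_bounded_linear[symmetric]
    by (auto intro!: linearI simp: vec_eq_iff)
  define J' where "J' w = (\<chi> i j. J (Q w) $ Rep_ordered_copy i $ Rep_ordered_copy j)" for w
  define \<tau>' where "\<tau>' = (\<lambda>w. R (\<tau> (Q w)))"
  define S' where "S' = Q -` S"
  have J'_mult: "J' w *v v = R (J (Q w) *v Q v)" for w v
  proof -
    have "(\<Sum>j\<in>UNIV. J (Q w) $ Rep_ordered_copy i $ Rep_ordered_copy j * v $ j)
        = (\<Sum>k\<in>UNIV. J (Q w) $ Rep_ordered_copy i $ k * Q v $ k)" for i
      using sum.reindex_bij_betw[OF bij_Rep_ordered_copy, of "\<lambda>k. J (Q w) $ Rep_ordered_copy i $ k * Q v $ k"]
      by (simp add: Q_def Rep_ordered_copy_inverse)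
    then show ?thesis by (simp add: vec_eq_iff J'_def R_def matrix_vector_mult_def)
  qed
  have det': "det (J' w) = det (J (Q w))" for w
    unfolding J'_def by (rule det_reindex[OF bij_Rep_ordered_copy])
  have im: "Q w \<in> \<tau> ` S \<longleftrightarrow> w \<in> \<tau>' ` S'" for w
  proof
    assume "Q w \<in> \<tau> ` S"
    then obtain z where "z \<in> S" "Q w = \<tau> z" by blast
    then have "R z \<in> S'" "w = \<tau>' (R z)" by (auto simp: S'_def \<tau>'_def) (metis RQ(1))
    then show "w \<in> \<tau>' ` S'" by blast
  qed (auto simp: S'_def \<tau>'_def)
  have "(\<integral>\<^sup>+y. ennreal (indicator (\<tau> ` S) y * \<phi> y) \<partial>lborel)
      = (\<integral>\<^sup>+w. ennreal (indicator (\<tau>' ` S') w * \<phi> (Q w)) \<partial>lborel)"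
    using m1 by (subst int) (auto simp: indicator_def im)
  also have "\<dots> = (\<integral>\<^sup>+w. ennreal (indicator S' w * (\<bar>det (J' w)\<bar> * \<phi> (Q (\<tau>' w)))) \<partial>lborel)"
  proof (rule nn_change_of_variables_wellorder)
    show "S' \<in> sets borel"
      using measurable_sets[OF Qm S] by (simp add: S'_def)
    show "inj_on \<tau>' S'"
      using inj unfolding inj_on_def S'_def \<tau>'_def by (metis RQ vimageE)
    show "(\<tau>' has_derivative (\<lambda>v. J' w *v v)) (at w)" if "w \<in> S'" for w
      unfolding \<tau>'_def J'_mult
      by (rule bounded_linear.has_derivative[OF linR])
        (rule has_derivative_compose[OF bounded_linear_imp_has_derivative[OF linQ]], rule der, use that in \<open>simp add: S'_def\<close>)
    show "\<phi> (Q (\<tau>' w)) \<ge> 0" if "w \<in> S'" for w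
      using that pos by (simp add: S'_def \<tau>'_def)
    show "(\<lambda>w. indicator (\<tau>' ` S') w * \<phi> (Q w)) \<in> borel_measurable borel"
      using measurable_compose[OF Qm m1] by (simp add: indicator_def im)
    show "(\<lambda>w. indicator S' w * (\<bar>det (J' w)\<bar> * \<phi> (Q (\<tau>' w)))) \<in> borel_measurable borel"
      using measurable_compose[OF Qm m2] by (simp add: indicator_def S'_def det' \<tau>'_def)
  qed
  also have "\<dots> = (\<integral>\<^sup>+z. ennreal (indicator S z * (\<bar>det (J z)\<bar> * \<phi> (\<tau> z))) \<partial>lborel)"
    using m2 by (subst int) (auto simp: indicator_def S'_def det' \<tau>'_def)
  finally show ?thesis .
qed

section \<open>The Riemannian volume measure\<close>

context riemannian
begin

definition chart_density :: "('a, 'n) chart \<Rightarrow> real^'n \<Rightarrow> real"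
  where "chart_density c z = sqrt (det (in_coords c (g c) z))"

definition chart_volume :: "('a, 'n) chart \<Rightarrow> 'a set \<Rightarrow> ennreal"
  where "chart_volume c B = (\<integral>\<^sup>+z\<in>chart_map c ` B. ennreal (chart_density c z) \<partial>lborel)"

text \<open>\<open>chart_volume\<close> is only a set function. Its countable additivity is obtained
  by realising it, on Borel subsets of the chart domain, as the push-forward of a weighted Lebesgue
  measure under the inverse chart.\<close>

definition chart_measure :: "('a, 'n) chart \<Rightarrow> 'a measure"
  where "chart_measure c = distr
    (density (restrict_space lborel (chart_image c)) (\<lambda>z. ennreal (chart_density c z)))
    borel (chart_inv c)"

lemma continuous_on_chart_density:
  assumes "c \<in> A"
  shows "continuous_on (chart_image c) (chart_density c)"
  unfolding chart_density_def[abs_def]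
  by (intro continuous_intros continuous_on_det Ck_on_continuous[OF metric_Ck[OF assms]])

text \<open>Within the open set \<open>chart_image c\<close>, the image is a preimage under the
  continuous inverse chart.\<close>

lemma sets_chart_image:
  assumes c: "c \<in> A" and B: "B \<in> sets borel" "B \<subseteq> chart_dom c"
  shows "chart_map c ` B \<in> sets borel"
proof -
  let ?i = "chart_inv c" and ?\<Omega> = "chart_image c"
  have "?i \<in> borel_measurable (restrict_space borel ?\<Omega>)"
    by (rule borel_measurable_continuous_on_restrict[OF continuous_inv_chart[OF c]])
  from measurable_sets[OF this B(1)] have "?i -` B \<inter> ?\<Omega> \<in> sets (restrict_space borel ?\<Omega>)"
    by (simp add: space_restrict_space)
  also have "?i -` B \<inter> ?\<Omega> = chart_map c ` B"
    using B(2) c by (auto simp: subset_iff)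
  finally show ?thesis
    using open_image[OF c] by (auto simp: sets_restrict_space_iff)
qed

lemma emeasure_chart_measure:
  assumes c: "c \<in> A" and B: "B \<in> sets borel" "B \<subseteq> chart_dom c"
  shows "emeasure (chart_measure c) B = chart_volume c B"
proof -
  let ?i = "chart_inv c" and ?\<Omega> = "chart_image c"
  let ?R = "restrict_space lborel ?\<Omega>"
  have sR: "sets ?R = sets (restrict_space borel ?\<Omega>)"
    by (simp add: sets_restrict_space)
  have \<Omega>: "?\<Omega> \<in> sets borel" using open_image[OF c] by simp
  have mi: "?i \<in> borel_measurable ?R"
    using borel_measurable_continuous_on_restrict[OF continuous_inv_chart[OF c]] measurable_cong_sets[OF sR refl] by blast
  have md: "chart_density c \<in> borel_measurable ?R"
    using borel_measurable_continuous_on_restrict[OF continuous_on_chart_density[OF c]] measurable_cong_sets[OF sR refl] by blast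
  have pre: "?i -` B \<inter> ?\<Omega> = chart_map c ` B"
    using B(2) c by (auto simp: subset_iff)
  have "emeasure (chart_measure c) B = emeasure (density ?R (\<lambda>z. ennreal (chart_density c z))) (chart_map c ` B)"
    unfolding chart_measure_def
    by (subst emeasure_distr) (use mi B(1) pre in \<open>auto simp: space_restrict_space\<close>)
  also have "\<dots> = (\<integral>\<^sup>+z. ennreal (chart_density c z) * indicator (chart_map c ` B) z \<partial>?R)"
  proof (rule emeasure_density)
    show "(\<lambda>z. ennreal (chart_density c z)) \<in> borel_measurable ?R" using md by measurable
    show "chart_map c ` B \<in> sets ?R"
      using sets_chart_image[OF c B] B(2) \<Omega> by (auto simp: sets_restrict_space_iff)
  qed
  also have "\<dots> = (\<integral>\<^sup>+z. ennreal (chart_density c z) * indicator (chart_map c ` B) z * indicator ?\<Omega> z \<partial>lborel)"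
    by (subst nn_integral_restrict_space) (use \<Omega> in auto)
  also have "\<dots> = chart_volume c B"
    unfolding chart_volume_def
    by (intro nn_integral_cong) (use B(2) in \<open>auto simp: indicator_def\<close>)
  finally show ?thesis .
qed

text \<open>With g^{-1} = B^T B, the product of det g and a square is 1.\<close>

lemma det_metric_nonneg:
  assumes "c \<in> A" "x \<in> chart_dom c"
  shows "det (g c x) \<ge> 0"
proof -
  obtain B :: "real^'n^'n" where "matrix_inv (g c x) = transpose B ** B"
    using metric_factor[OF assms] by blast
  then have "det (g c x) * (det B)\<^sup>2 = det (g c x ** matrix_inv (g c x))"
    by (simp add: det_mul power2_eq_square)
  also have "\<dots> = 1" by (simp add: matrix_inv_mult metric_invertible assms)
  finally show ?thesis
    by (metis mult_nonpos_nonneg not_one_le_zero zero_le_power2 linorder_le_cases)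
qed

text \<open>Taking determinants in the transformation law of the metric shows that the densities
  differ by exactly the factor |det J| of the change of variables.\<close>

lemma chart_volume_unique:
  assumes c: "c \<in> A" and d: "d \<in> A" and B: "B \<in> sets borel" "B \<subseteq> chart_dom c" "B \<subseteq> chart_dom d"
  shows "chart_volume d B = chart_volume c B"
proof -
  define \<tau> where "\<tau> = in_coords d (chart_map c)"
  define W where "W = chart_map d ` (chart_dom d \<inter> chart_dom c)"
  define J where "J = coord_jacobian c d"
  let ?S = "chart_map d ` B"
  have W: "open W" unfolding W_def by (rule open_chart_image[OF d open_dom[OF c]])
  have SW: "?S \<subseteq> W" using B by (auto simp: W_def)
  have \<tau>: "Ck_on k \<tau> W" for k unfolding \<tau>_def W_def by (rule transition_Ck[OF c d])
  have \<tau>_d: "\<tau> (chart_map d x) = chart_map c x" if "x \<in> B" for x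
    using that B by (auto simp: \<tau>_def d)
  have im: "\<tau> ` ?S = chart_map c ` B"
    using \<tau>_d by (force simp: image_image)
  have J_d: "J (chart_map d x) = jacobian c d x" for x
    by (simp add: jacobian_chart J_def coord_jacobian_def)
  have dens: "\<bar>det (J z)\<bar> * chart_density c (\<tau> z) = chart_density d z" if z: "z \<in> ?S" for z
  proof -
    obtain x where x: "x \<in> B" "z = chart_map d x" using z by blast
    then have xc: "x \<in> chart_dom c" "x \<in> chart_dom d" using B by auto
    have "det (g d x) = (det (jacobian c d x))\<^sup>2 * det (g c x)"
      by (simp add: metric_transform[OF c d xc] det_mul power2_eq_square)
    then have "sqrt (det (g d x)) = \<bar>det (jacobian c d x)\<bar> * sqrt (det (g c x))"
      by (simp add: real_sqrt_mult)
    then show ?thesis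
      by (simp add: x \<tau>_d J_d chart_density_def c d xc)
  qed
  have bS: "?S \<in> sets borel" "chart_map c ` B \<in> sets borel"
    using sets_chart_image[OF d B(1,3)] sets_chart_image[OF c B(1,2)] by auto
  have m: "(\<lambda>z. indicator (chart_map e ` B) z * chart_density e z) \<in> borel_measurable borel"
    if "e \<in> A" "B \<subseteq> chart_dom e" for e
    using borel_measurable_continuous_on_indicator[OF sets_chart_image[OF that(1) B(1) that(2)]
        continuous_on_subset[OF continuous_on_chart_density[OF that(1)] image_mono[OF that(2)]]]
    by simp
  have nn: "chart_volume e B = (\<integral>\<^sup>+z. ennreal (indicator (chart_map e ` B) z * chart_density e z) \<partial>lborel)" for e
    unfolding chart_volume_def by (intro nn_integral_cong) (auto simp: indicator_def)
  have "(\<integral>\<^sup>+y. ennreal (indicator (\<tau> ` ?S) y * chart_density c y) \<partial>lborel)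
      = (\<integral>\<^sup>+z. ennreal (indicator ?S z * (\<bar>det (J z)\<bar> * chart_density c (\<tau> z))) \<partial>lborel)"
  proof (rule nn_change_of_variables[OF bS(1)])
    show "inj_on \<tau> ?S"
      using \<tau>_d inj_on_subset[OF inj_chart[OF c] B(2)] unfolding inj_on_def by fastforce
    show "(\<tau> has_derivative (\<lambda>v. J z *v v)) (at z)" if "z \<in> ?S" for z
    proof -
      have z: "z \<in> W" using that SW by blast
      have "(\<lambda>z. \<tau> z $ i) differentiable (at z)" for i
        using Ck_on_nth[OF W \<tau>[of "Suc 0"], of i] z by (auto simp: differentiable_on_open_iff W)
      from vec_has_derivative_entries[OF this] show ?thesis
        by (simp add: matrix_vector_mult_def J_def coord_jacobian_def \<tau>_def mult.commute)
    qed
    show "chart_density c (\<tau> z) \<ge> 0" if z: "z \<in> ?S" for z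
    proof -
      obtain x where x: "x \<in> B" "z = chart_map d x" using z by blast
      then show ?thesis
        using B(2) det_metric_nonneg[OF c, of x] by (auto simp: \<tau>_d chart_density_def c)
    qed
    show "(\<lambda>y. indicator (\<tau> ` ?S) y * chart_density c y) \<in> borel_measurable borel"
      unfolding im by (rule m[OF c B(2)])
    have "(\<lambda>z. indicator ?S z * (\<bar>det (J z)\<bar> * chart_density c (\<tau> z))) = (\<lambda>z. indicator ?S z * chart_density d z)"
      using dens by (auto simp: indicator_def fun_eq_iff)
    then show "(\<lambda>z. indicator ?S z * (\<bar>det (J z)\<bar> * chart_density c (\<tau> z))) \<in> borel_measurable borel"
      using m[OF d B(3)] by simp
  qed
  also have "\<dots> = (\<integral>\<^sup>+z. ennreal (indicator ?S z * chart_density d z) \<partial>lborel)"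
    by (intro nn_integral_cong) (use dens in \<open>auto simp: indicator_def\<close>)
  finally show ?thesis unfolding nn im ..
qed

section \<open>Existence and uniqueness of the volume measure\<close>

definition is_volume :: "'a measure \<Rightarrow> bool"
  where "is_volume \<mu> \<longleftrightarrow> sets \<mu> = sets borel \<and>
    (\<forall>c\<in>A. \<forall>B\<in>sets borel. B \<subseteq> chart_dom c \<longrightarrow> emeasure \<mu> B = chart_volume c B)"

text \<open>Second countability enters here, through the Lindelof property.\<close>

lemma countable_chart_cover:
  obtains cs :: "nat \<Rightarrow> ('a, 'n) chart" where "range cs \<subseteq> A" "(\<Union>n. chart_dom (cs n)) = UNIV"
proof -
  obtain F where F: "F \<subseteq> chart_dom ` A" "countable F" "\<Union>F = \<Union>(chart_dom ` A)"
    using Lindelof[of "chart_dom ` A"] open_dom by blast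
  then have U: "\<Union>F = UNIV" using atlas by (simp add: smooth_atlas_def)
  then have "F \<noteq> {}" by auto
  then have ran: "range (from_nat_into F) = F" using F(2) by (rule range_from_nat_into)
  have "\<exists>c\<in>A. chart_dom c = from_nat_into F n" for n
  proof -
    have "from_nat_into F n \<in> chart_dom ` A"
      using F(1) ran by (metis rangeI subsetD)
    then show ?thesis by auto
  qed
  then obtain cs where cs: "\<And>n. cs n \<in> A" "\<And>n. chart_dom (cs n) = from_nat_into F n"
    by metis
  show thesis
  proof
    show "range cs \<subseteq> A" using cs by blast
    show "(\<Union>n. chart_dom (cs n)) = UNIV" using cs(2) ran U by simp
  qed
qed

text \<open>The manifold is cut into countably many disjoint Borel pieces, each inside a chart. A
  volume measure is determined by its values on subsets of the pieces; conversely the chart measures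
  of the pieces add up to one, as charts agree on overlaps.\<close>

lemma ex1_volume: "\<exists>!\<mu>. is_volume \<mu>"
proof -
  obtain cs :: "nat \<Rightarrow> ('a, 'n) chart" where cs: "range cs \<subseteq> A" "(\<Union>n. chart_dom (cs n)) = UNIV"
    using countable_chart_cover .
  have csA: "cs n \<in> A" for n using cs(1) by blast
  define E where "E = disjointed (\<lambda>n. chart_dom (cs n))"
  have E: "disjoint_family E" "(\<Union>n. E n) = UNIV" "\<And>n. E n \<subseteq> chart_dom (cs n)"
    unfolding E_def UN_disjointed_eq using cs(2) disjointed_subset[of "\<lambda>n. chart_dom (cs n)"]
    by (auto intro: disjoint_family_disjointed)
  have Eb: "E n \<in> sets borel" for n
  proof -
    have "range (\<lambda>n. chart_dom (cs n)) \<subseteq> sets borel"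
      using open_dom[OF csA] by auto
    from sets.range_disjointed_sets[OF this] show ?thesis unfolding E_def by blast
  qed
  have decomp: "(\<Sum>n. emeasure \<nu> (B \<inter> E n)) = emeasure \<nu> B" if "sets \<nu> = sets borel" "B \<in> sets borel" for \<nu> B
  proof -
    have "(\<Sum>n. emeasure \<nu> (B \<inter> E n)) = emeasure \<nu> (\<Union>n. B \<inter> E n)"
      using E(1) Eb that by (intro suminf_emeasure) (auto simp: disjoint_family_on_def)
    also have "(\<Union>n. B \<inter> E n) = B" using E(2) by auto
    finally show ?thesis .
  qed
  define m where "m B = (\<Sum>n. emeasure (chart_measure (cs n)) (B \<inter> E n))" for B
  define \<mu> where "\<mu> = measure_of UNIV (sets borel) m"
  have s\<mu>: "sets \<mu> = sets borel"
    unfolding \<mu>_def using sets.sigma_sets_eq[of borel] by (simp add: sets.space_closed)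
  have sc: "sets (chart_measure c) = sets borel" for c
    by (simp add: chart_measure_def)
  have "emeasure \<mu> B = m B" if "B \<in> sets borel" for B
    unfolding \<mu>_def
  proof (rule emeasure_measure_of_sigma[OF _ _ _ that])
    show "sigma_algebra UNIV (sets (borel :: 'a measure))"
      using sets.sigma_algebra_axioms[of borel] by simp
    show "positive (sets borel) m" by (simp add: positive_def m_def)
    show "countably_additive (sets borel) m"
    proof (rule countably_additiveI)
      fix X :: "nat \<Rightarrow> 'a set" assume X: "range X \<subseteq> sets borel" "disjoint_family X"
      \<comment> \<open>Reading the sum over \<open>i\<close> as an integral for the counting
        measure allows the two series to be interchanged.\<close>
      have "(\<Sum>i. m (X i)) = (\<integral>\<^sup>+i. (\<Sum>n. emeasure (chart_measure (cs n)) (X i \<inter> E n)) \<partial>count_space UNIV)"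
        by (simp add: m_def nn_integral_count_space_nat)
      also have "\<dots> = (\<Sum>n. \<integral>\<^sup>+i. emeasure (chart_measure (cs n)) (X i \<inter> E n) \<partial>count_space UNIV)"
        by (rule nn_integral_suminf) simp
      also have "\<dots> = (\<Sum>n. \<Sum>i. emeasure (chart_measure (cs n)) (X i \<inter> E n))"
        by (simp add: nn_integral_count_space_nat)
      also have "\<dots> = (\<Sum>n. emeasure (chart_measure (cs n)) (\<Union>i. X i \<inter> E n))"
        using X Eb by (intro suminf_cong suminf_emeasure) (auto simp: sc disjoint_family_on_def)
      also have "\<dots> = m (\<Union>i. X i)" by (simp add: m_def)
      finally show "(\<Sum>i. m (X i)) = m (\<Union>i. X i)" .
    qed
  qed
  moreover have "m B = chart_volume c B" if c: "c \<in> A" and B: "B \<in> sets borel" "B \<subseteq> chart_dom c" for c B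
  proof -
    have "emeasure (chart_measure (cs n)) (B \<inter> E n) = emeasure (chart_measure c) (B \<inter> E n)" for n
    proof -
      have BE: "B \<inter> E n \<in> sets borel" "B \<inter> E n \<subseteq> chart_dom c" "B \<inter> E n \<subseteq> chart_dom (cs n)"
        using B Eb[of n] E(3)[of n] by auto
      show ?thesis
        using chart_volume_unique[OF c csA BE] emeasure_chart_measure[OF c BE(1,2)]
          emeasure_chart_measure[OF csA BE(1,3)] by simp
    qed
    then show ?thesis
      unfolding m_def using decomp[OF sc B(1)] emeasure_chart_measure[OF c B] by simp
  qed
  ultimately have "is_volume \<mu>" by (simp add: is_volume_def s\<mu>)
  moreover have "\<nu> = \<mu>" if "is_volume \<nu>" for \<nu>
  proof (rule measure_eqI)
    show "sets \<nu> = sets \<mu>" using that s\<mu> by (simp add: is_volume_def)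
    fix B assume "B \<in> sets \<nu>"
    then have B: "B \<in> sets borel" using that by (simp add: is_volume_def)
    have BE: "B \<inter> E n \<in> sets borel" "B \<inter> E n \<subseteq> chart_dom (cs n)" for n
      using B Eb[of n] E(3)[of n] by auto
    have val: "emeasure \<kappa> (B \<inter> E n) = chart_volume (cs n) (B \<inter> E n)" if "is_volume \<kappa>" for \<kappa> n
      using that csA[of n] BE[of n] by (simp add: is_volume_def)
    have "emeasure \<nu> B = (\<Sum>n. emeasure \<nu> (B \<inter> E n))"
      using decomp[OF _ B] that by (simp add: is_volume_def)
    also have "\<dots> = (\<Sum>n. emeasure \<mu> (B \<inter> E n))"
      by (simp add: val[OF that] val[OF \<open>is_volume \<mu>\<close>])
    also have "\<dots> = emeasure \<mu> B" by (rule decomp[OF s\<mu> B])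
    finally show "emeasure \<nu> B = emeasure \<mu> B" .
  qed
  ultimately show ?thesis by blast
qed

abbreviation vol :: "'a measure" where "vol \<equiv> riemannian_volume A g"

lemma is_volume_vol: "is_volume vol"
proof -
  have "vol = (THE \<mu>. is_volume \<mu>)"
    by (simp add: riemannian_volume_def is_volume_def chart_volume_def chart_density_def)
  then show ?thesis using theI'[OF ex1_volume] by simp
qed

lemma sets_vol [measurable_cong]: "sets vol = sets borel"
  using is_volume_vol by (simp add: is_volume_def)

lemma emeasure_vol:
  "c \<in> A \<Longrightarrow> B \<in> sets borel \<Longrightarrow> B \<subseteq> chart_dom c \<Longrightarrow> emeasure vol B = chart_volume c B"
  using is_volume_vol by (simp add: is_volume_def)

section \<open>Compact sets have finite volume\<close>

lemma finite_volume_neighbourhood: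
  obtains U where "open U" "x \<in> U" "emeasure vol U < \<infinity>"
proof -
  define c where "c = chart_at A x"
  have c: "c \<in> A" "x \<in> chart_dom c" by (simp_all add: c_def chart_at_in in_chart_at)
  let ?i = "chart_inv c" and ?\<Omega> = "chart_image c"
  obtain r where r: "r > 0" "cball (chart_map c x) r \<subseteq> ?\<Omega>"
    using open_image[OF c(1)] c(2) open_contains_cball by blast
  define U where "U = chart_dom c \<inter> chart_map c -` ball (chart_map c x) r"
  have U: "open U"
    unfolding U_def by (rule continuous_open_preimage[OF continuous_chart[OF c(1)] open_dom[OF c(1)] open_ball])
  have im: "chart_map c ` U \<subseteq> cball (chart_map c x) r" by (auto simp: U_def)
  have "bounded (chart_density c ` cball (chart_map c x) r)"
    by (intro compact_imp_bounded compact_continuous_image compact_cball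
        continuous_on_subset[OF continuous_on_chart_density[OF c(1)] r(2)])
  then obtain C where "\<forall>y\<in>chart_density c ` cball (chart_map c x) r. norm y \<le> C"
    unfolding bounded_iff by blast
  then have C: "\<bar>chart_density c z\<bar> \<le> C" if "z \<in> cball (chart_map c x) r" for z
    using that by auto
  have "emeasure vol U = chart_volume c U"
    using U by (intro emeasure_vol c(1)) (auto simp: U_def)
  also have "\<dots> \<le> (\<integral>\<^sup>+z. ennreal C * indicator (cball (chart_map c x) r) z \<partial>lborel)"
    unfolding chart_volume_def
  proof (rule nn_integral_mono)
    fix z
    show "ennreal (chart_density c z) * indicator (chart_map c ` U) z \<le> ennreal C * indicator (cball (chart_map c x) r) z"
      using C[of z] im by (auto simp: indicator_def intro: ennreal_leI)
  qed
  also have "\<dots> = ennreal C * emeasure lborel (cball (chart_map c x) r)"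
    by (rule nn_integral_cmult_indicator) simp
  also have "\<dots> < \<infinity>"
    using emeasure_compact_finite[OF compact_cball, of "chart_map c x" r] by (auto simp: ennreal_mult_less_top)
  finally show thesis using that U c(2) r(1) by (simp add: U_def)
qed

lemma finite_volume_compact:
  assumes "compact K"
  shows "emeasure vol K < \<infinity>"
proof -
  have "\<exists>U. open U \<and> x \<in> U \<and> emeasure vol U < \<infinity>" for x
    using finite_volume_neighbourhood[of x] by blast
  then obtain U where U: "\<And>x. open (U x)" "\<And>x. x \<in> U x" "\<And>x. emeasure vol (U x) < \<infinity>"
    by metis
  obtain X where X: "finite X" "K \<subseteq> (\<Union>x\<in>X. U x)"
    using compactE_image[OF assms, of UNIV U] U by (metis UNIV_I UN_I subsetI)
  have "emeasure vol K \<le> emeasure vol (\<Union>x\<in>X. U x)"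
    using X U(1) by (intro emeasure_mono) (auto simp: sets_vol intro: borel_open)
  also have "\<dots> \<le> (\<Sum>x\<in>X. emeasure vol (U x))"
    using X U(1) by (intro emeasure_subadditive_finite) (auto simp: sets_vol intro: borel_open)
  also have "\<dots> < \<infinity>"
    using X(1) U(3) by (induction X rule: finite_induct) auto
  finally show ?thesis .
qed

end

section \<open>Approximation of \<open>C\<^sup>2\<close> functions of compact support\<close>

lemma partial_zero: "partial i (\<lambda>_. 0) z = 0"
  by (subst has_derivative_imp_partial) auto

section \<open>Integrals of p-th powers\<close>

lemma powr_add_le:
  assumes "a \<ge> 0" "b \<ge> 0" "p > (0::real)"
  shows "(a + b) powr p \<le> 2 powr p * (a powr p + b powr p)"
proof -
  have "(a + b) powr p \<le> (2 * max a b) powr p"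
    using assms by (intro powr_mono2) auto
  also have "\<dots> = 2 powr p * max a b powr p"
    by (rule powr_mult)
  also have "\<dots> \<le> 2 powr p * (a powr p + b powr p)"
    by (intro mult_left_mono) (auto simp: max_def)
  finally show ?thesis .
qed

text \<open>The p-th power of the L^p norm with values in \<open>ennreal\<close>, so that estimates
  may be written before finiteness is known.\<close>

definition power_integral :: "real \<Rightarrow> 'a measure \<Rightarrow> ('a \<Rightarrow> real) \<Rightarrow> ennreal"
  where "power_integral p M f = (\<integral>\<^sup>+x. ennreal (\<bar>f x\<bar> powr p) \<partial>M)"

lemma in_Lp_iff: "in_Lp p M f \<longleftrightarrow> f \<in> borel_measurable M \<and> power_integral p M f < \<infinity>"
  unfolding in_Lp_def power_integral_def by (auto simp: integrable_iff_bounded)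

text \<open>Measurability is asked of the bounds \<open>a\<close> and \<open>b\<close>; the lemma is
  later applied with a Laplacian as \<open>f\<close>.\<close>

lemma power_integral_add_le:
  assumes p: "p > 0" and le: "\<And>x. \<bar>f x\<bar> \<le> \<bar>a x\<bar> + \<bar>b x\<bar>"
    and m: "a \<in> borel_measurable M" "b \<in> borel_measurable M"
  shows "power_integral p M f \<le> ennreal (2 powr p) * (power_integral p M a + power_integral p M b)"
proof -
  have "power_integral p M f \<le> (\<integral>\<^sup>+x. ennreal (2 powr p) * (ennreal (\<bar>a x\<bar> powr p) + ennreal (\<bar>b x\<bar> powr p)) \<partial>M)"
    unfolding power_integral_def
  proof (rule nn_integral_mono)
    fix x
    have "\<bar>f x\<bar> powr p \<le> (\<bar>a x\<bar> + \<bar>b x\<bar>) powr p"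
      using p le by (intro powr_mono2) auto
    also have "\<dots> \<le> 2 powr p * (\<bar>a x\<bar> powr p + \<bar>b x\<bar> powr p)"
      by (rule powr_add_le) (use p in auto)
    finally show "ennreal (\<bar>f x\<bar> powr p) \<le> ennreal (2 powr p) * (ennreal (\<bar>a x\<bar> powr p) + ennreal (\<bar>b x\<bar> powr p))"
      by (simp add: ennreal_leI flip: ennreal_plus ennreal_mult)
  qed
  also have "\<dots> = ennreal (2 powr p) * (power_integral p M a + power_integral p M b)"
    unfolding power_integral_def using m by (simp add: nn_integral_cmult nn_integral_add)
  finally show ?thesis .
qed

lemma power_integral_cmult:
  assumes "a \<in> borel_measurable M"
  shows "power_integral p M (\<lambda>x. k * a x) = ennreal (\<bar>k\<bar> powr p) * power_integral p M a"
  unfolding power_integral_def using assms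
  by (simp add: abs_mult powr_mult ennreal_mult nn_integral_cmult)

lemma power_integral_bounded_support:
  assumes p: "p > 0" and le: "\<And>x. x \<in> K \<Longrightarrow> \<bar>f x\<bar> \<le> k" and out: "\<And>x. x \<notin> K \<Longrightarrow> f x = 0" and K: "K \<in> sets M"
  shows "power_integral p M f \<le> ennreal (k powr p) * emeasure M K"
proof -
  have "power_integral p M f \<le> (\<integral>\<^sup>+x. ennreal (k powr p) * indicator K x \<partial>M)"
    unfolding power_integral_def
  proof (rule nn_integral_mono)
    fix x show "ennreal (\<bar>f x\<bar> powr p) \<le> ennreal (k powr p) * indicator K x"
      using le[of x] out[of x] p by (cases "x \<in> K") (auto intro!: ennreal_leI powr_mono2)
  qed
  also have "\<dots> = ennreal (k powr p) * emeasure M K"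
    by (rule nn_integral_cmult_indicator[OF K])
  finally show ?thesis .
qed

context riemannian
begin

lemma hessian_norm_zero:
  assumes T: "open T" "x \<in> T" "\<And>y. y \<in> T \<Longrightarrow> w y = 0"
  shows "hessian_norm A g w x = 0"
proof -
  define c where "c = chart_at A x"
  have c: "c \<in> A" "x \<in> chart_dom c" by (simp_all add: c_def chart_at_in in_chart_at)
  define W where "W = chart_map c ` (chart_dom c \<inter> T)"
  have W: "open W" unfolding W_def by (rule open_chart_image[OF c(1) T(1)])
  have x: "chart_map c x \<in> W" using c T by (auto simp: W_def)
  have w0: "in_coords c w z = 0" if "z \<in> W" for z
    using that c T(3) by (auto simp: W_def)
  have p1: "partial i (in_coords c w) z = 0" if "z \<in> W" for i z
    using partial_cong_open[OF W that, of "in_coords c w" "\<lambda>_. 0"] w0 by (simp add: partial_zero)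
  have p2: "partial i (partial j (in_coords c w)) z = 0" if "z \<in> W" for i j z
    using partial_cong_open[OF W that, of "partial j (in_coords c w)" "\<lambda>_. 0"] p1 by (simp add: partial_zero)
  have "hessian g w c x = 0"
    by (simp add: vec_eq_iff hessian_component[OF c] p1[OF x] p2[OF x])
  then show ?thesis
    unfolding cotensor2_norm_eq c_def[symmetric] by (simp add: tensor2_norm_def)
qed

lemma borel_measurable_vol_continuous:
  "continuous_on UNIV f \<Longrightarrow> f \<in> borel_measurable vol" for f :: "'a \<Rightarrow> real"
  using borel_measurable_continuous_onI[of f] measurable_cong_sets[OF sets_vol refl] by blast

lemma smooth_compact_supportI:
  fixes v :: "'a \<Rightarrow> real"
  assumes "\<And>k. Ck_fun A k v" "compact K" "{x. v x \<noteq> 0} \<subseteq> K"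
  shows "smooth_compact_support A v"
proof -
  have "closure {x. v x \<noteq> 0} \<subseteq> K"
    using assms(2,3) by (intro closure_minimal compact_imp_closed)
  then have "compact (closure {x. v x \<noteq> 0})"
    using assms(2) closed_closure compact_Int_closed[of K "closure {x. v x \<noteq> 0}"] by (simp add: Int_absorb1)
  then show ?thesis using assms(1) by (simp add: smooth_compact_support_def)
qed

lemma smooth_compact_support_add:
  assumes "smooth_compact_support A v" "smooth_compact_support A w"
  shows "smooth_compact_support A (\<lambda>x. v x + w x)"
proof (rule smooth_compact_supportI)
  show "compact (closure {x. v x \<noteq> 0} \<union> closure {x. w x \<noteq> 0})"
    using assms by (auto simp: smooth_compact_support_def)
  show "{x. v x + w x \<noteq> 0} \<subseteq> closure {x. v x \<noteq> 0} \<union> closure {x. w x \<noteq> 0}"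
  proof -
    have "{x. v x + w x \<noteq> 0} \<subseteq> {x. v x \<noteq> 0} \<union> {x. w x \<noteq> 0}" by auto
    also have "\<dots> \<subseteq> closure {x. v x \<noteq> 0} \<union> closure {x. w x \<noteq> 0}"
      by (intro Un_mono closure_subset)
    finally show ?thesis .
  qed
qed (use assms in \<open>auto simp: smooth_compact_support_def intro: Ck_fun_add\<close>)

section \<open>Transfer between a chart and the manifold\<close>

definition extend_by_zero :: "('a, 'n) chart \<Rightarrow> (real^'n \<Rightarrow> real) \<Rightarrow> 'a \<Rightarrow> real"
  where "extend_by_zero c H x = (if x \<in> chart_dom c then H (chart_map c x) else 0)"

definition chart_preimage :: "('a, 'n) chart \<Rightarrow> (real^'n) set \<Rightarrow> 'a set"
  where "chart_preimage c K = chart_dom c \<inter> chart_map c -` K"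

lemma compact_chart_preimage:
  assumes c: "c \<in> A" and K: "compact K" "K \<subseteq> chart_image c"
  shows "compact (chart_preimage c K)"
proof -
  have "chart_preimage c K = chart_inv c ` K"
  proof (intro subset_antisym subsetI)
    fix x assume "x \<in> chart_preimage c K"
    then show "x \<in> chart_inv c ` K"
      using c by (intro image_eqI[where x="chart_map c x"]) (auto simp: chart_preimage_def)
  next
    fix x assume "x \<in> chart_inv c ` K"
    then obtain z where z: "z \<in> K" "x = chart_inv c z" by blast
    then obtain y where "y \<in> chart_dom c" "z = chart_map c y" using K(2) by blast
    then show "x \<in> chart_preimage c K" using z c by (simp add: chart_preimage_def)
  qed
  then show ?thesis
    using compact_continuous_image[OF continuous_on_subset[OF continuous_inv_chart[OF c] K(2)] K(1)] by simp
qed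

lemma extend_by_zero_support:
  "{z. H z \<noteq> 0} \<subseteq> K \<Longrightarrow> {x. extend_by_zero c H x \<noteq> 0} \<subseteq> chart_preimage c K"
  by (auto simp: extend_by_zero_def chart_preimage_def split: if_splits)

text \<open>Near a point of the domain of \<open>c\<close> the function is \<open>H\<close> composed
  with a transition map. Any other point lies in the complement of the preimage of \<open>K\<close>,
  where the function vanishes, and this complement is open because compact sets of a Hausdorff space
  are closed.\<close>

lemma Ck_fun_extend_by_zero:
  assumes c: "c \<in> A" and K: "compact K" "K \<subseteq> chart_image c"
    and H: "Ck_on k H UNIV" "{z. H z \<noteq> 0} \<subseteq> K"
  shows "Ck_fun A k (extend_by_zero c H)"
  unfolding Ck_fun_def
proof
  fix d assume d: "d \<in> A"
  have cl: "closed (chart_preimage c K)"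
    using compact_chart_preimage[OF c K] by (rule compact_imp_closed)
  show "Ck_on k (in_coords d (extend_by_zero c H)) (chart_image d)"
  proof (rule Ck_on_local[OF open_image[OF d]])
    fix z assume "z \<in> chart_image d"
    then obtain y where y: "y \<in> chart_dom d" "z = chart_map d y" by blast
    show "\<exists>T. open T \<and> z \<in> T \<and> Ck_on k (in_coords d (extend_by_zero c H)) T"
    proof (cases "y \<in> chart_dom c")
      case True
      let ?T = "chart_map d ` (chart_dom d \<inter> chart_dom c)"
      have T: "open ?T" by (rule open_chart_image[OF d open_dom[OF c]])
      have 1: "Ck_on k (\<lambda>z. H (in_coords d (chart_map c) z)) ?T"
        by (rule Ck_on_compose[OF T open_UNIV _ H(1) transition_Ck[OF c d]]) auto
      have eq: "in_coords d (extend_by_zero c H) z = H (in_coords d (chart_map c) z)" if "z \<in> ?T" for z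
        using that d by (auto simp: extend_by_zero_def)
      have "Ck_on k (in_coords d (extend_by_zero c H)) ?T"
        using 1 by (simp only: Ck_on_cong[OF T eq])
      then show ?thesis using T True y by blast
    next
      case False
      let ?T = "chart_map d ` (chart_dom d \<inter> - chart_preimage c K)"
      have T: "open ?T" by (rule open_chart_image[OF d open_Compl[OF cl]])
      have "in_coords d (extend_by_zero c H) z = 0" if "z \<in> ?T" for z
        using that d extend_by_zero_support[OF H(2), of c] by auto
      then have "Ck_on k (in_coords d (extend_by_zero c H)) ?T"
        using Ck_on_cong[OF T, of "in_coords d (extend_by_zero c H)" "\<lambda>_. 0"] by simp
      moreover have "z \<in> ?T" using y False by (auto simp: chart_preimage_def)
      ultimately show ?thesis using T by blast
    qed
  qed
qed

lemma local_bump: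
  obtains b U c K where "\<And>k. Ck_fun A k b" "open U" "x \<in> U" "\<And>y. y \<in> U \<Longrightarrow> b y = 1"
    "c \<in> A" "compact K" "K \<subseteq> chart_image c" "{y. b y \<noteq> 0} \<subseteq> chart_preimage c K"
proof -
  define c where "c = chart_at A x"
  have c: "c \<in> A" "x \<in> chart_dom c" by (simp_all add: c_def chart_at_in in_chart_at)
  obtain s where s: "s > 0" "cball (chart_map c x) s \<subseteq> chart_image c"
    using open_image[OF c(1)] c(2) open_contains_cball by blast
  \<comment> \<open>\<open>smooth_bump_exists\<close> gives a support of radius
    \<open>4 * r\<close>, here the ball of radius \<open>s\<close> inside the chart image.\<close>
  define r where "r = s / 4"
  have r: "r > 0" "4 * r = s" using s by (auto simp: r_def)
  obtain h :: "real^'n \<Rightarrow> real" where h: "\<And>k. Ck_on k h UNIV" "ball (chart_map c x) r \<subseteq> {y. h y = 1}"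
      "{y. h y \<noteq> 0} \<subseteq> cball (chart_map c x) (4 * r)"
    using smooth_bump_exists[OF r(1), of "chart_map c x"] by blast
  have supp: "{y. h y \<noteq> 0} \<subseteq> cball (chart_map c x) s" using h(3) by (simp only: r(2))
  show thesis
  proof
    show "Ck_fun A k (extend_by_zero c h)" for k
      by (rule Ck_fun_extend_by_zero[OF c(1) compact_cball s(2) h(1) supp])
    show "open (chart_preimage c (ball (chart_map c x) r))"
      unfolding chart_preimage_def
      by (rule continuous_open_preimage[OF continuous_chart[OF c(1)] open_dom[OF c(1)] open_ball])
    show "x \<in> chart_preimage c (ball (chart_map c x) r)"
      using c r by (simp add: chart_preimage_def)
    show "extend_by_zero c h y = 1" if "y \<in> chart_preimage c (ball (chart_map c x) r)" for y
      using that h(2) by (auto simp: chart_preimage_def extend_by_zero_def)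
    show "{y. extend_by_zero c h y \<noteq> 0} \<subseteq> chart_preimage c (cball (chart_map c x) s)"
      by (rule extend_by_zero_support[OF supp])
  qed (use c s in auto)
qed

text \<open>The Laplacian is left to \<open>laplacian_le\<close>, which bounds it pointwise by the
  Hessian of the difference.\<close>

definition approximable :: "real \<Rightarrow> ('a \<Rightarrow> real) \<Rightarrow> bool"
  where "approximable p w \<longleftrightarrow> (\<forall>e>0. \<exists>v. smooth_compact_support A v \<and>
    power_integral p vol (\<lambda>x. w x - v x) \<le> ennreal e \<and>
    power_integral p vol (hessian_norm A g (\<lambda>x. w x - v x)) \<le> ennreal e)"

lemma smooth_C2: "smooth_compact_support A v \<Longrightarrow> Ck_fun A 2 v"
  by (simp add: smooth_compact_support_def)

lemma approximable_add:
  assumes p: "p > 0" and w: "Ck_fun A 2 w1" "Ck_fun A 2 w2" and a: "approximable p w1" "approximable p w2"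
  shows "approximable p (\<lambda>x. w1 x + w2 x)"
  unfolding approximable_def
proof (intro allI impI)
  let ?I = "power_integral p vol" and ?H = "hessian_norm A g"
  fix e :: real assume e: "e > 0"
  \<comment> \<open>Two errors \<open>e'\<close>, multiplied by the factor \<open>2 powr p\<close>
    of \<open>power_integral_add_le\<close>, add up to \<open>e\<close>.\<close>
  define e' where "e' = e / (2 * 2 powr p)"
  have e': "e' > 0" "2 powr p * (e' + e') = e" using e by (auto simp: e'_def)
  have ee: "ennreal (2 powr p) * (ennreal e' + ennreal e') = ennreal e"
    using e' by (simp flip: ennreal_plus ennreal_mult)
  obtain v1 where v1: "smooth_compact_support A v1"
    "?I (\<lambda>x. w1 x - v1 x) \<le> ennreal e'"
    "?I (?H (\<lambda>x. w1 x - v1 x)) \<le> ennreal e'"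
    using a(1) e' unfolding approximable_def by blast
  obtain v2 where v2: "smooth_compact_support A v2"
    "?I (\<lambda>x. w2 x - v2 x) \<le> ennreal e'"
    "?I (?H (\<lambda>x. w2 x - v2 x)) \<le> ennreal e'"
    using a(2) e' unfolding approximable_def by blast
  have r: "Ck_fun A 2 (\<lambda>x. w1 x - v1 x)" "Ck_fun A 2 (\<lambda>x. w2 x - v2 x)"
    by (intro Ck_fun_diff w smooth_C2 v1 v2)+
  have eq: "(\<lambda>x. w1 x + w2 x - (v1 x + v2 x)) = (\<lambda>x. (w1 x - v1 x) + (w2 x - v2 x))"
    by auto
  show "\<exists>v. smooth_compact_support A v \<and>
    ?I (\<lambda>x. w1 x + w2 x - v x) \<le> ennreal e \<and>
    ?I (?H (\<lambda>x. w1 x + w2 x - v x)) \<le> ennreal e"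
  proof (intro exI[of _ "\<lambda>x. v1 x + v2 x"] conjI)
    show "smooth_compact_support A (\<lambda>x. v1 x + v2 x)"
      by (rule smooth_compact_support_add[OF v1(1) v2(1)])
    have "?I (\<lambda>x. (w1 x - v1 x) + (w2 x - v2 x))
        \<le> ennreal (2 powr p) * (?I (\<lambda>x. w1 x - v1 x) + ?I (\<lambda>x. w2 x - v2 x))"
      by (intro power_integral_add_le p abs_triangle_ineq borel_measurable_vol_continuous
          continuous_on_fun[OF r(1)] continuous_on_fun[OF r(2)])
    also have "\<dots> \<le> ennreal (2 powr p) * (ennreal e' + ennreal e')"
      by (intro mult_left_mono add_mono v1 v2) auto
    finally show "?I (\<lambda>x. w1 x + w2 x - (v1 x + v2 x)) \<le> ennreal e"
      unfolding eq ee .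
    have "?I (?H (\<lambda>x. (w1 x - v1 x) + (w2 x - v2 x)))
        \<le> ennreal (2 powr p) * (?I (?H (\<lambda>x. w1 x - v1 x))
            + ?I (?H (\<lambda>x. w2 x - v2 x)))"
      using hessian_norm_add_le[OF r]
      by (intro power_integral_add_le p borel_measurable_vol_continuous continuous_on_hessian_norm r)
        (simp add: hessian_norm_nonneg)
    also have "\<dots> \<le> ennreal (2 powr p) * (ennreal e' + ennreal e')"
      by (intro mult_left_mono add_mono v1 v2) auto
    finally show "?I (?H (\<lambda>x. w1 x + w2 x - (v1 x + v2 x))) \<le> ennreal e"
      unfolding eq ee .
  qed
qed

text \<open>The difference to the mollification is uniformly small, together with its Hessian, and
  both vanish off a fixed compact set of finite volume; hence their p-th power integrals are
  small.\<close>

lemma approximable_in_chart: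
  assumes p: "p > 0" and w: "Ck_fun A 2 w" and c: "c \<in> A"
    and K: "compact K" "K \<subseteq> chart_image c" and supp: "{x. w x \<noteq> 0} \<subseteq> chart_preimage c K"
  shows "approximable p w"
  unfolding approximable_def
proof (intro allI impI)
  let ?I = "power_integral p vol" and ?H = "hessian_norm A g"
  fix \<epsilon> :: real assume \<epsilon>: "\<epsilon> > 0"
  let ?\<Omega> = "chart_image c"
  \<comment> \<open>The coordinate expression extended by 0; it is C^2 on the whole space since its
    support lies in the compact subset \<open>K\<close> of the chart image.\<close>
  define F where "F z = (if z \<in> ?\<Omega> then in_coords c w z else 0)" for z
  have F_supp: "{z. F z \<noteq> 0} \<subseteq> K"
    using supp c by (auto simp: F_def chart_preimage_def split: if_splits)
  have F_chart: "F (chart_map c x) = w x" if "x \<in> chart_dom c" for x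
    using that c by (simp add: F_def)
  have F: "Ck_on 2 F UNIV"
  proof (rule Ck_on_local[OF open_UNIV])
    fix z
    show "\<exists>T. open T \<and> z \<in> T \<and> Ck_on 2 F T"
    proof (cases "z \<in> ?\<Omega>")
      case True
      have "Ck_on 2 F ?\<Omega> \<longleftrightarrow> Ck_on 2 (in_coords c w) ?\<Omega>"
        by (rule Ck_on_cong[OF open_image[OF c]]) (simp add: F_def)
      then show ?thesis
        using True open_image[OF c] w c unfolding Ck_fun_def by blast
    next
      case False
      have o: "open (- K)" using K(1) by (simp add: compact_imp_closed open_Compl)
      have "Ck_on 2 F (- K) \<longleftrightarrow> Ck_on 2 (\<lambda>_. 0 :: real) (- K)"
        by (rule Ck_on_cong[OF o]) (use F_supp in auto)
      then show ?thesis using False K(2) o by auto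
    qed
  qed
  obtain \<delta> where \<delta>: "\<delta> > 0" "(\<Union>x\<in>K. cball x \<delta>) \<subseteq> ?\<Omega>"
    using compact_subset_open_imp_cball_epsilon_subset[OF K(1) open_image[OF c] K(2)] by blast
  \<comment> \<open>The closed \<delta>-neighbourhood of \<open>K\<close>: it still fits into the
    chart image and contains the support of the mollification.\<close>
  define K' where "K' = (\<Union>x\<in>K. cball x \<delta>)"
  have K': "compact K'" "K' \<subseteq> ?\<Omega>" "K \<subseteq> K'"
    using compact_minkowski_sum_cball[OF K(1)] \<delta> by (auto simp: K'_def)
  define L where "L = chart_preimage c K'"
  have L: "compact L" "L \<subseteq> chart_dom c"
    using compact_chart_preimage[OF c K'(1,2)] by (auto simp: L_def chart_preimage_def)
  have L_closed: "closed L" by (rule compact_imp_closed[OF L(1)])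
  obtain C where C: "C > 0"
    "\<And>w x e. \<lbrakk>Ck_fun A 2 w; x \<in> L; \<And>i. \<bar>partial i (in_coords c w) (chart_map c x)\<bar> \<le> e;
      \<And>i j. \<bar>partial i (partial j (in_coords c w)) (chart_map c x)\<bar> \<le> e\<rbrakk>
      \<Longrightarrow> ?H w x \<le> C * e"
    using hessian_norm_bound_on_compact[OF c L] by metis
  define V where "V = measure vol L"
  have V: "V \<ge> 0" "emeasure vol L = ennreal V"
    using finite_volume_compact[OF L(1)] by (auto simp: V_def emeasure_eq_ennreal_measure less_top)
  \<comment> \<open>One constant for both estimates: the function needs the factor 1, the Hessian
    the factor \<open>C\<close>.\<close>
  define C' where "C' = max 1 C"
  \<comment> \<open>Solves (C' e)^p (V + 1) = \<epsilon>; the summand 1 avoids a division by zero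
    when \<open>V = 0\<close>.\<close>
  define e where "e = (\<epsilon> / (V + 1)) powr (1 / p) / C'"
  have C': "C' \<ge> 1" "C' \<ge> C" by (auto simp: C'_def)
  have e: "e > 0" using \<epsilon> V C' by (auto simp: e_def)
  have "(C' * e) powr p = \<epsilon> / (V + 1)"
    using C' \<epsilon> V p by (simp add: e_def powr_powr)
  then have "(C' * e) powr p + (C' * e) powr p * V = \<epsilon>"
    using V by (simp add: field_simps)
  then have "(C' * e) powr p * V \<le> \<epsilon>"
    using powr_ge_zero[of "C' * e" p] by linarith
  then have small: "ennreal ((C' * e) powr p) * emeasure vol L \<le> ennreal \<epsilon>"
    using V by (simp add: ennreal_leI flip: ennreal_mult)
  obtain H where H: "\<And>k. Ck_on k H UNIV" "\<And>y. (\<And>x. x \<in> K \<Longrightarrow> \<delta> < dist x y) \<Longrightarrow> H y = 0"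
    "\<And>y. \<bar>F y - H y\<bar> \<le> e" "\<And>i y. \<bar>partial i F y - partial i H y\<bar> \<le> e"
    "\<And>i j y. \<bar>partial i (partial j F) y - partial i (partial j H) y\<bar> \<le> e"
    using C2_smooth_approximation[OF F K(1) F_supp e \<delta>(1)] by metis
  have H_supp: "{y. H y \<noteq> 0} \<subseteq> K'"
    using H(2) unfolding K'_def by (force simp: not_less)
  define v where "v = extend_by_zero c H"
  have v: "smooth_compact_support A v"
  proof (rule smooth_compact_supportI)
    show "Ck_fun A k v" for k
      unfolding v_def by (rule Ck_fun_extend_by_zero[OF c K'(1,2) H(1) H_supp])
    show "{x. v x \<noteq> 0} \<subseteq> L"
      unfolding v_def L_def by (rule extend_by_zero_support[OF H_supp])
  qed (rule L(1))
  let ?r = "\<lambda>x. w x - v x"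
  have r: "Ck_fun A 2 ?r" by (intro Ck_fun_diff w smooth_C2 v)
  have r_out: "?r x = 0" if "x \<notin> L" for x
  proof -
    have "chart_preimage c K \<subseteq> L"
      using K'(3) by (auto simp: L_def chart_preimage_def)
    then have "w x = 0" using supp that by blast
    moreover have "v x = 0"
      using extend_by_zero_support[OF H_supp, of c] that unfolding v_def L_def by blast
    ultimately show ?thesis by simp
  qed
  have r_coords: "in_coords c ?r z = F z - H z" if "z \<in> ?\<Omega>" for z
    using that c by (auto simp: F_chart v_def extend_by_zero_def)
  have dF: "F differentiable (at z)" "partial i F differentiable (at z)" for z i
    using Ck_on_2D(1,2)[OF F] by (auto simp: differentiable_on_open_iff)
  have dH: "H differentiable (at z)" "partial i H differentiable (at z)" for z i
    using Ck_on_2D(1,2)[OF H(1)] by (auto simp: differentiable_on_open_iff)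
  have p1: "partial i (in_coords c ?r) z = partial i F z - partial i H z" if "z \<in> ?\<Omega>" for i z
    using partial_cong_open[OF open_image[OF c] that r_coords] by (simp add: partial_diff dF dH)
  have p2: "partial i (partial j (in_coords c ?r)) z = partial i (partial j F) z - partial i (partial j H) z"
    if "z \<in> ?\<Omega>" for i j z
    using partial_cong_open[OF open_image[OF c] that p1] by (simp add: partial_diff dF dH)
  have r_le: "\<bar>?r x\<bar> \<le> C' * e" if "x \<in> L" for x
  proof -
    have "\<bar>?r x\<bar> \<le> e"
      using H(3)[of "chart_map c x"] that L(2) by (auto simp: F_chart v_def extend_by_zero_def)
    also have "\<dots> \<le> C' * e" using C' e by simp
    finally show ?thesis .
  qed
  have hess_le: "\<bar>?H ?r x\<bar> \<le> C' * e" if "x \<in> L" for x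
  proof -
    have z: "chart_map c x \<in> ?\<Omega>" using that L(2) by blast
    have "?H ?r x \<le> C * e"
      by (rule C(2)[OF r that]) (simp_all add: p1[OF z] p2[OF z] H)
    also have "\<dots> \<le> C' * e" using C' e by simp
    finally show ?thesis by (simp add: hessian_norm_nonneg)
  qed
  have hess_out: "?H ?r x = 0" if "x \<notin> L" for x
    by (rule hessian_norm_zero[of "- L"]) (use that L_closed r_out in \<open>auto simp: open_Compl\<close>)
  have sL: "L \<in> sets vol" using L_closed by (simp add: sets_vol)
  show "\<exists>v. smooth_compact_support A v \<and>
    ?I (\<lambda>x. w x - v x) \<le> ennreal \<epsilon> \<and>
    ?I (?H (\<lambda>x. w x - v x)) \<le> ennreal \<epsilon>"
  proof (intro exI[of _ v] conjI v)
    have "?I ?r \<le> ennreal ((C' * e) powr p) * emeasure vol L"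
      by (rule power_integral_bounded_support[OF p _ _ sL], rule r_le, assumption, rule r_out, assumption)
    then show "?I ?r \<le> ennreal \<epsilon>" using small by (rule order_trans)
    have "?I (?H ?r) \<le> ennreal ((C' * e) powr p) * emeasure vol L"
      by (rule power_integral_bounded_support[OF p _ _ sL], rule hess_le, assumption, rule hess_out, assumption)
    then show "?I (?H ?r) \<le> ennreal \<epsilon>" using small by (rule order_trans)
  qed
qed

text \<open>The factor 1 - b vanishes on the neighbourhood where b = 1, so each splitting removes
  one set from the finite cover of the support. No division by a sum of bump functions
  occurs.\<close>

lemma approximable_compact_support:
  assumes p: "p > 0" and w: "Ck_fun A 2 w" and K: "compact K" "{x. w x \<noteq> 0} \<subseteq> K"
  shows "approximable p w"
proof -
  have "\<exists>b U c K. (\<forall>k. Ck_fun A k b) \<and> open U \<and> x \<in> U \<and> (\<forall>y\<in>U. b y = 1) \<and>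
      c \<in> A \<and> compact K \<and> K \<subseteq> chart_image c \<and> {y. b y \<noteq> 0} \<subseteq> chart_preimage c K" for x
    by (rule local_bump[of x]) blast
  then obtain b U c L where b: "\<And>x k. Ck_fun A k (b x)" "\<And>x. open (U x)" "\<And>x. x \<in> U x"
      "\<And>x y. y \<in> U x \<Longrightarrow> b x y = 1" "\<And>x. c x \<in> A" "\<And>x. compact (L x)"
      "\<And>x. L x \<subseteq> chart_image (c x)" "\<And>x. {y. b x y \<noteq> 0} \<subseteq> chart_preimage (c x) (L x)"
    by metis
  obtain X where X: "finite X" "K \<subseteq> (\<Union>x\<in>X. U x)"
    using compactE_image[OF K(1), of UNIV U] b(2,3) by (metis UNIV_I UN_I subsetI)
  \<comment> \<open>The form of the support condition that survives the induction, in which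
    \<open>w\<close> varies.\<close>
  have "{x. w x \<noteq> 0} \<subseteq> (\<Union>x\<in>X. U x)" using K(2) X(2) by blast
  with X(1) w show ?thesis
  proof (induction X arbitrary: w rule: finite_induct)
    case empty
    then have "w = (\<lambda>_. 0)" by auto
    moreover have "smooth_compact_support A (\<lambda>_. 0)"
      by (rule smooth_compact_supportI[of _ "{}"]) (auto simp: Ck_fun_const)
    moreover have "hessian_norm A g (\<lambda>_. 0) = (\<lambda>_. 0)"
      using hessian_norm_zero[of UNIV _ "\<lambda>_. 0"] by auto
    ultimately show ?case
      unfolding approximable_def
      by (auto intro!: exI[of _ "\<lambda>_. 0"] simp: power_integral_def)
  next
    case (insert x X)
    have C2: "Ck_fun A 2 (\<lambda>y. b x y * w y)" "Ck_fun A 2 (\<lambda>y. (1 - b x y) * w y)"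
      by (intro Ck_fun_mult Ck_fun_diff Ck_fun_const b insert.prems)+
    have "approximable p (\<lambda>y. b x y * w y)"
      by (rule approximable_in_chart[OF p C2(1) b(5)[of x] b(6)[of x] b(7)[of x]]) (use b(8)[of x] in auto)
    moreover have "approximable p (\<lambda>y. (1 - b x y) * w y)"
      by (rule insert.IH[OF C2(2)]) (use insert.prems(2) b(4)[of _ x] in auto)
    ultimately have "approximable p (\<lambda>y. b x y * w y + (1 - b x y) * w y)"
      by (intro approximable_add[OF p C2])
    then show ?case by (simp add: algebra_simps)
  qed
qed

section \<open>The Calderon--Zygmund inequality and the conclusion\<close>

text \<open>In this direction the default value 0 of the Bochner integral is harmless. The lemma
  serves the right-hand side of \<open>CZ\<close>, where it spares a proof that the powers of the
  Laplacian are integrable.\<close>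

lemma ennreal_integral_le_nn_integral:
  assumes "\<And>x. f x \<ge> 0"
  shows "ennreal (LINT x|M. f x) \<le> (\<integral>\<^sup>+x. ennreal (f x) \<partial>M)"
proof (cases "integrable M f")
  case True
  then show ?thesis using assms by (subst nn_integral_eq_integral) auto
next
  case False
  then show ?thesis by (simp add: not_integrable_integral_eq)
qed

text \<open>A bound between the \<open>p\<close>-th powers, with extended values: here the Bochner integral must not
  take its junk value 0 for \<open>hessian_norm A g v\<close>, which is continuous with compact support.\<close>

lemma CZ_power_integral:
  assumes p: "p > 1" and CZ: "CZ A g p"
  obtains C where "C \<ge> 0" "\<And>v. smooth_compact_support A v \<Longrightarrow>
    power_integral p vol (hessian_norm A g v)
      \<le> ennreal C * (power_integral p vol v + power_integral p vol (laplacian A g v))"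
proof -
  obtain C1 C2 where C12: "C1 \<ge> 0" "C2 > 0" and CZ: "\<And>v. smooth_compact_support A v \<Longrightarrow>
    Lp_norm p vol (hessian_norm A g v) \<le> C1 * Lp_norm p vol v + C2 * Lp_norm p vol (laplacian A g v)"
    using CZ unfolding CZ_def by blast
  define C where "C = 2 powr p * max (C1 powr p) (C2 powr p)"
  have Lp: "Lp_norm p vol f powr p = (LINT x|vol. \<bar>f x\<bar> powr p)" "Lp_norm p vol f \<ge> 0" for f
    using p by (simp_all add: Lp_norm_def powr_powr)
  show thesis
  proof
    show "C \<ge> 0" by (simp add: C_def le_max_iff_disj)
    fix v assume v: "smooth_compact_support A v"
    let ?H = "hessian_norm A g v"
    define K where "K = closure {x. v x \<noteq> 0}"
    have K: "compact K" using v by (simp add: K_def smooth_compact_support_def)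
    have cH: "continuous_on UNIV ?H" by (rule continuous_on_hessian_norm[OF smooth_C2[OF v]])
    have out: "?H x = 0" if "x \<notin> K" for x
      using that closure_subset[of "{x. v x \<noteq> 0}"]
      by (intro hessian_norm_zero[of "- K"]) (auto simp: K_def open_Compl)
    have "bounded (?H ` K)"
      using K cH by (meson compact_continuous_image compact_imp_bounded continuous_on_subset subset_UNIV)
    then obtain k where "\<forall>y\<in>?H ` K. norm y \<le> k" unfolding bounded_iff by blast
    then have k: "\<bar>?H x\<bar> \<le> k" if "x \<in> K" for x using that by auto
    have "power_integral p vol ?H \<le> ennreal (k powr p) * emeasure vol K"
      by (rule power_integral_bounded_support[OF _ k out]) (use p K in \<open>auto simp: sets_vol compact_imp_closed\<close>)
    also have "\<dots> < \<infinity>"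
      using finite_volume_compact[OF K] by (simp add: ennreal_mult_less_top)
    finally have "in_Lp p vol ?H"
      by (simp add: in_Lp_iff borel_measurable_vol_continuous[OF cH])
    then have int: "integrable vol (\<lambda>x. \<bar>?H x\<bar> powr p)" by (simp add: in_Lp_def)
    let ?a = "Lp_norm p vol v" and ?b = "Lp_norm p vol (laplacian A g v)"
    have "(LINT x|vol. \<bar>?H x\<bar> powr p) \<le> (C1 * ?a + C2 * ?b) powr p"
      unfolding Lp(1)[symmetric] using p CZ[OF v] Lp(2) by (intro powr_mono2) auto
    also have "\<dots> \<le> 2 powr p * ((C1 * ?a) powr p + (C2 * ?b) powr p)"
      using C12 p Lp(2) by (intro powr_add_le) auto
    also have "\<dots> = 2 powr p * (C1 powr p * ?a powr p + C2 powr p * ?b powr p)"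
      using C12 Lp(2) by (simp add: powr_mult)
    also have "\<dots> \<le> 2 powr p * (max (C1 powr p) (C2 powr p) * ?a powr p + max (C1 powr p) (C2 powr p) * ?b powr p)"
      by (intro mult_left_mono add_mono mult_right_mono) auto
    also have "\<dots> = C * (?a powr p + ?b powr p)" by (simp add: C_def algebra_simps)
    finally have le: "(LINT x|vol. \<bar>?H x\<bar> powr p)
        \<le> C * ((LINT x|vol. \<bar>v x\<bar> powr p) + (LINT x|vol. \<bar>laplacian A g v x\<bar> powr p))"
      unfolding Lp(1) .
    have "power_integral p vol ?H = ennreal (LINT x|vol. \<bar>?H x\<bar> powr p)"
      unfolding power_integral_def by (rule nn_integral_eq_integral[OF int]) simp
    also have "\<dots> \<le> ennreal (C * ((LINT x|vol. \<bar>v x\<bar> powr p) + (LINT x|vol. \<bar>laplacian A g v x\<bar> powr p)))"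
      by (rule ennreal_leI[OF le])
    also have "\<dots> = ennreal C * (ennreal (LINT x|vol. \<bar>v x\<bar> powr p) + ennreal (LINT x|vol. \<bar>laplacian A g v x\<bar> powr p))"
      using \<open>C \<ge> 0\<close> by (simp add: ennreal_mult ennreal_plus)
    also have "\<dots> \<le> ennreal C * (power_integral p vol v + power_integral p vol (laplacian A g v))"
      unfolding power_integral_def by (intro mult_left_mono add_mono ennreal_integral_le_nn_integral) auto
    finally show "power_integral p vol ?H
      \<le> ennreal C * (power_integral p vol v + power_integral p vol (laplacian A g v))" .
  qed
qed

end

theorem proposition3p10:
  fixes A :: "('a::{t2_space,second_countable_topology}, 'n::finite) chart set"
    and g :: "('a, 'n) tensor2"
    and p :: real
    and u f :: "'a \<Rightarrow> real"
  assumes "1 < p"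
    and "riemannian_manifold A g"
    and "CZ A g p"
    and "\<exists>\<eta>. hessian_cutoffs A g \<eta>"
    and "Ck_fun A 2 u"
    and "\<forall>x. laplacian A g u x = f x"
    and "in_Lp p (riemannian_volume A g) u"
    and "in_Lp p (riemannian_volume A g) (gradient_norm A g u)"
    and "in_Lp p (riemannian_volume A g) f"
  shows "in_Lp p (riemannian_volume A g) (hessian_norm A g u)"
proof -
  interpret riemannian A g by unfold_locales fact
  have p: "p > 0" using assms(1) by simp
  note u = \<open>Ck_fun A 2 u\<close>
  let ?I = "power_integral p vol" and ?H = "hessian_norm A g" and ?G = "differential_norm A g" and ?\<Delta> = "laplacian A g"
  let ?N = "norm (mat 1 :: real^'n^'n)"
  define D where "D = ?G u"
  have D_grad: "gradient_norm A g u = D" by (auto simp: D_def gradient_norm_eq)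
  have D0: "D x \<ge> 0" for x by (simp add: D_def covector_norm_frame)
  have um: "u \<in> borel_measurable vol" "?I u < \<infinity>"
    and Dm [measurable]: "D \<in> borel_measurable vol" and Di: "?I D < \<infinity>"
    and fm [measurable]: "f \<in> borel_measurable vol" and fi: "?I f < \<infinity>"
    using assms(7-9) unfolding D_grad in_Lp_iff by auto
  note um(1) [measurable]
  have fin_add: "?I (\<lambda>x. \<bar>a x\<bar> + \<bar>b x\<bar>) < \<infinity>"
    if "a \<in> borel_measurable vol" "b \<in> borel_measurable vol" "?I a < \<infinity>" "?I b < \<infinity>" for a b
  proof -
    have "?I (\<lambda>x. \<bar>a x\<bar> + \<bar>b x\<bar>) \<le> ennreal (2 powr p) * (?I a + ?I b)"
      using that by (intro power_integral_add_le p) auto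
    also have "\<dots> < \<infinity>" using that by (simp add: ennreal_mult_less_top ennreal_add_less_top)
    finally show ?thesis .
  qed
  have fin_cmult: "?I (\<lambda>x. k * a x) < \<infinity>" if "a \<in> borel_measurable vol" "?I a < \<infinity>" for a k
    using that by (simp add: power_integral_cmult ennreal_mult_less_top)
  \<comment> \<open>Dominates the lower order terms of the product rule for \<eta>_n u as soon as
    the differential and the Hessian of \<eta>_n have norm at most 1.\<close>
  define R where "R x = 2 * D x + \<bar>u x\<bar>" for x
  have Rm [measurable]: "R \<in> borel_measurable vol" unfolding R_def by measurable
  have R0: "R x \<ge> 0" for x using D0[of x] by (simp add: R_def)
  have Ri: "?I R < \<infinity>"
    using fin_add[of "\<lambda>x. 2 * D x" u] fin_cmult[OF Dm Di, of 2] um D0 by (simp add: R_def[abs_def])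
  \<comment> \<open>Dominates the Laplacian of \<eta>_n u under the same condition on
    \<eta>_n.\<close>
  define Q where "Q x = \<bar>f x\<bar> + \<bar>?N * R x\<bar>" for x
  have Qm [measurable]: "Q \<in> borel_measurable vol" unfolding Q_def by measurable
  have Qi: "?I Q < \<infinity>"
    unfolding Q_def by (rule fin_add[OF fm _ fi fin_cmult[OF Rm Ri]]) measurable
  obtain C where C: "C \<ge> 0" "\<And>v. smooth_compact_support A v \<Longrightarrow>
    ?I (?H v) \<le> ennreal C * (?I v + ?I (?\<Delta> v))"
    using CZ_power_integral[OF assms(1,3)] by metis
  define P where "P = ennreal (2 powr p)"
  \<comment> \<open>The right-hand side that results from the estimates in \<open>bound\<close>,
    with both approximation errors replaced by 1; its point is to be finite and independent of
    n.\<close>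
  define T where "T = P * (P * (ennreal C * (P * (?I u + 1) + P * (?I Q + ennreal (\<bar>?N\<bar> powr p) * 1)) + 1) + ?I R)"
  have T: "T < \<infinity>"
    unfolding T_def P_def using um(2) Qi Ri by (simp add: ennreal_mult_less_top ennreal_add_less_top)
  obtain \<eta> where \<eta>: "hessian_cutoffs A g \<eta>" using assms(4) by blast
  have \<eta>s: "smooth_compact_support A (\<eta> n)" and \<eta>01: "0 \<le> \<eta> n x" "\<eta> n x \<le> 1" for n x
    using \<eta> by (auto simp: hessian_cutoffs_def)
  have \<eta>2: "Ck_fun A 2 (\<eta> n)" for n by (rule smooth_C2[OF \<eta>s])
  \<comment> \<open>The threshold 1 corresponds to the coefficients chosen in
    \<open>R\<close>.\<close>
  have small: "eventually (\<lambda>n. \<forall>x. F n x \<le> 1) sequentially"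
    if "(\<lambda>n. SUP x. ennreal (F n x)) \<longlonglongrightarrow> 0" for F :: "nat \<Rightarrow> 'a \<Rightarrow> real"
  proof -
    have "eventually (\<lambda>n. (SUP x. ennreal (F n x)) < 1) sequentially"
      using order_tendstoD(2)[OF that, of 1] by simp
    then show ?thesis
    proof (rule eventually_mono, intro allI)
      fix n x assume "(SUP x. ennreal (F n x)) < 1"
      then have "ennreal (F n x) < 1" by (meson SUP_upper UNIV_I order_le_less_trans)
      then show "F n x \<le> 1"
        by (metis ennreal_1 ennreal_leI linorder_le_cases order_less_le_trans order_less_irrefl)
    qed
  qed
  have bound: "?I (\<lambda>x. \<eta> n x * ?H u x) \<le> T"
    if d1: "\<forall>x. ?G (\<eta> n) x \<le> 1" and h1: "\<forall>x. ?H (\<eta> n) x \<le> 1" for n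
  proof -
    define w where "w = (\<lambda>x. \<eta> n x * u x)"
    have w: "Ck_fun A 2 w" unfolding w_def by (rule Ck_fun_mult[OF \<eta>2 u])
    have "approximable p w"
    proof (rule approximable_compact_support[OF p w])
      show "compact (closure {x. \<eta> n x \<noteq> 0})" using \<eta>s[of n] by (simp add: smooth_compact_support_def)
      show "{x. w x \<noteq> 0} \<subseteq> closure {x. \<eta> n x \<noteq> 0}"
        using closure_subset[of "{x. \<eta> n x \<noteq> 0}"] by (auto simp: w_def)
    qed
    \<comment> \<open>The function \<open>v\<close> depends on n, but with the fixed error 1 the
      final bound does not.\<close>
    then obtain v where v: "smooth_compact_support A v"
      "?I (\<lambda>x. w x - v x) \<le> 1" "?I (?H (\<lambda>x. w x - v x)) \<le> 1"
      unfolding approximable_def by (metis ennreal_1 zero_less_one)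
    define r where "r = (\<lambda>x. w x - v x)"
    note v2 = smooth_C2[OF v(1)]
    have r: "Ck_fun A 2 r" unfolding r_def by (rule Ck_fun_diff[OF w v2])
    have w_eq: "w = (\<lambda>x. v x + r x)" by (auto simp: r_def)
    have [measurable]: "r \<in> borel_measurable vol" "?H r \<in> borel_measurable vol"
      "?H v \<in> borel_measurable vol"
      by (intro borel_measurable_vol_continuous continuous_on_hessian_norm continuous_on_fun[OF r] r v2)+
    have cross: "2 * ?G (\<eta> n) x * D x + \<bar>u x\<bar> * ?H (\<eta> n) x \<le> R x" for x
      using mult_right_mono[OF d1[rule_format, of x], of "2 * D x"] D0[of x]
        mult_left_mono[OF h1[rule_format, of x], of "\<bar>u x\<bar>"] by (simp add: R_def)
    have hess: "\<eta> n x * ?H u x \<le> (?H v x + ?H r x) + R x" for x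
      using hessian_norm_mult_ge[OF \<eta>2[of n] u, of x] cross[of x] hessian_norm_add_le[OF v2 r, of x] \<eta>01(1)[of n x]
      unfolding w_def[symmetric] D_def[symmetric] w_eq[symmetric] by simp
    \<comment> \<open>The Laplacian of \<open>v\<close> is that of \<eta>_n u minus that of
      \<open>r\<close>, and the latter is at most a constant times the Hessian of
      \<open>r\<close>.\<close>
    have lap: "\<bar>?\<Delta> v x\<bar> \<le> Q x + ?N * ?H r x" for x
    proof -
      have "\<bar>?\<Delta> w x\<bar> \<le> \<bar>\<eta> n x\<bar> * \<bar>f x\<bar> + ?N * (2 * ?G (\<eta> n) x * D x + \<bar>u x\<bar> * ?H (\<eta> n) x)"
        using laplacian_mult_le[OF \<eta>2[of n] u, of x] assms(6) unfolding w_def[symmetric] D_def[symmetric] by simp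
      also have "\<dots> \<le> 1 * \<bar>f x\<bar> + ?N * R x"
        using \<eta>01[of n x] cross[of x] by (intro add_mono mult_right_mono mult_left_mono) auto
      also have "\<dots> = Q x" using R0[of x] by (simp add: Q_def abs_mult)
      finally have "\<bar>?\<Delta> w x\<bar> \<le> Q x" .
      moreover have "?\<Delta> w x = ?\<Delta> v x + ?\<Delta> r x"
        unfolding w_eq by (rule laplacian_add[OF v2 r])
      ultimately show ?thesis using laplacian_le[of r x] by linarith
    qed
    have "?I v \<le> P * (?I u + ?I r)"
      unfolding P_def
    proof (rule power_integral_add_le[OF p])
      show "\<bar>v x\<bar> \<le> \<bar>u x\<bar> + \<bar>r x\<bar>" for x
      proof -
        have "\<bar>w x\<bar> \<le> \<bar>u x\<bar>"
          using \<eta>01[of n x] by (simp add: w_def abs_mult mult_left_le_one_le)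
        then show ?thesis by (simp add: r_def)
      qed
    qed measurable
    also have "\<dots> \<le> P * (?I u + 1)"
      using v(2) by (intro mult_left_mono add_mono) (auto simp: r_def)
    finally have Iv: "?I v \<le> P * (?I u + 1)" .
    have "?I (?\<Delta> v) \<le> P * (?I Q + ?I (\<lambda>x. ?N * ?H r x))"
      unfolding P_def
    proof (rule power_integral_add_le[OF p])
      show "\<bar>?\<Delta> v x\<bar> \<le> \<bar>Q x\<bar> + \<bar>?N * ?H r x\<bar>" for x
        using lap[of x] by linarith
    qed measurable
    also have "\<dots> = P * (?I Q + ennreal (\<bar>?N\<bar> powr p) * ?I (?H r))"
      by (subst power_integral_cmult) measurable
    also have "\<dots> \<le> P * (?I Q + ennreal (\<bar>?N\<bar> powr p) * 1)"
      by (intro mult_left_mono add_mono v(3)[folded r_def]) auto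
    finally have Il: "?I (?\<Delta> v) \<le> P * (?I Q + ennreal (\<bar>?N\<bar> powr p) * 1)" .
    have "?I (\<lambda>x. \<eta> n x * ?H u x)
        \<le> P * (?I (\<lambda>x. ?H v x + ?H r x) + ?I R)"
      unfolding P_def
    proof (rule power_integral_add_le[OF p])
      show "\<bar>\<eta> n x * ?H u x\<bar> \<le> \<bar>?H v x + ?H r x\<bar> + \<bar>R x\<bar>" for x
        using hess[of x] \<eta>01(1)[of n x] hessian_norm_nonneg[of u x] by simp
    qed measurable
    \<comment> \<open>From here on each bound is substituted inside the preceding right-hand side;
      the monotonicity conditions collected by \<open>also\<close> are discharged by the
      \<open>simp\<close> after \<open>finally\<close>.\<close>
    also have "?I (\<lambda>x. ?H v x + ?H r x) \<le> P * (?I (?H v) + ?I (?H r))"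
      unfolding P_def by (intro power_integral_add_le p abs_triangle_ineq) measurable
    also have "?I (?H v) \<le> ennreal C * (?I v + ?I (?\<Delta> v))"
      by (rule C(2)[OF v(1)])
    also note Iv
    also note Il
    also have "?I (?H r) \<le> 1" using v(3) by (simp add: r_def)
    finally show ?thesis
      unfolding T_def by (simp add: mult_left_mono add_mono)
  qed
  have ev: "eventually (\<lambda>n. ?I (\<lambda>x. \<eta> n x * ?H u x) \<le> T) sequentially"
  proof (rule eventually_elim2)
    show "eventually (\<lambda>n. \<forall>x. ?G (\<eta> n) x \<le> 1) sequentially"
      "eventually (\<lambda>n. \<forall>x. ?H (\<eta> n) x \<le> 1) sequentially"
      using \<eta> unfolding hessian_cutoffs_def by (auto intro: small)
  qed (rule bound)
  have Hm [measurable]: "?H u \<in> borel_measurable vol"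
    by (intro borel_measurable_vol_continuous continuous_on_hessian_norm u)
  have \<eta>m [measurable]: "\<eta> n \<in> borel_measurable vol" for n
    by (intro borel_measurable_vol_continuous continuous_on_fun[OF \<eta>2])
  \<comment> \<open>At each point the integrands are eventually constant, as the singleton is
    compact and hence \<eta>_n is eventually 1 on it. This brings the integral into the form
    required by Fatou's lemma.\<close>
  have "?I (?H u)
      = (\<integral>\<^sup>+x. liminf (\<lambda>n. ennreal (\<bar>\<eta> n x * ?H u x\<bar> powr p)) \<partial>vol)"
    unfolding power_integral_def
  proof (rule nn_integral_cong)
    fix x
    have "\<exists>n0. \<forall>n\<ge>n0. \<eta> n x = 1"
      using \<eta> compact_sing[of x] unfolding hessian_cutoffs_def by (metis singletonI)
    then have "eventually (\<lambda>n. \<eta> n x = 1) sequentially"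
      by (simp add: eventually_sequentially)
    then have "(\<lambda>n. ennreal (\<bar>\<eta> n x * ?H u x\<bar> powr p)) \<longlonglongrightarrow> ennreal (\<bar>?H u x\<bar> powr p)"
      by (intro tendsto_eventually) (auto elim: eventually_mono)
    from lim_imp_Liminf[OF sequentially_bot this]
    show "ennreal (\<bar>?H u x\<bar> powr p) = liminf (\<lambda>n. ennreal (\<bar>\<eta> n x * ?H u x\<bar> powr p))" ..
  qed
  also have "\<dots> \<le> liminf (\<lambda>n. ?I (\<lambda>x. \<eta> n x * ?H u x))"
    unfolding power_integral_def by (intro nn_integral_liminf) measurable
  also have "\<dots> \<le> T" by (rule Liminf_le[OF _ ev]) simp
  finally show ?thesis
    using T Hm by (simp add: in_Lp_iff order_le_less_trans)
qed

end
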